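(* The problem $k,e$-Long Cycle in an $n$-vertex bipartite undirected graph can be solved in $2^{k/2}\operatorname{poly}(n)$ time.
   Context: The $k,e$-Long Cycle problem: given an $n$-vertex undirected graph $G$, a specified edge $e$ of $G$, and a positive integer $k$, decide whether $G$ has a simple cycle passing through $e$ whose length (number of edges) is at least $k$. Here "solved" is understood as by an algorithm deciding the problem, where randomised (Monte Carlo, i.e. correct with high/constant probability) algorithms are allowed, as the paper's algorithms are randomised. *)

theory Defs
  imports
    "HOL-Probability.SPMF"
    "HOL-Library.Discrete_Functions"
    "HOL-Computational_Algebra.Polynomial"
    "Graph_Theory.Pair_Digraph"
begin

section \<open>Graphs and the decision problem\<close>

text \<open>
  A finite simple undirected graph is a \<^locale>\<open>pair_graph\<close>: an undirected edge is represented
  by its two orientations.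
\<close>

definition bipartite :: "'a pair_pre_digraph \<Rightarrow> bool" where
  "bipartite G \<longleftrightarrow> (\<exists>A B. pverts G = A \<union> B \<and> A \<inter> B = {} \<and> parcs G \<subseteq> A \<times> B \<union> B \<times> A)"

text \<open>
  The notion \<^const>\<open>pre_digraph.cycle\<close> is directed and so admits walking an edge back and forth,
  which is not a cycle of the undirected graph; \<open>3 \<le> length p\<close> excludes exactly these walks,
  since there are no loops.
\<close>

definition simple_cycle :: "'a pair_pre_digraph \<Rightarrow> ('a \<times> 'a) awalk \<Rightarrow> bool" where
  "simple_cycle G p \<longleftrightarrow> pre_digraph.cycle (with_proj G) p \<and> 3 \<le> length p"

definition long_cycle_through :: "'a pair_pre_digraph \<Rightarrow> 'a \<times> 'a \<Rightarrow> nat \<Rightarrow> bool" where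
  "long_cycle_through G e k \<longleftrightarrow>
     (\<exists>p. simple_cycle G p \<and> (e \<in> set p \<or> (snd e, fst e) \<in> set p) \<and> k \<le> length p)"


section \<open>Randomised random access machines with logarithmic cost\<close>

text \<open>
  Programs are finite terms of a while language over finitely many named, unbounded arrays of
  natural numbers; scalars are the cells with index 0.  Time is measured by the logarithmic cost
  criterion: every operation costs the number of binary digits of the addresses and values that it
  touches, and multiplication and division are charged at schoolbook cost.
\<close>

datatype binop = Add | Sub | Mul | Div | Mod | And | Or | Xor | Less | Equal

datatype expr = Lit nat | Load string expr | Bin binop expr expr

datatype com =
    Skip
  | Store string expr expr
  | Toss string expr
  | Seq com com
  | If expr com com
  | While expr com

type_synonym memory = "string \<Rightarrow> nat \<Rightarrow> nat"

fun apply_binop :: "binop \<Rightarrow> nat \<Rightarrow> nat \<Rightarrow> nat" where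
  "apply_binop Add a b = a + b"
| "apply_binop Sub a b = a - b"
| "apply_binop Mul a b = a * b"
| "apply_binop Div a b = a div b"
| "apply_binop Mod a b = a mod b"
| "apply_binop And a b = Bit_Operations.and a b"
| "apply_binop Or a b = Bit_Operations.or a b"
| "apply_binop Xor a b = Bit_Operations.xor a b"
| "apply_binop Less a b = of_bool (a < b)"
| "apply_binop Equal a b = of_bool (a = b)"

definition bit_length :: "nat \<Rightarrow> nat" where
  "bit_length a = Suc (floor_log a)"

definition binop_cost :: "binop \<Rightarrow> nat \<Rightarrow> nat \<Rightarrow> nat" where
  "binop_cost f a b =
     (if f \<in> {Mul, Div, Mod} then bit_length a * bit_length b else bit_length a + bit_length b)"

primrec eval_expr :: "expr \<Rightarrow> memory \<Rightarrow> nat" where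
  "eval_expr (Lit c) s = c"
| "eval_expr (Load x i) s = s x (eval_expr i s)"
| "eval_expr (Bin f a b) s = apply_binop f (eval_expr a s) (eval_expr b s)"

primrec expr_cost :: "expr \<Rightarrow> memory \<Rightarrow> nat" where
  "expr_cost (Lit c) s = bit_length c"
| "expr_cost (Load x i) s =
     expr_cost i s + bit_length (eval_expr i s) + bit_length (s x (eval_expr i s))"
| "expr_cost (Bin f a b) s =
     expr_cost a s + expr_cost b s + binop_cost f (eval_expr a s) (eval_expr b s)"

definition update :: "memory \<Rightarrow> string \<Rightarrow> nat \<Rightarrow> nat \<Rightarrow> memory" where
  "update s x i v = s(x := (s x)(i := v))"

definition charge :: "nat \<Rightarrow> (memory \<times> nat) spmf \<Rightarrow> (memory \<times> nat) spmf" where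
  "charge c = map_spmf (\<lambda>(s, t). (s, c + t))"

lemma charge_mono [partial_function_mono]:
  "mono_spmf B \<Longrightarrow> mono_spmf (\<lambda>g. charge c (B g))"
  unfolding charge_def by (rule map_spmf_mono)

partial_function (spmf) run_while ::
  "expr \<Rightarrow> (memory \<Rightarrow> (memory \<times> nat) spmf) \<Rightarrow> memory \<Rightarrow> (memory \<times> nat) spmf" where
  "run_while b body s = charge (expr_cost b s)
     (if eval_expr b s = 0 then return_spmf (s, 0)
      else bind_spmf (body s) (\<lambda>(s', t). charge t (run_while b body s')))"

text \<open>
  The semantics is the joint subdistribution of the final memory and the total cost; the missing
  mass is the probability of divergence.
\<close>

primrec run :: "com \<Rightarrow> memory \<Rightarrow> (memory \<times> nat) spmf" where
  "run Skip s = return_spmf (s, 1)"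
| "run (Store x i e) s = return_spmf
     (update s x (eval_expr i s) (eval_expr e s),
      expr_cost i s + expr_cost e s + bit_length (eval_expr i s) + bit_length (eval_expr e s))"
| "run (Toss x i) s = map_spmf
     (\<lambda>b. (update s x (eval_expr i s) (of_bool b), expr_cost i s + bit_length (eval_expr i s) + 1))
     coin_spmf"
| "run (Seq c d) s = bind_spmf (run c s) (\<lambda>(s', t). charge t (run d s'))"
| "run (If b c d) s = charge (expr_cost b s) (if eval_expr b s \<noteq> 0 then run c s else run d s)"
| "run (While b c) s = run_while b (run c) s"

definition accepts :: "memory \<Rightarrow> bool" where
  "accepts s \<longleftrightarrow> s ''out'' 0 = 1"

text \<open>
  Monte Carlo decision within a time bound.  Losslessness together with the bound on the support
  means that every run halts within time \<open>T\<close>, whatever the outcome of the coin tosses.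
\<close>

definition decides_within :: "com \<Rightarrow> memory \<Rightarrow> bool \<Rightarrow> real \<Rightarrow> bool" where
  "decides_within c s answer T \<longleftrightarrow>
     lossless_spmf (run c s) \<and>
     (\<forall>(s', t) \<in> set_spmf (run c s). real t \<le> T) \<and>
     measure (measure_spmf (run c s)) {(s', t). accepts s' \<longleftrightarrow> answer} \<ge> 2 / 3"


section \<open>Encoding of instances\<close>

text \<open>
  The graph, on the vertices \<open>0, \<dots>, n - 1\<close>, is given by its adjacency matrix in row-major order.
  No bipartition is supplied.
\<close>

definition encode_instance :: "nat pair_pre_digraph \<Rightarrow> nat \<times> nat \<Rightarrow> nat \<Rightarrow> memory" where
  "encode_instance G e k = (let n = card (pverts G) in (\<lambda>_ _. 0)
     (''n'' := (\<lambda>_. 0)(0 := n),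
      ''k'' := (\<lambda>_. 0)(0 := k),
      ''e'' := (\<lambda>_. 0)(0 := fst e, 1 := snd e),
      ''adj'' := (\<lambda>i. of_bool (i < n * n \<and> (i div n, i mod n) \<in> parcs G))))"

end

(*
  Let e = uv.  A cycle of length at least k through e is a simple path from v to u that contains at
  least K = max 2 (ceiling (k/2)) vertices of the side A of v.  Sum, over all walks of a fixed length
  from v to u and all placements of K labels on distinct steps, the product of a variable for every
  step and, for a label i on a step whose endpoint in A is w, a variable for the pair (w, i).  Over
  GF(2)[X] this is the coefficient of eps_0 ... eps_(K-1) in a walk sum with symmetric step weights
  a = x + z Y_w, where Y_w is a linear form in the eps_i and eps_i^2 = 0.

  Decomposing a walk at its last visit to the first vertex expresses the walk sum by simple paths and
  closed walks.  In characteristic 2 a closed walk cancels against its reversal, so closed walks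
  contribute squares only, and the squares of this algebra are scalars.  Since Y_w^2 = 0, every vertex
  of A on a simple path carries at most one label, so a nonzero sum yields a path with K vertices in
  A.  Conversely, for such a path some 0/1 point makes the sum equal to 1, and by the Schwartz-Zippel
  argument random values of the variables detect this.

  The machine computes in the natural numbers: a polynomial with coefficients below B = 2^b is
  represented by its value at B, and the coefficients modulo 2 are the parities of the digits in
  base B.  The table has 2^K times polynomially many entries.
*)
theory Submission
  imports Defs "HOL-Library.Z2" "HOL-Computational_Algebra.Formal_Power_Series" "HOL-Library.Nat_Bijection"
begin

section \<open>Square-free algebras\<close>

text \<open>A sum over walks can be computed step by step, a sum over simple paths cannot; the
  labels are there to make walks with repeated vertices drop out. As the sides alternate, marking
  one side suffices, and this halves the exponent. GF(2)[X] stands in for a finite field of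
  characteristic 2: it is an infinite domain, no irreducible polynomial has to be found, and the 2^m
  polynomials of degree below m serve as sample points. The price is the growth of intermediate
  results, governed by three constants: m = 4n brings the Schwartz-Zippel bound down to 1/3, B =
  2^(9n^2) exceeds all coefficients over the naturals, so that no carries occur, and D = 10n^2
  bounds the number of base-B digits. All stored numbers thus have O(n^4) bits.\<close>

typedef (overloaded) 'a sqfree = "{f :: nat set \<Rightarrow> 'a::zero. \<forall>I. infinite I \<longrightarrow> f I = 0}"
  morphisms coef Abs_sqfree
  by (rule exI[of _ "\<lambda>_. 0"]) simp

setup_lifting type_definition_sqfree

lemma coef_infinite [simp]: "infinite I \<Longrightarrow> coef f I = 0"
  using coef[of f] by simp

lemma sqfree_eqI: "(\<And>I. finite I \<Longrightarrow> coef f I = coef g I) \<Longrightarrow> f = g"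
  by (metis coef_inject coef_infinite ext)

instantiation sqfree :: (comm_ring_1) comm_ring_1
begin

lift_definition zero_sqfree :: "'a sqfree" is "\<lambda>_. 0" by simp
lift_definition one_sqfree :: "'a sqfree" is "\<lambda>I. if I = {} then 1 else 0" by auto
lift_definition plus_sqfree :: "'a sqfree \<Rightarrow> 'a sqfree \<Rightarrow> 'a sqfree" is "\<lambda>f g I. f I + g I" by simp
lift_definition minus_sqfree :: "'a sqfree \<Rightarrow> 'a sqfree \<Rightarrow> 'a sqfree" is "\<lambda>f g I. f I - g I" by simp
lift_definition uminus_sqfree :: "'a sqfree \<Rightarrow> 'a sqfree" is "\<lambda>f I. - f I" by simp
text \<open>Subset convolution, the product of square-free monomials modulo all
  \<open>eps i * eps i\<close>. At an infinite \<open>I\<close> the sum ranges over an infinite set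
  and is 0 by convention; the carrier demands 0 there, so the unit law holds at every index.\<close>

lift_definition times_sqfree :: "'a sqfree \<Rightarrow> 'a sqfree \<Rightarrow> 'a sqfree" is
  "\<lambda>f g I. \<Sum>J\<in>Pow I. f J * g (I - J)" by simp

instance
proof
  fix a b c :: "'a sqfree"
  show "a * b * c = a * (b * c)"
  proof (rule sqfree_eqI)
    fix I :: "nat set" assume I: "finite I"
    have "coef (a * b * c) I = (\<Sum>J\<in>Pow I. \<Sum>K\<in>Pow J. coef a K * coef b (J - K) * coef c (I - J))"
      by (simp add: times_sqfree.rep_eq sum_distrib_right)
    also have "\<dots> = (\<Sum>(J, K)\<in>Sigma (Pow I) Pow. coef a K * coef b (J - K) * coef c (I - J))"
      using I by (intro sum.Sigma) (auto intro: finite_subset)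
    also have "\<dots> = (\<Sum>(K, M)\<in>Sigma (Pow I) (\<lambda>K. Pow (I - K)). coef a K * (coef b M * coef c (I - K - M)))"
      by (rule sum.reindex_bij_witness[where i = "\<lambda>(K, M). (K \<union> M, K)" and j = "\<lambda>(J, K). (K, J - K)"])
        (auto simp: mult.assoc Diff_Un Un_Diff Diff_eq Int_absorb2 intro!: arg_cong2[of _ _ _ _ "(*)"] arg_cong[of _ _ "coef _"])
    also have "\<dots> = (\<Sum>K\<in>Pow I. \<Sum>M\<in>Pow (I - K). coef a K * (coef b M * coef c (I - K - M)))"
      using I by (intro sum.Sigma[symmetric]) auto
    also have "\<dots> = coef (a * (b * c)) I"
      by (simp add: times_sqfree.rep_eq sum_distrib_left)
    finally show "coef (a * b * c) I = coef (a * (b * c)) I" .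
  qed
  show "a * b = b * a"
  proof (rule sqfree_eqI)
    fix I :: "nat set"
    show "coef (a * b) I = coef (b * a) I"
      unfolding times_sqfree.rep_eq
      by (rule sum.reindex_bij_witness[where i = "\<lambda>J. I - J" and j = "\<lambda>J. I - J"])
        (auto simp: double_diff mult.commute)
  qed
  show "1 * a = a"
  proof (rule sqfree_eqI)
    fix I :: "nat set" assume "finite I"
    then have "(\<Sum>J\<in>Pow I. (if J = {} then 1 else 0) * coef a (I - J)) =
        (\<Sum>J\<in>Pow I. if J = {} then coef a I else 0)"
      by (intro sum.cong) auto
    then show "coef (1 * a) I = coef a I"
      using \<open>finite I\<close> by (simp add: times_sqfree.rep_eq one_sqfree.rep_eq)
  qed
  show "(a + b) * c = a * c + b * c"
    by (rule sqfree_eqI) (simp add: times_sqfree.rep_eq plus_sqfree.rep_eq sum.distrib distrib_right)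
  show "(0::'a sqfree) \<noteq> 1"
    by (metis one_sqfree.rep_eq zero_neq_one zero_sqfree.rep_eq)
qed (auto intro!: sqfree_eqI simp: plus_sqfree.rep_eq minus_sqfree.rep_eq uminus_sqfree.rep_eq
    zero_sqfree.rep_eq algebra_simps)

end

lemmas coef_simps = zero_sqfree.rep_eq one_sqfree.rep_eq plus_sqfree.rep_eq

lemma coef_sum: "coef (sum f A) I = (\<Sum>x\<in>A. coef (f x) I)"
  by (induction A rule: infinite_finite_induct) (auto simp: coef_simps)

lift_definition scalar :: "'a::comm_ring_1 \<Rightarrow> 'a sqfree" is "\<lambda>c I. if I = {} then c else 0" by auto

lift_definition eps :: "nat \<Rightarrow> 'a::comm_ring_1 sqfree" is "\<lambda>i I. if I = {i} then 1 else 0" by auto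

lemma coef_scalar_mult [simp]: "coef (scalar c * f) I = c * coef f I"
proof (cases "finite I")
  case True
  then have "(\<Sum>J\<in>Pow I. (if J = {} then c else 0) * coef f (I - J)) =
      (\<Sum>J\<in>Pow I. if J = {} then c * coef f I else 0)"
    by (intro sum.cong) auto
  then show ?thesis
    using True by (simp add: times_sqfree.rep_eq scalar.rep_eq)
qed simp

lemma coef_eps_mult [simp]: "coef (eps i * f) I = (if i \<in> I then coef f (I - {i}) else 0)"
proof (cases "finite I")
  case True
  then have "(\<Sum>J\<in>Pow I. (if J = {i} then 1 else 0) * coef f (I - J)) =
      (\<Sum>J\<in>Pow I. if J = {i} then coef f (I - {i}) else 0)"
    by (intro sum.cong) auto
  then show ?thesis
    using True by (simp add: times_sqfree.rep_eq eps.rep_eq)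
qed auto

lemma scalar_0 [simp]: "scalar 0 = 0" and scalar_1 [simp]: "scalar 1 = 1"
  by (auto intro!: sqfree_eqI simp: coef_simps scalar.rep_eq)

lemma scalar_mult: "scalar a * scalar b = scalar (a * b)"
  and scalar_add: "scalar a + scalar b = scalar (a + b)"
  by (auto intro!: sqfree_eqI simp: coef_simps scalar.rep_eq)

text \<open>This is where characteristic 2 enters: complementary subsets contribute equally to a square.\<close>

lemma square_scalar:
  fixes f :: "'a::comm_ring_1 sqfree"
  assumes char2: "(1::'a) + 1 = 0"
  shows "f * f \<in> range scalar"
proof -
  have double: "x + x = 0" for x :: 'a
    using arg_cong[OF char2, of "\<lambda>c. c * x"] by (simp add: distrib_right)
  have "coef (f * f) I = 0" if I: "finite I" "I \<noteq> {}" for I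
  proof -
    obtain i where i: "i \<in> I" using I by auto
    let ?g = "\<lambda>J. coef f J * coef f (I - J)"
    have "{J \<in> Pow I. i \<in> J} \<union> {J \<in> Pow I. i \<notin> J} = Pow I" by auto
    then have "coef (f * f) I = sum ?g ({J \<in> Pow I. i \<in> J} \<union> {J \<in> Pow I. i \<notin> J})"
      by (simp only: times_sqfree.rep_eq)
    also have "\<dots> = sum ?g {J \<in> Pow I. i \<in> J} + sum ?g {J \<in> Pow I. i \<notin> J}"
      using I by (intro sum.union_disjoint) auto
    also have "sum ?g {J \<in> Pow I. i \<in> J} = sum ?g {J \<in> Pow I. i \<notin> J}"
      using i by (intro sum.reindex_bij_witness[where i = "\<lambda>J. I - J" and j = "\<lambda>J. I - J"])
        (auto simp: double_diff mult.commute)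
    finally show ?thesis using double by simp
  qed
  then have "f * f = scalar (coef (f * f) {})"
    by (intro sqfree_eqI) (auto simp: scalar.rep_eq)
  then show ?thesis by blast
qed

lemma sqfree_double:
  assumes "(1::'a::comm_ring_1) + 1 = 0"
  shows "(1::'a sqfree) + 1 = 0"
  using assms by (intro sqfree_eqI) (simp only: coef_simps, simp)

section \<open>Linear forms and degree bounds\<close>

definition linear_form :: "nat \<Rightarrow> (nat \<Rightarrow> 'a::comm_ring_1) \<Rightarrow> 'a sqfree" where
  "linear_form K y = (\<Sum>i<K. scalar (y i) * eps i)"

lemma coef_linear_form_mult:
  "coef (linear_form K y * f) I = (\<Sum>i<K. if i \<in> I then y i * coef f (I - {i}) else 0)"
  by (auto simp: linear_form_def sum_distrib_right coef_sum mult.assoc intro!: sum.cong)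

lemma square_sum_char2:
  fixes f :: "'b \<Rightarrow> 'a::comm_ring_1"
  assumes char2: "(1::'a) + 1 = 0"
  shows "sum f A * sum f A = (\<Sum>x\<in>A. f x * f x)"
proof (induction A rule: infinite_finite_induct)
  case (insert x A)
  have double: "y + y = 0" for y :: 'a
    using arg_cong[OF char2, of "\<lambda>c. c * y"] by (simp add: distrib_right)
  have "(f x + sum f A) * (f x + sum f A) = f x * f x + sum f A * sum f A + (f x * sum f A + f x * sum f A)"
    by (simp add: algebra_simps)
  then show ?case using insert double by simp
qed auto

text \<open>Squaring is additive in characteristic 2, so the mixed products cancel in pairs and only
  multiples of \<open>eps i * eps i = 0\<close> remain.\<close>

lemma linear_form_square:
  assumes "(1::'a::comm_ring_1) + 1 = 0"
  shows "linear_form K y * linear_form K y = (0 :: 'a sqfree)"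
proof -
  have "eps i * eps i = (0 :: 'a sqfree)" for i
    by (auto intro!: sqfree_eqI simp: coef_simps eps.rep_eq)
  then have "(scalar c * eps i) * (scalar c * eps i) = (0 :: 'a sqfree)" for c i
    by (metis mult.left_commute mult.assoc mult_zero_right)
  then show ?thesis
    unfolding linear_form_def square_sum_char2[OF sqfree_double[OF assms]] by simp
qed

text \<open>The bound is strict, so that \<open>deg_lt 0\<close> means vanishing and
  \<open>deg_lt K\<close> kills the coefficient at a label set of size \<open>K\<close>.\<close>

definition deg_lt :: "nat \<Rightarrow> 'a::comm_ring_1 sqfree \<Rightarrow> bool" where
  "deg_lt j f \<longleftrightarrow> (\<forall>I. j \<le> card I \<longrightarrow> coef f I = 0)"

lemma deg_lt_0 [simp]: "deg_lt j 0"
  and deg_lt_add: "deg_lt j f \<Longrightarrow> deg_lt j g \<Longrightarrow> deg_lt j (f + g)"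
  and deg_lt_scalar_mult: "deg_lt j f \<Longrightarrow> deg_lt j (scalar c * f)"
  and deg_lt_scalar: "deg_lt (Suc j) (scalar c)"
  and deg_lt_mono: "deg_lt j f \<Longrightarrow> j \<le> j' \<Longrightarrow> deg_lt j' f"
  by (auto simp: deg_lt_def coef_simps scalar.rep_eq)

lemma deg_lt_zero_iff: "deg_lt 0 f \<longleftrightarrow> f = 0"
  by (auto simp: deg_lt_def coef_simps intro: sqfree_eqI)

lemma deg_lt_sum: "(\<And>x. x \<in> A \<Longrightarrow> deg_lt j (f x)) \<Longrightarrow> deg_lt j (sum f A)"
  by (induction A rule: infinite_finite_induct) (auto intro: deg_lt_add)

lemma deg_lt_linear_form_mult:
  assumes "deg_lt j f"
  shows "deg_lt (Suc j) (linear_form K y * f)"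
  unfolding deg_lt_def coef_linear_form_mult
proof (intro allI impI sum.neutral ballI)
  fix I :: "nat set" and i :: nat assume I: "Suc j \<le> card I"
  then have "finite I" by (intro card_ge_0_finite) simp
  then show "(if i \<in> I then y i * coef f (I - {i}) else 0) = 0"
    using assms I by (auto simp: deg_lt_def card_Diff_singleton)
qed


section \<open>Walk sums in characteristic 2\<close>

primrec walks :: "('v \<Rightarrow> 'v \<Rightarrow> 'r::comm_ring_1) \<Rightarrow> 'v set \<Rightarrow> nat \<Rightarrow> 'v \<Rightarrow> 'v \<Rightarrow> 'r" where
  "walks a H 0 w u = of_bool (w = u)"
| "walks a H (Suc l) w u = (\<Sum>w'\<in>H. a w w' * walks a H l w' u)"

lemma walks_Suc_right:
  assumes "finite H" "w \<in> H" "u \<in> H"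
  shows "walks a H (Suc l) w u = (\<Sum>w'\<in>H. walks a H l w w' * a w' u)"
  using assms(2)
proof (induction l arbitrary: w)
  case 0
  have "(\<Sum>w'\<in>H. a w w' * of_bool (w' = u)) = (\<Sum>w'\<in>H. if w' = u then a w u else 0)"
    by (intro sum.cong) auto
  moreover have "(\<Sum>w'\<in>H. of_bool (w = w') * a w' u) = (\<Sum>w'\<in>H. if w' = w then a w u else 0)"
    by (intro sum.cong) auto
  ultimately show ?case using assms 0 by simp
next
  case (Suc l)
  have "walks a H (Suc (Suc l)) w u = (\<Sum>w'\<in>H. a w w' * walks a H (Suc l) w' u)" by simp
  also have "\<dots> = (\<Sum>w'\<in>H. a w w' * (\<Sum>x\<in>H. walks a H l w' x * a x u))"
    using Suc.IH by (intro sum.cong) auto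
  also have "\<dots> = (\<Sum>x\<in>H. \<Sum>w'\<in>H. a w w' * (walks a H l w' x * a x u))"
    unfolding sum_distrib_left by (rule sum.swap)
  also have "\<dots> = (\<Sum>x\<in>H. walks a H (Suc l) w x * a x u)"
    by (simp add: sum_distrib_right mult.assoc)
  finally show ?case .
qed

lemma walks_sym:
  assumes "finite H" "w \<in> H" "u \<in> H" and sym: "\<And>x y. a x y = a y x"
  shows "walks a H l w u = walks a H l u w"
  using assms(2,3)
proof (induction l arbitrary: w u)
  case (Suc l)
  have "walks a H (Suc l) w u = (\<Sum>w'\<in>H. walks a H l w w' * a w' u)"
    using Suc.prems assms by (intro walks_Suc_right)
  also have "\<dots> = (\<Sum>w'\<in>H. a u w' * walks a H l w' w)"
    using Suc sym by (intro sum.cong) (auto simp: mult.commute)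
  finally show ?case by simp
qed auto

section \<open>Generating functions of walks, split at the visits to one vertex\<close>

definition walk_fps :: "('v \<Rightarrow> 'v \<Rightarrow> 'r::comm_ring_1) \<Rightarrow> 'v set \<Rightarrow> 'v \<Rightarrow> 'v \<Rightarrow> 'r fps" where
  "walk_fps a H w u = Abs_fps (\<lambda>l. walks a H l w u)"

lemma walk_fps_eq:
  "walk_fps a H w u = of_bool (w = u) + fps_X * (\<Sum>w'\<in>H. fps_const (a w w') * walk_fps a H w' u)"
  by (rule fps_ext, case_tac n) (auto simp: walk_fps_def fps_sum_nth)

text \<open>The factor \<open>fps_X\<close> lets coefficient \<open>Suc l\<close> depend on
  coefficients \<open>l\<close> only, so the system is a recursion. An identity of walk series can
  thus be proved by checking that both sides solve the same system.\<close>

lemma fps_system_unique: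
  fixes f g :: "'v \<Rightarrow> 'r::comm_ring_1 fps"
  assumes f: "\<And>w. w \<in> G \<Longrightarrow> f w = h w + fps_X * (\<Sum>w'\<in>G. fps_const (a w w') * f w')"
    and g: "\<And>w. w \<in> G \<Longrightarrow> g w = h w + fps_X * (\<Sum>w'\<in>G. fps_const (a w w') * g w')"
    and w: "w \<in> G"
  shows "f w = g w"
proof -
  have "fps_nth (f w) l = fps_nth (g w) l" for l
    using w
  proof (induction l arbitrary: w)
    case 0
    then show ?case by (subst f, simp, subst g, simp, simp)
  next
    case (Suc l)
    then show ?case by (subst f, simp, subst g, simp, simp add: fps_sum_nth)
  qed
  then show ?thesis by (simp add: fps_eq_iff)
qed

text \<open>For \<open>v\<close> outside \<open>G\<close> and \<open>w\<close> in \<open>G\<close>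
  these are the first arrivals at \<open>v\<close>: walks that stay in \<open>G\<close> until their
  last step.\<close>

definition exit_fps :: "('v \<Rightarrow> 'v \<Rightarrow> 'r::comm_ring_1) \<Rightarrow> 'v set \<Rightarrow> 'v \<Rightarrow> 'v \<Rightarrow> 'r fps" where
  "exit_fps a G v w = (\<Sum>w'\<in>G. walk_fps a G w w' * (fps_X * fps_const (a w' v)))"

lemma exit_fps_eq:
  assumes "finite G" "w \<in> G"
  shows "exit_fps a G v w = fps_X * fps_const (a w v) +
    fps_X * (\<Sum>w''\<in>G. fps_const (a w w'') * exit_fps a G v w'')"
proof -
  have "exit_fps a G v w = (\<Sum>w'\<in>G. (of_bool (w = w') + fps_X * (\<Sum>w''\<in>G. fps_const (a w w'') * walk_fps a G w'' w'))
      * (fps_X * fps_const (a w' v)))"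
    unfolding exit_fps_def by (subst walk_fps_eq) simp
  also have "\<dots> = (\<Sum>w'\<in>G. of_bool (w = w') * (fps_X * fps_const (a w' v))) +
      (\<Sum>w'\<in>G. \<Sum>w''\<in>G. fps_X * (fps_const (a w w'') * walk_fps a G w'' w') * (fps_X * fps_const (a w' v)))"
    by (simp add: distrib_right sum.distrib sum_distrib_left sum_distrib_right)
  also have "(\<Sum>w'\<in>G. of_bool (w = w') * (fps_X * fps_const (a w' v))) = (\<Sum>w'\<in>G. if w' = w then fps_X * fps_const (a w v) else 0)"
    by (intro sum.cong) auto
  also have "\<dots> = fps_X * fps_const (a w v)" using assms by simp
  also have "(\<Sum>w'\<in>G. \<Sum>w''\<in>G. fps_X * (fps_const (a w w'') * walk_fps a G w'' w') * (fps_X * fps_const (a w' v)))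
     = (\<Sum>w''\<in>G. \<Sum>w'\<in>G. fps_X * (fps_const (a w w'') * walk_fps a G w'' w') * (fps_X * fps_const (a w' v)))"
    by (rule sum.swap)
  also have "\<dots> = fps_X * (\<Sum>w''\<in>G. fps_const (a w w'') * exit_fps a G v w'')"
    by (simp add: exit_fps_def sum_distrib_left mult.assoc)
  finally show ?thesis .
qed

text \<open>A walk either avoids \<open>v\<close> or splits at its first visit to \<open>v\<close>.
  Formally, both sides solve one linear system over \<open>G\<close>, whose inhomogeneous part
  contains the walks that step to \<open>v\<close> at once.\<close>

lemma walk_fps_insert:
  assumes "finite G" "v \<notin> G" "w \<in> G"
  shows "walk_fps a (insert v G) w u =
    (if u = v then 0 else walk_fps a G w u) + exit_fps a G v w * walk_fps a (insert v G) v u"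
proof -
  let ?f = "\<lambda>w. walk_fps a (insert v G) w u" and ?V = "walk_fps a (insert v G) v u"
  let ?g = "\<lambda>w. (if u = v then 0 else walk_fps a G w u) + exit_fps a G v w * ?V"
  have "?f w = ?g w"
  proof (rule fps_system_unique[where f = ?f and g = ?g and G = G and a = a and
        h = "\<lambda>w. (if u = v then 0 else of_bool (w = u)) + fps_X * fps_const (a w v) * ?V"])
    fix w assume "w \<in> G"
    then show "?f w = ((if u = v then 0 else of_bool (w = u)) + fps_X * fps_const (a w v) * ?V)
        + fps_X * (\<Sum>w'\<in>G. fps_const (a w w') * ?f w')"
      using assms by (subst walk_fps_eq) (auto simp: algebra_simps)
  next
    fix w assume w: "w \<in> G"
    have 1: "(if u = v then 0 else walk_fps a G w u) = (if u = v then 0 else of_bool (w = u)) +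
        fps_X * (\<Sum>w'\<in>G. fps_const (a w w') * (if u = v then 0 else walk_fps a G w' u))"
      by (auto simp flip: walk_fps_eq)
    show "?g w = ((if u = v then 0 else of_bool (w = u)) + fps_X * fps_const (a w v) * ?V)
        + fps_X * (\<Sum>w'\<in>G. fps_const (a w w') * ?g w')"
      by (subst 1, subst exit_fps_eq[OF assms(1) w])
        (simp add: algebra_simps sum.distrib sum_distrib_left)
  qed (rule assms)
  then show ?thesis .
qed

text \<open>For \<open>v\<close> outside \<open>G\<close> these are the first returns: closed walks
  that meet \<open>v\<close> only at their two ends.\<close>

definition return_fps :: "('v \<Rightarrow> 'v \<Rightarrow> 'r::comm_ring_1) \<Rightarrow> 'v set \<Rightarrow> 'v \<Rightarrow> 'r fps" where
  "return_fps a G v = fps_X * (\<Sum>w\<in>G. fps_const (a v w) * exit_fps a G v w)"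

text \<open>Renewal equation: a walk from \<open>v\<close> either never comes back or makes a first
  return and starts afresh. \<open>a v v = 0\<close> rules out a return in one step.\<close>

lemma walk_fps_first_step:
  assumes "finite G" "v \<notin> G" "a v v = 0"
  shows "(1 - return_fps a G v) * walk_fps a (insert v G) v u =
    (if u = v then 1 else fps_X * (\<Sum>w\<in>G. fps_const (a v w) * walk_fps a G w u))"
proof -
  let ?V = "walk_fps a (insert v G) v u"
  let ?R = "(\<Sum>w\<in>G. fps_const (a v w) * (if u = v then 0 else walk_fps a G w u))"
  have "(\<Sum>w\<in>G. fps_const (a v w) * walk_fps a (insert v G) w u) =
      (\<Sum>w\<in>G. fps_const (a v w) * ((if u = v then 0 else walk_fps a G w u) + exit_fps a G v w * ?V))"
    using assms by (intro sum.cong) (auto simp: walk_fps_insert)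
  then have 1: "(\<Sum>w\<in>G. fps_const (a v w) * walk_fps a (insert v G) w u) =
      ?R + (\<Sum>w\<in>G. fps_const (a v w) * exit_fps a G v w) * ?V"
    by (simp only: distrib_left sum.distrib sum_distrib_right mult.assoc)
  have "?V = of_bool (v = u) + fps_X * (\<Sum>w\<in>G. fps_const (a v w) * walk_fps a (insert v G) w u)"
    using assms by (subst walk_fps_eq) simp
  then have "?V = of_bool (v = u) + fps_X * ?R + return_fps a G v * ?V"
    unfolding 1 return_fps_def distrib_left mult.assoc add.assoc .
  then have "(1 - return_fps a G v) * ?V = of_bool (v = u) + fps_X * ?R"
    unfolding left_diff_distrib mult_1_left diff_eq_eq .
  then show ?thesis by auto
qed

text \<open>The renewal equation for \<open>u = v\<close> says that the closed walks at
  \<open>v\<close> are inverse to \<open>1 - return_fps a G v\<close>; multiplying the equation for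
  \<open>u\<close> by them avoids a division of series.\<close>

lemma walk_fps_last_exit:
  assumes "finite G" "v \<notin> G" "a v v = 0" "u \<noteq> v"
  shows "walk_fps a (insert v G) v u =
    walk_fps a (insert v G) v v * (fps_X * (\<Sum>w\<in>G. fps_const (a v w) * walk_fps a G w u))"
proof -
  let ?W = "walk_fps a (insert v G) v"
  have "?W v * ((1 - return_fps a G v) * ?W u) = ((1 - return_fps a G v) * ?W v) * ?W u"
    by (simp only: ac_simps)
  then show ?thesis
    using walk_fps_first_step[where u = u, OF assms(1,2), of a] walk_fps_first_step[where u = v, OF assms(1,2), of a]
      assms(3,4) by simp
qed

lemma symmetric_sum_char2:
  fixes g :: "'b \<Rightarrow> 'b \<Rightarrow> 'a::comm_ring_1"
  assumes char2: "(1::'a) + 1 = 0" and "finite G" and sym: "\<And>x y. x \<in> G \<Longrightarrow> y \<in> G \<Longrightarrow> g x y = g y x"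
  shows "(\<Sum>x\<in>G. \<Sum>y\<in>G. g x y) = (\<Sum>x\<in>G. g x x)"
  using assms(2,3)
proof (induction G rule: finite_induct)
  case (insert x F)
  have double: "y + y = 0" for y :: 'a
    using arg_cong[OF char2, of "\<lambda>c. c * y"] by (simp add: distrib_right)
  have "(\<Sum>y\<in>F. g y x) = (\<Sum>y\<in>F. g x y)" using insert by (intro sum.cong) auto
  moreover have "(\<Sum>y\<in>F. \<Sum>z\<in>insert x F. g y z) = (\<Sum>y\<in>F. g y x) + (\<Sum>y\<in>F. \<Sum>z\<in>F. g y z)"
    using insert by (simp add: sum.distrib)
  ultimately have "(\<Sum>y\<in>insert x F. \<Sum>z\<in>insert x F. g y z) =
      g x x + (\<Sum>y\<in>F. \<Sum>z\<in>F. g y z) + ((\<Sum>y\<in>F. g x y) + (\<Sum>y\<in>F. g x y))"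
    using insert by (simp add: add_ac)
  then show ?case using insert double by simp
qed auto

text \<open>
  Closed walks cancel against their reversals.  Only the walks that are palindromes survive, and
  these have square weights.
\<close>

lemma closed_walks_in_subring:
  fixes a :: "'v \<Rightarrow> 'v \<Rightarrow> 'r::comm_ring_1" and S :: "'r set"
  assumes char2: "(1::'r) + 1 = 0"
    and sym: "\<And>x y. a x y = a y x" and loop: "\<And>x. a x x = 0"
    and S: "0 \<in> S" "1 \<in> S" "\<And>x y. x \<in> S \<Longrightarrow> y \<in> S \<Longrightarrow> x + y \<in> S"
      "\<And>x y. x \<in> S \<Longrightarrow> y \<in> S \<Longrightarrow> x * y \<in> S" "\<And>x. x * x \<in> S"
    and "finite H" "v \<in> H"
  shows "walks a H l v v \<in> S"
  using assms(9-10)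
proof (induction "card H" arbitrary: H v l)
  case (Suc c)
  define G where "G = H - {v}"
  have G: "finite G" "v \<notin> G" "insert v G = H" "c = card G"
    using Suc by (auto simp: G_def)
  have sumS: "sum f A \<in> S" if "\<And>x. x \<in> A \<Longrightarrow> f x \<in> S" for f :: "'b \<Rightarrow> 'r" and A
    using that by (induction A rule: infinite_finite_induct) (auto intro: S)
  let ?b = "\<lambda>w. fps_const (a v w)"
  have "return_fps a G v = (\<Sum>w\<in>G. \<Sum>w'\<in>G. fps_X * (?b w * (walk_fps a G w w' * (fps_X * fps_const (a w' v)))))"
    by (simp add: return_fps_def exit_fps_def sum_distrib_left)
  \<comment> \<open>Reversing an excursion inside \<open>G\<close> exchanges its end vertices, so
    only excursions with equal ends survive. They contribute a square times a closed walk in the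
    smaller set \<open>G\<close>.\<close>
  also have "\<dots> = (\<Sum>w\<in>G. fps_X * (?b w * (walk_fps a G w w * (fps_X * fps_const (a w v)))))"
  proof (rule symmetric_sum_char2)
    show "(1::'r fps) + 1 = 0"
      using arg_cong[OF char2, of fps_const] by (simp del: fps_const_add add: fps_const_add[symmetric])
    fix w w' assume w: "w \<in> G" "w' \<in> G"
    have "walk_fps a G w w' = walk_fps a G w' w"
      using walks_sym[OF G(1) w sym] by (simp add: walk_fps_def)
    then show "fps_X * (?b w * (walk_fps a G w w' * (fps_X * fps_const (a w' v)))) =
        fps_X * (?b w' * (walk_fps a G w' w * (fps_X * fps_const (a w v))))"
      by (simp add: sym[of _ v] ac_simps)
  qed (use G in auto)
  also have "\<dots> = (\<Sum>w\<in>G. fps_X * (fps_X * (fps_const (a v w * a v w) * walk_fps a G w w)))"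
    by (intro sum.cong) (auto simp: sym[of _ v] ac_simps simp flip: fps_const_mult)
  finally have ret: "return_fps a G v = (\<Sum>w\<in>G. fps_X * (fps_X * (fps_const (a v w * a v w) * walk_fps a G w w)))" .
  have retS: "fps_nth (return_fps a G v) i \<in> S" for i
    unfolding ret fps_sum_nth using Suc.hyps(1)[OF G(4) G(1)] S
    by (intro sumS) (auto simp: walk_fps_def)
  have ret0: "fps_nth (return_fps a G v) 0 = 0"
    by (simp add: return_fps_def)
  have eq: "walk_fps a H v v = 1 + return_fps a G v * walk_fps a H v v"
    using walk_fps_first_step[of G v a v] G loop by (simp add: algebra_simps)
  \<comment> \<open>First returns have no constant term, so the renewal equation gives each
    coefficient from earlier ones.\<close>
  have "fps_nth (walk_fps a H v v) l \<in> S"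
  proof (induction l rule: less_induct)
    case (less l)
    have "fps_nth (walk_fps a H v v) l = of_bool (l = 0) +
        (\<Sum>i=0..l. fps_nth (return_fps a G v) i * fps_nth (walk_fps a H v v) (l - i))"
      by (subst eq) (simp add: fps_mult_nth)
    moreover have "fps_nth (return_fps a G v) i * fps_nth (walk_fps a H v v) (l - i) \<in> S" if "i \<in> {0..l}" for i
    proof (cases "i = 0")
      case True
      then show ?thesis using S(1) ret0 by simp
    next
      case False
      then show ?thesis using that less by (intro S retS) auto
    qed
    then have "(\<Sum>i=0..l. fps_nth (return_fps a G v) i * fps_nth (walk_fps a H v v) (l - i)) \<in> S"
      by (rule sumS)
    moreover have "of_bool (l = 0) \<in> S" using S(1,2) by (cases "l = 0") auto
    ultimately show ?case using S(3) by metis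
  qed
  then show ?case by (simp add: walk_fps_def)
qed auto


section \<open>Walk sums detect long simple paths\<close>

definition path_between :: "('v \<Rightarrow> 'v \<Rightarrow> bool) \<Rightarrow> 'v set \<Rightarrow> 'v \<Rightarrow> 'v list \<Rightarrow> 'v \<Rightarrow> bool" where
  "path_between E H w p u \<longleftrightarrow> p \<noteq> [] \<and> hd p = w \<and> last p = u \<and> distinct p \<and> set p \<subseteq> H \<and> successively E p"

lemma path_between_Cons:
  assumes "path_between E (H - {w}) w' p u" "E w w'" "w \<in> H"
  shows "path_between E H w (w # p) u"
  using assms by (auto simp: path_between_def successively_Cons)

text \<open>Induction on the number of available vertices. The last visit to \<open>w\<close> splits
  off a closed walk, a scalar that does not affect the degree; there remain a step to some
  \<open>w'\<close> and a walk that avoids \<open>w\<close>. The second claim says that a label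
  already charged to \<open>w\<close> costs no extra degree; it serves steps that enter
  \<open>w\<close> from the other side and carry the label of \<open>w\<close>.\<close>

lemma walks_degree:
  fixes a :: "'v \<Rightarrow> 'v \<Rightarrow> 'a::comm_ring_1 sqfree" and Y :: "'v \<Rightarrow> 'a sqfree"
  assumes char2: "(1::'a) + 1 = 0"
    and sym: "\<And>x y. \<xi> x y = \<xi> y x" "\<And>x y. \<zeta> x y = \<zeta> y x"
    and E: "\<And>x y. \<not> E x y \<Longrightarrow> \<xi> x y = 0 \<and> \<zeta> x y = 0"
    and bip: "\<And>x y. E x y \<Longrightarrow> x \<in> A \<longleftrightarrow> y \<notin> A"
    and Y: "\<And>w. Y w = linear_form K (y w)"
    and a: "\<And>x y. a x y = scalar (\<xi> x y) + scalar (\<zeta> x y) * Y (if x \<in> A then x else y)"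
    and H: "finite H" "w \<in> H" and u: "u \<in> H" "u \<notin> A"
    and few: "\<And>p. path_between E H w p u \<Longrightarrow> length (filter (\<lambda>x. x \<in> A) p) < j"
  shows "deg_lt j (walks a H l w u) \<and> (w \<in> A \<longrightarrow> deg_lt j (Y w * walks a H l w u))"
  using H u(1) few
proof (induction "card H" arbitrary: H w j l)
  case (Suc c)
  have a_sym: "a x y = a y x" for x y
    using bip[of x y] E[of x y] sym[of x y] by (cases "E x y") (auto simp: a)
  have a_loop: "a x x = 0" for x
    using bip[of x x] E[of x x] by (cases "E x x") (auto simp: a)
  have S01: "0 \<in> range (scalar :: 'a \<Rightarrow> _)" "1 \<in> range (scalar :: 'a \<Rightarrow> _)"
    by (metis rangeI scalar_0, metis rangeI scalar_1)
  have scal: "walks a H l w w \<in> range scalar" for l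
    by (rule closed_walks_in_subring[where S = "range scalar"])
      (use a_sym a_loop square_scalar[OF char2] sqfree_double[OF char2] Suc.prems in
        \<open>auto simp: scalar_add scalar_mult intro: S01\<close>)
  show ?case
  proof (cases "w = u")
    case True
    have "path_between E H w [w] u" using Suc True by (auto simp: path_between_def)
    then obtain j' where "j = Suc j'" using Suc.prems(4) by (cases j) force+
    then show ?thesis using scal[of l] True u(2) by (auto intro: deg_lt_scalar)
  next
    case False
    define G where "G = H - {w}"
    have G: "finite G" "w \<notin> G" "insert w G = H" "c = card G" "u \<in> G"
      using Suc False by (auto simp: G_def)
    have step: "walks a H l w u = (\<Sum>i=0..l. walks a H i w w *
        (if l = i then 0 else \<Sum>w'\<in>G. a w w' * walks a G (l - i - 1) w' u))"
    proof -
      have "fps_nth (walk_fps a H w u) l = fps_nth (walk_fps a H w w *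
          (fps_X * (\<Sum>w'\<in>G. fps_const (a w w') * walk_fps a G w' u))) l"
        using walk_fps_last_exit[where a = a and u = u, OF G(1,2)] a_loop[of w] False G(3) by simp
      then show ?thesis
        by (simp add: fps_mult_nth[of "walk_fps a H w w"] fps_sum_nth) (auto simp: walk_fps_def fps_sum_nth intro!: sum.cong)
    qed
    have inner: "deg_lt j (a w w' * walks a G i w' u) \<and> (w \<in> A \<longrightarrow> deg_lt j (Y w * (a w w' * walks a G i w' u)))"
      if w': "w' \<in> G" for w' i
    proof (cases "E w w'")
      case False
      then have "a w w' = 0" using E by (simp add: a)
      then show ?thesis by simp
    next
      case True
      have path: "length (filter (\<lambda>x. x \<in> A) (w # p)) < j" if "path_between E G w' p u" for p
        using Suc.prems(4)[OF path_between_Cons] that True Suc.prems by (auto simp: G_def)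
      show ?thesis
      proof (cases "w \<in> A")
        case wA: True
        have aw: "a w w' = scalar (\<xi> w w') + scalar (\<zeta> w w') * Y w" by (simp add: a wA)
        show ?thesis
        proof (cases j)
          case 0
          \<comment> \<open>For \<open>j = 0\<close> no path leads from \<open>w'\<close> to
            \<open>u\<close> inside \<open>G\<close>, so these walk sums vanish.\<close>
          then have "deg_lt 0 (walks a G i w' u)"
            using Suc.hyps(1)[OF G(4,1) w' G(5), of 0 i] path by auto
          then show ?thesis by (simp add: deg_lt_zero_iff)
        next
          case (Suc j')
          have d: "deg_lt j' (walks a G i w' u)"
            using Suc.hyps(1)[OF G(4,1) w' G(5), of j' i] path wA Suc by auto
          have d': "deg_lt (Suc j') (Y w * walks a G i w' u)"
            unfolding Y using d by (rule deg_lt_linear_form_mult)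
          have e1: "a w w' * walks a G i w' u = scalar (\<xi> w w') * walks a G i w' u +
              scalar (\<zeta> w w') * (Y w * walks a G i w' u)"
            by (simp add: aw algebra_simps)
          \<comment> \<open>The label of \<open>w\<close> cannot be used twice, so only the plain
            step survives.\<close>
          have "Y w * (a w w' * walks a G i w' u) = scalar (\<xi> w w') * (Y w * walks a G i w' u) +
              scalar (\<zeta> w w') * ((Y w * Y w) * walks a G i w' u)"
            by (simp add: aw algebra_simps)
          also have "Y w * Y w = 0" unfolding Y by (rule linear_form_square[OF char2])
          finally have e2: "Y w * (a w w' * walks a G i w' u) = scalar (\<xi> w w') * (Y w * walks a G i w' u)"
            by simp
          show ?thesis unfolding e2 unfolding e1 Suc using d d'
            by (auto intro!: deg_lt_add deg_lt_scalar_mult intro: deg_lt_mono)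
        qed
      next
        case wA: False
        then have w'A: "w' \<in> A" using bip True by auto
        \<comment> \<open>A label on this step is charged to \<open>w'\<close>; the second half of
          the induction hypothesis absorbs it.\<close>
        have "deg_lt j (walks a G i w' u) \<and> deg_lt j (Y w' * walks a G i w' u)"
          using Suc.hyps(1)[OF G(4,1) w' G(5), of j i] path wA w'A by auto
        moreover have "a w w' * walks a G i w' u = scalar (\<xi> w w') * walks a G i w' u +
              scalar (\<zeta> w w') * (Y w' * walks a G i w' u)"
          by (simp add: a wA algebra_simps)
        ultimately show ?thesis using wA by (auto intro!: deg_lt_add deg_lt_scalar_mult)
      qed
    qed
    have Ystep: "Y w * walks a H l w u = (\<Sum>i=0..l. walks a H i w w *
        (if l = i then 0 else \<Sum>w'\<in>G. Y w * (a w w' * walks a G (l - i - 1) w' u)))"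
      unfolding step sum_distrib_left by (intro sum.cong) (auto simp: sum_distrib_left algebra_simps)
    have scal_mult: "deg_lt j (walks a H i w w * f)" if "deg_lt j f" for i f
      using scal[of i] that by (auto intro: deg_lt_scalar_mult)
    show ?thesis
      unfolding Ystep unfolding step
      using inner by (auto intro!: deg_lt_sum scal_mult)
  qed
qed auto

section \<open>The dynamic programme\<close>

text \<open>
  One array \<open>\<rho>\<close> holds three blocks of variables: for plain steps, for labelled steps, and for the pairs
  of a vertex and a label.  A step is indexed by its endpoint \<open>r\<close> in the side \<open>A\<close> first; \<open>i = 0\<close> is the
  plain step and \<open>i > 0\<close> carries the label \<open>i - 1\<close>.  The set of labels is a bit mask.
\<close>

definition step_weight :: "nat \<Rightarrow> (nat \<Rightarrow> 'r::comm_semiring_1) \<Rightarrow> nat \<Rightarrow> nat \<Rightarrow> nat \<Rightarrow> nat \<Rightarrow> (nat \<Rightarrow> 'r) \<Rightarrow> 'r" where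
  "step_weight n \<rho> r c i I f =
     (if i = 0 then \<rho> (r * n + c) * f I
      else if odd (I div 2 ^ (i - 1))
      then \<rho> (n * n + r * n + c) * \<rho> (2 * n * n + r * n + (i - 1)) * f (I - 2 ^ (i - 1))
      else 0)"

text \<open>
  The table is computed backwards from the end \<open>u\<close>, which is not in \<open>A\<close>.  Hence the parity of \<open>l\<close> tells
  which endpoint of a step is in \<open>A\<close>, and the bipartition itself is not needed.
\<close>

primrec dp :: "(nat \<Rightarrow> nat \<Rightarrow> bool) \<Rightarrow> nat \<Rightarrow> nat \<Rightarrow> nat \<Rightarrow> (nat \<Rightarrow> 'r::comm_semiring_1) \<Rightarrow> nat \<Rightarrow> nat \<Rightarrow> nat \<Rightarrow> 'r" where
  "dp E n K u \<rho> 0 w I = of_bool (w = u \<and> I = 0)"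
| "dp E n K u \<rho> (Suc l) w I = (\<Sum>w'<n. \<Sum>i\<le>K. if E w' w
     then step_weight n \<rho> (if even l then w else w') (if even l then w' else w) i I (dp E n K u \<rho> l w') else 0)"

text \<open>The recursion uses sums and products only. Over semirings the same table can be read
  over \<open>nat\<close> (the machine), \<open>nat poly\<close> (digits kept apart) and
  \<open>bit poly\<close> (the algebra), linked by evaluation and by reduction modulo 2.\<close>

lemma dp_hom:
  fixes h :: "'r::comm_semiring_1 \<Rightarrow> 's::comm_semiring_1"
  assumes h: "h 0 = 0" "h 1 = 1" "\<And>x y. h (x + y) = h x + h y" "\<And>x y. h (x * y) = h x * h y"
  shows "h (dp E n K u \<rho> l w I) = dp E n K u (\<lambda>q. h (\<rho> q)) l w I"
proof -
  have hsum: "h (sum f A) = (\<Sum>x\<in>A. h (f x))" for f :: "'b \<Rightarrow> 'r" and A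
    by (induction A rule: infinite_finite_induct) (auto simp: h)
  show ?thesis
    by (induction l arbitrary: w I) (auto simp: hsum h step_weight_def intro!: sum.cong)
qed

text \<open>\<open>K \<le> n\<close> keeps the index of every pair of a vertex and a label inside
  the last block of \<open>n * n\<close> cells.\<close>

lemma dp_cong:
  assumes "\<And>q. q < 3 * n * n \<Longrightarrow> \<rho> q = \<rho>' q" "w < n" "K \<le> n"
  shows "dp E n K u \<rho> l w I = dp E n K u \<rho>' l w I"
  using assms(2)
proof (induction l arbitrary: w I)
  case (Suc l)
  have idx: "r * n + c < n * n" if "r < n" "c < n" for r c :: nat
  proof -
    have "r * n + c < Suc r * n" using that by simp
    also have "\<dots> \<le> n * n" using that by (intro mult_right_mono) auto
    finally show ?thesis .
  qed
  have "step_weight n \<rho> r c i I (dp E n K u \<rho> l w') = step_weight n \<rho>' r c i I (dp E n K u \<rho>' l w')"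
    if "r < n" "c < n" "w' < n" "i \<le> K" for r c w' i
  proof -
    have "i - 1 < n" using that assms(3) by (cases i) auto
    then show ?thesis
      using that idx[OF that(1,2)] idx[OF that(1), of "i - 1"] assms(3) Suc.IH[OF that(3)]
      by (auto simp: step_weight_def assms(1))
  qed
  then show ?case using Suc.prems by (auto intro!: sum.cong)
qed auto

text \<open>A step offers at most \<open>n * (K + 1)\<close> choices and multiplies by at most two
  variables. With \<open>V = m\<close> this will bound coefficients, with \<open>V = B ^ m\<close>
  the stored numbers.\<close>

lemma dp_le:
  fixes \<rho> :: "nat \<Rightarrow> nat"
  assumes "\<And>q. \<rho> q \<le> V" "V \<ge> 1"
  shows "dp E n K u \<rho> l w I \<le> (n * (K + 1) * V\<^sup>2) ^ l"
proof (induction l arbitrary: w I)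
  case (Suc l)
  let ?M = "(n * (K + 1) * V\<^sup>2) ^ l"
  have "step_weight n \<rho> r c i I (dp E n K u \<rho> l w') \<le> V\<^sup>2 * ?M" for r c i w'
  proof -
    have "\<rho> q * \<rho> q' \<le> V\<^sup>2" for q q'
      unfolding power2_eq_square using assms by (intro mult_mono) auto
    moreover have "\<rho> q \<le> V\<^sup>2" for q
      using assms by (meson le_trans power2_nat_le_imp_le self_le_power zero_less_numeral)
    ultimately show ?thesis
      using Suc.IH by (auto simp: step_weight_def intro!: mult_mono)
  qed
  then have "dp E n K u \<rho> (Suc l) w I \<le> (\<Sum>w'<n. \<Sum>i\<le>K. V\<^sup>2 * ?M)"
    unfolding dp.simps by (intro sum_mono) auto
  then show ?case by (simp add: algebra_simps)
qed auto

lemma in_set_decode: "i \<in> set_decode I \<longleftrightarrow> odd (I div 2 ^ i)"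
  by (simp add: set_decode_def)

lemma set_decode_minus_power_2:
  assumes "i \<in> set_decode I"
  shows "set_decode (I - 2 ^ i) = set_decode I - {i}"
proof -
  have "insert i (set_decode I - {i}) = set_decode I" using assms by auto
  then have "I = 2 ^ i + set_encode (set_decode I - {i})"
    using set_encode_insert[of "set_decode I - {i}" i] by simp
  then have "I - 2 ^ i = set_encode (set_decode I - {i})" by linarith
  then show ?thesis by simp
qed

lemma set_decode_all: "set_decode (2 ^ K - 1) = {..<K}"
proof -
  have "set_encode {..<K} = 2 ^ K - 1"
    by (induction K) (auto simp: lessThan_Suc set_encode_inf)
  then show ?thesis by (metis finite_lessThan set_encode_inverse)
qed

section \<open>The table as coefficients of a walk sum\<close>

context
  fixes E :: "nat \<Rightarrow> nat \<Rightarrow> bool" and n K u :: nat and A :: "nat set"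
  assumes sym: "\<And>x y. E x y \<Longrightarrow> E y x"
    and bip: "\<And>x y. E x y \<Longrightarrow> x \<in> A \<longleftrightarrow> y \<notin> A"
    and u: "u \<notin> A" "u < n"
begin

text \<open>The endpoint in \<open>A\<close> is the row, so both directions of an edge read the same
  cell and the weights are symmetric.\<close>

definition plain :: "(nat \<Rightarrow> 'r::comm_ring_1) \<Rightarrow> nat \<Rightarrow> nat \<Rightarrow> 'r" where
  "plain \<rho> x y = (if E x y then \<rho> (if x \<in> A then x * n + y else y * n + x) else 0)"

definition labelled :: "(nat \<Rightarrow> 'r::comm_ring_1) \<Rightarrow> nat \<Rightarrow> nat \<Rightarrow> 'r" where
  "labelled \<rho> x y = (if E x y then \<rho> (if x \<in> A then n * n + x * n + y else n * n + y * n + x) else 0)"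

definition label_form :: "(nat \<Rightarrow> 'r::comm_ring_1) \<Rightarrow> nat \<Rightarrow> 'r sqfree" where
  "label_form \<rho> w = linear_form K (\<lambda>i. \<rho> (2 * n * n + w * n + i))"

definition arc_weight :: "(nat \<Rightarrow> 'r::comm_ring_1) \<Rightarrow> nat \<Rightarrow> nat \<Rightarrow> 'r sqfree" where
  "arc_weight \<rho> x y = scalar (plain \<rho> x y) + scalar (labelled \<rho> x y) * label_form \<rho> (if x \<in> A then x else y)"

text \<open>Multiplication by a linear form removes one element of the label set in every possible
  way, which is the choice of \<open>i > 0\<close> in \<open>step_weight\<close>. As
  \<open>u\<close> lies outside \<open>A\<close>, a walk of length \<open>l\<close> to
  \<open>u\<close> starts in \<open>A\<close> exactly if \<open>l\<close> is odd; the table is 0 at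
  the other vertices.\<close>

lemma dp_eq_walks:
  fixes \<rho> :: "nat \<Rightarrow> 'r::comm_ring_1"
  shows "dp E n K u \<rho> l w I =
    (if w \<in> A \<longleftrightarrow> odd l then coef (walks (arc_weight \<rho>) {..<n} l w u) (set_decode I) else 0)"
proof (induction l arbitrary: w I)
  case 0
  have "I = 0 \<longleftrightarrow> set_decode I = {}"
    by (metis set_decode_inverse set_decode_zero)
  then show ?case using u by (auto simp: coef_simps)
next
  case (Suc l)
  define W where "W w' = walks (arc_weight \<rho>) {..<n} l w' u" for w'
  let ?r = "\<lambda>w'. if even l then w else w'" and ?c = "\<lambda>w'. if even l then w' else w"
  let ?t = "\<lambda>w'. \<Sum>i\<le>K. if E w' w then step_weight n \<rho> (?r w') (?c w') i I (dp E n K u \<rho> l w') else 0"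
  show ?case
  proof (cases "w \<in> A \<longleftrightarrow> odd (Suc l)")
    case False
    have "dp E n K u \<rho> l w' J = 0" if "E w' w" for w' J
      using Suc.IH[of w' J] False bip[OF that] by auto
    then have "?t w' = 0" for w'
      by (intro sum.neutral) (auto simp: step_weight_def)
    then show ?thesis using False by auto
  next
    case True
    have "?t w' = coef (arc_weight \<rho> w w' * W w') (set_decode I)" for w'
    proof (cases "E w' w")
      case False
      then have "\<not> E w w'" using sym by blast
      then show ?thesis using False by (simp add: arc_weight_def plain_def labelled_def coef_simps)
    next
      case E: True
      have d: "dp E n K u \<rho> l w' J = coef (W w') (set_decode J)" for J
        using Suc.IH[of w' J] True bip[OF E] by (auto simp: W_def)
      have r: "?r w' = (if w \<in> A then w else w')" "?c w' = (if w \<in> A then w' else w)"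
        using True by auto
      have "?t w' = (\<Sum>i\<le>K. step_weight n \<rho> (?r w') (?c w') i I (\<lambda>J. coef (W w') (set_decode J)))"
        using E by (simp add: d[abs_def])
      also have "\<dots> = coef (arc_weight \<rho> w w' * W w') (set_decode I)"
        unfolding sum.atMost_shift r
        using E sym[OF E]
        by (auto simp: arc_weight_def distrib_right coef_simps mult.assoc label_form_def coef_linear_form_mult
            sum_distrib_left plain_def labelled_def step_weight_def in_set_decode set_decode_minus_power_2
            intro!: sum.cong arg_cong2[of _ _ _ _ "(+)"])
      finally show ?thesis .
    qed
    then show ?thesis using True by (simp add: coef_sum W_def)
  qed
qed

lemma dp_nonzero_imp_path:
  fixes \<rho> :: "nat \<Rightarrow> 'r::comm_ring_1"
  assumes char2: "(1::'r) + 1 = 0" and v: "v \<in> A" "v < n"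
    and nz: "dp E n K u \<rho> l v (2 ^ K - 1) \<noteq> 0"
  shows "\<exists>p. path_between E {..<n} v p u \<and> K \<le> length (filter (\<lambda>x. x \<in> A) p)"
proof (rule ccontr)
  assume "\<not> ?thesis"
  then have few: "length (filter (\<lambda>x. x \<in> A) p) < K" if "path_between E {..<n} v p u" for p
    using that by force
  have "deg_lt K (walks (arc_weight \<rho>) {..<n} l v u)"
    using walks_degree[where \<xi> = "plain \<rho>" and \<zeta> = "labelled \<rho>" and Y = "label_form \<rho>" and A = A
        and E = E and a = "arc_weight \<rho>" and K = K and H = "{..<n}" and w = v and u = u and j = K and l = l
        and y = "\<lambda>w i. \<rho> (2 * n * n + w * n + i)", OF char2]
      sym bip u v few
    by (auto simp: plain_def labelled_def arc_weight_def label_form_def)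
  then show False
    using nz set_decode_all[of K] by (auto simp: dp_eq_walks deg_lt_def split: if_splits)
qed

end

subsection \<open>A point at which the dynamic programme does not vanish\<close>

text \<open>
  At this point the only surviving walk of the length of the path \<open>p\<close> is \<open>p\<close> itself, and the label \<open>i\<close>
  can only be placed on the step that leaves the vertex \<open>p ! (2 * i)\<close>.
\<close>

definition witness_point :: "nat \<Rightarrow> nat \<Rightarrow> nat list \<Rightarrow> nat \<Rightarrow> 'r::comm_semiring_1" where
  "witness_point n K p q =
     (if q < n * n then of_bool (\<exists>j. Suc j < length p \<and>
          (q = p ! j * n + p ! Suc j \<or> q = p ! Suc j * n + p ! j))
      else if q < 2 * n * n then of_bool (\<exists>j. Suc j < length p \<and> even j \<and> q = n * n + p ! j * n + p ! Suc j)
      else of_bool (\<exists>i<K. q = 2 * n * n + p ! (2 * i) * n + i))"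

lemma row_major_inj:
  fixes n :: nat
  assumes "c < n" "c' < n"
  shows "r * n + c = r' * n + c' \<longleftrightarrow> r = r' \<and> c = c'"
proof
  assume eq: "r * n + c = r' * n + c'"
  have "(r * n + c) div n = r" "(r' * n + c') div n = r'" "(r * n + c) mod n = c" "(r' * n + c') mod n = c'"
    using assms by auto
  then show "r = r' \<and> c = c'" using eq by metis
qed auto

lemma row_major_less:
  fixes n :: nat
  assumes "r < m" "c < n"
  shows "r * n + c < m * n"
proof -
  have "r * n + c < Suc r * n" using assms by simp
  also have "\<dots> \<le> m * n" using assms by (intro mult_right_mono) auto
  finally show ?thesis .
qed

text \<open>Steps off the path have weight 0, and with at most \<open>L - j\<close> steps left a
  walk from \<open>p ! j\<close> cannot afford to turn back. An even position \<open>j\<close>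
  offers label \<open>j div 2\<close> only, so the labels still to be placed have
  \<open>2 * i\<close> at least \<open>j\<close>.\<close>

lemma dp_witness_point:
  fixes E :: "nat \<Rightarrow> nat \<Rightarrow> bool"
  assumes E: "\<And>j. j < L \<Longrightarrow> E (p ! Suc j) (p ! j)" and len: "length p = Suc L" and "odd L"
    and dist: "distinct p" and p: "set p \<subseteq> {..<n}" and K: "2 * K \<le> Suc L" "K \<le> n"
    and "j \<le> L" "l \<le> L - j"
  shows "dp E n K (p ! L) (witness_point n K p) l (p ! j) I =
    (of_bool (l = L - j \<and> (\<forall>i\<in>set_decode I. i < K \<and> j \<le> 2 * i)) :: 'r::comm_semiring_1)"
  using assms(8,9)
proof (induction l arbitrary: j I)
  case 0
  have "set_decode I = {} \<longleftrightarrow> I = 0"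
    by (metis set_decode_inverse set_decode_zero)
  moreover have "p ! j = p ! L \<longleftrightarrow> j = L"
    using dist 0 len by (simp add: nth_eq_iff_index_eq)
  moreover have "\<not> (i < K \<and> L \<le> 2 * i)" for i
    using K by auto
  ultimately show ?case using 0 by (cases "j = L") auto
next
  case (Suc l)
  let ?\<rho> = "witness_point n K p :: nat \<Rightarrow> 'r"
  let ?dp = "dp E n K (p ! L) ?\<rho>"
  have lt: "p ! i < n" if "i \<le> L" for i
    using p len that nth_mem[of i p] by (auto simp: subset_eq)
  have inj: "p ! i = p ! i' \<longleftrightarrow> i = i'" if "i \<le> L" "i' \<le> L" for i i'
    using dist len that by (simp add: nth_eq_iff_index_eq)
  have x: "?\<rho> (r * n + c) = of_bool (\<exists>j<L. (r = p ! j \<and> c = p ! Suc j) \<or> (r = p ! Suc j \<and> c = p ! j))"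
    if "r < n" "c < n" for r c
    using row_major_less[OF that] lt len that
    by (auto simp: witness_point_def row_major_inj intro!: arg_cong[of _ _ of_bool] ex_cong)
  have z: "?\<rho> (n * n + r * n + c) = of_bool (\<exists>j<L. even j \<and> r = p ! j \<and> c = p ! Suc j)"
    if "r < n" "c < n" for r c
    using row_major_less[OF that] lt len that
    by (auto simp: witness_point_def row_major_inj add.assoc intro!: arg_cong[of _ _ of_bool] ex_cong)
  have y: "?\<rho> (2 * n * n + r * n + i) = of_bool (r = p ! (2 * i))"
    if "r < n" "i < K" for r i
  proof -
    have "i' < n" "2 * i' \<le> L" if "i' < K" for i' using that K by auto
    then show ?thesis
      using that lt
      by (auto simp: witness_point_def row_major_inj add.assoc intro!: arg_cong[of _ _ of_bool])
  qed
  let ?r = "\<lambda>w'. if even l then p ! j else w'" and ?c = "\<lambda>w'. if even l then w' else p ! j"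
  let ?t = "\<lambda>w'. \<Sum>i\<le>K. if E w' (p ! j) then step_weight n ?\<rho> (?r w') (?c w') i I (?dp l w') else 0"
  have j: "j < L" "l \<le> L - Suc j" using Suc.prems by auto
  have other: "?t w' = 0" if w': "w' < n" "w' \<noteq> p ! Suc j" for w'
  proof (rule sum.neutral, intro ballI)
    fix i assume i: "i \<in> {..K}"
    show "(if E w' (p ! j) then step_weight n ?\<rho> (?r w') (?c w') i I (?dp l w') else 0) = 0"
    \<comment> \<open>A step back leaves too few steps to reach the end; any other vertex is not a
      neighbour of \<open>p ! j\<close> on the path.\<close>
    proof (cases "0 < j \<and> w' = p ! (j - 1)")
      case True
      then have "?dp l w' J = 0" for J
        using Suc.IH[of "j - 1" J] j by auto
      then show ?thesis by (simp add: step_weight_def)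
    next
      case False
      have n1: "\<not> (\<exists>i<L. (p ! j = p ! i \<and> w' = p ! Suc i) \<or> (p ! j = p ! Suc i \<and> w' = p ! i))"
        using False w' j inj by (metis Suc_leI diff_Suc_1 less_imp_le_nat zero_less_Suc)
      have "?\<rho> (?r w' * n + ?c w') = 0" "?\<rho> (n * n + ?r w' * n + ?c w') = 0"
        using n1 w' lt[of j] j by (auto simp: x z)
      then show ?thesis by (simp add: step_weight_def)
    qed
  qed
  have "?dp (Suc l) (p ! j) I = (\<Sum>w'<n. if w' = p ! Suc j then ?t (p ! Suc j) else 0)"
    unfolding dp.simps using other by (intro sum.cong) auto
  also have "\<dots> = ?t (p ! Suc j)" using lt[of "Suc j"] j by simp
  also have "\<dots> = (\<Sum>i\<le>K. step_weight n ?\<rho> (?r (p ! Suc j)) (?c (p ! Suc j)) i I (?dp l (p ! Suc j)))"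
    using E[OF j(1)] by simp
  also have "\<dots> = of_bool (Suc l = L - j \<and> (\<forall>i\<in>set_decode I. i < K \<and> j \<le> 2 * i))"
  proof (cases "l = L - Suc j")
    case False
    then have "?dp l (p ! Suc j) J = 0" for J
      using Suc.IH[of "Suc j" J] j by auto
    then have "step_weight n ?\<rho> r c i I (?dp l (p ! Suc j)) = 0" for r c i
      by (simp add: step_weight_def)
    then show ?thesis using False j by (simp only: sum.neutral_const) auto
  next
    case True
    have par: "even l \<longleftrightarrow> even j" using True j \<open>odd L\<close> by auto
    have d: "?dp l (p ! Suc j) J = of_bool (\<forall>i\<in>set_decode J. i < K \<and> Suc j \<le> 2 * i)" for J
      using Suc.IH[of "Suc j" J] j True by auto
    show ?thesis
    proof (cases "even j")
      case e: True
      have yy: "?\<rho> (2 * n * n + p ! j * n + i) = of_bool (j = 2 * i)" if "i < K" for i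
        using y[OF lt that, of j] inj[of j "2 * i"] j that K by auto
      \<comment> \<open>The first summand leaves the step plain, the second places label
        \<open>j div 2\<close>. Their conditions exclude each other, so the sum is 0 or 1 in every
        semiring.\<close>
      have "(\<Sum>i\<le>K. step_weight n ?\<rho> (?r (p ! Suc j)) (?c (p ! Suc j)) i I (?dp l (p ! Suc j))) =
          of_bool (\<forall>i\<in>set_decode I. i < K \<and> Suc j \<le> 2 * i) +
          (\<Sum>i<K. if i = j div 2 then of_bool (j div 2 \<in> set_decode I \<and> (\<forall>i\<in>set_decode I - {j div 2}. i < K \<and> Suc j \<le> 2 * i)) else 0)"
        unfolding sum.atMost_shift using e par j lt
        by (intro arg_cong2[of _ _ _ _ "(+)"] sum.cong)
          (auto simp: step_weight_def x z yy d in_set_decode[symmetric] set_decode_minus_power_2)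
      also have "\<dots> = of_bool (\<forall>i\<in>set_decode I. i < K \<and> j \<le> 2 * i)"
      proof -
        have 1: "Suc j \<le> 2 * i \<longleftrightarrow> j \<le> 2 * i \<and> i \<noteq> j div 2" for i using e by presburger
        have 2: "j \<le> 2 * (j div 2)" using e by simp
        show ?thesis unfolding 1 using 2 by (auto simp: of_bool_def)
      qed
      finally show ?thesis using True j by auto
    next
      case o: False
      \<comment> \<open>Labelled variables are set for steps that leave an even position, not for
        those that enter one.\<close>
      have z0: "?\<rho> (n * n + p ! Suc j * n + p ! j) = 0"
        using z[of "p ! Suc j" "p ! j"] lt j inj o by (auto simp: Suc_le_eq)
      have x1: "?\<rho> (p ! Suc j * n + p ! j) = 1"
        using x[of "p ! Suc j" "p ! j"] lt j by auto
      have "(\<Sum>i\<le>K. step_weight n ?\<rho> (?r (p ! Suc j)) (?c (p ! Suc j)) i I (?dp l (p ! Suc j))) =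
          of_bool (\<forall>i\<in>set_decode I. i < K \<and> Suc j \<le> 2 * i)"
        unfolding sum.atMost_shift using o par
        by (simp add: step_weight_def x1 z0 d cong: if_cong)
      moreover have "Suc j \<le> 2 * i \<longleftrightarrow> j \<le> 2 * i" for i using o by presburger
      ultimately show ?thesis using True j by auto
    qed
  qed
  finally show ?case .
qed

section \<open>Random evaluation\<close>

text \<open>The degree is bounded in each variable separately, along lines parallel to the axes;
  this is what an argument that replaces one coordinate at a time sees.\<close>

definition poly_fun :: "nat \<Rightarrow> ((nat \<Rightarrow> 'a::idom) \<Rightarrow> 'a) \<Rightarrow> bool" where
  "poly_fun d f \<longleftrightarrow> (\<forall>\<rho> q. \<exists>P. degree P \<le> d \<and> (\<forall>x. f (\<rho>(q := x)) = poly P x))"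

lemma poly_fun_const: "poly_fun d (\<lambda>_. c)"
  unfolding poly_fun_def by (intro allI exI[of _ "[:c:]"]) auto

lemma poly_fun_var: "poly_fun 1 (\<lambda>\<rho>. \<rho> q)"
  unfolding poly_fun_def
proof (intro allI)
  fix \<rho> :: "nat \<Rightarrow> 'a" and q'
  show "\<exists>P. degree P \<le> 1 \<and> (\<forall>x. (\<rho>(q' := x)) q = poly P x)"
    by (cases "q = q'") (auto intro: exI[of _ "[:0, 1:]"] exI[of _ "[:\<rho> q:]"])
qed

lemma poly_fun_add: "poly_fun d f \<Longrightarrow> poly_fun d g \<Longrightarrow> poly_fun d (\<lambda>\<rho>. f \<rho> + g \<rho>)"
  unfolding poly_fun_def by (metis degree_add_le poly_add)

lemma poly_fun_mult:
  assumes "poly_fun d f" "poly_fun d' g"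
  shows "poly_fun (d + d') (\<lambda>\<rho>. f \<rho> * g \<rho>)"
  unfolding poly_fun_def
proof (intro allI)
  fix \<rho> :: "nat \<Rightarrow> 'a" and q
  obtain P Q where "degree P \<le> d" "\<And>x. f (\<rho>(q := x)) = poly P x"
      "degree Q \<le> d'" "\<And>x. g (\<rho>(q := x)) = poly Q x"
    using assms unfolding poly_fun_def by metis
  then show "\<exists>P. degree P \<le> d + d' \<and> (\<forall>x. f (\<rho>(q := x)) * g (\<rho>(q := x)) = poly P x)"
    by (intro exI[of _ "P * Q"]) (use degree_mult_le[of P Q] in auto)
qed

lemma poly_fun_mono: "poly_fun d f \<Longrightarrow> d \<le> d' \<Longrightarrow> poly_fun d' f"
  unfolding poly_fun_def by (meson le_trans)

lemma poly_fun_sum: "(\<And>x. x \<in> A \<Longrightarrow> poly_fun d (f x)) \<Longrightarrow> poly_fun d (\<lambda>\<rho>. \<Sum>x\<in>A. f x \<rho>)"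
  by (induction A rule: infinite_finite_induct) (auto intro: poly_fun_add poly_fun_const)

lemma poly_fun_step_weight:
  assumes "\<And>J. poly_fun d (\<lambda>\<rho>. f \<rho> J)"
  shows "poly_fun (d + 2) (\<lambda>\<rho>. step_weight n \<rho> r c i I (f \<rho>))"
proof (cases "i = 0")
  case True
  have "poly_fun (1 + d) (\<lambda>\<rho>. \<rho> (r * n + c) * f \<rho> I)"
    by (intro poly_fun_mult poly_fun_var assms)
  then show ?thesis using True by (auto simp: step_weight_def intro: poly_fun_mono)
next
  case False
  have "poly_fun (1 + 1 + d) (\<lambda>\<rho>. \<rho> (n * n + r * n + c) * \<rho> (2 * n * n + r * n + (i - 1)) * f \<rho> (I - 2 ^ (i - 1)))"
    by (intro poly_fun_mult poly_fun_var assms)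
  then show ?thesis using False
    by (cases "odd (I div 2 ^ (i - 1))") (auto simp: step_weight_def intro: poly_fun_mono poly_fun_const)
qed

lemma poly_fun_dp: "poly_fun (2 * l) (\<lambda>\<rho> :: nat \<Rightarrow> 'a::idom. dp E n K u \<rho> l w I)"
proof (induction l arbitrary: w I)
  case 0
  show ?case unfolding dp.simps by (rule poly_fun_const)
next
  case (Suc l)
  have l: "2 * Suc l = 2 * l + 2" by simp
  show ?case unfolding dp.simps l
  proof (intro poly_fun_sum)
    fix w' i
    show "poly_fun (2 * l + 2) (\<lambda>\<rho> :: nat \<Rightarrow> 'a. if E w' w
       then step_weight n \<rho> (if even l then w else w') (if even l then w' else w) i I (dp E n K u \<rho> l w') else 0)"
    proof (cases "E w' w")
      case True
      show ?thesis unfolding if_P[OF True] by (rule poly_fun_step_weight) (rule Suc.IH)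
    next
      case False
      show ?thesis unfolding if_not_P[OF False] by (rule poly_fun_const)
    qed
  qed
qed

section \<open>The Schwartz-Zippel bound on grids\<close>

definition grid :: "'a set \<Rightarrow> (nat \<Rightarrow> 'a) \<Rightarrow> nat \<Rightarrow> (nat \<Rightarrow> 'a) set" where
  "grid S c Q = {\<rho>. (\<forall>i<Q. \<rho> i \<in> S) \<and> (\<forall>i\<ge>Q. \<rho> i = c i)}"

lemma grid_0: "grid S c 0 = {c}"
  by (auto simp: grid_def)

lemma grid_Suc: "grid S c (Suc Q) = (\<lambda>(\<rho>, x). \<rho>(Q := x)) ` (grid S c Q \<times> S)"
proof (intro equalityI subsetI)
  fix \<rho> assume "\<rho> \<in> grid S c (Suc Q)"
  then have "(\<rho>(Q := c Q), \<rho> Q) \<in> grid S c Q \<times> S" "\<rho> = (\<rho>(Q := c Q))(Q := \<rho> Q)"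
    by (auto simp: grid_def)
  then show "\<rho> \<in> (\<lambda>(\<rho>, x). \<rho>(Q := x)) ` (grid S c Q \<times> S)"
    by (metis (mono_tags, lifting) case_prod_conv image_eqI)
qed (auto simp: grid_def)

lemma grid_Suc_inj: "inj_on (\<lambda>(\<rho>, x). \<rho>(Q := x)) (grid S c Q \<times> S)"
proof (rule inj_onI, clarify)
  fix \<rho> x \<rho>' x' assume *: "\<rho> \<in> grid S c Q" "\<rho>' \<in> grid S c Q" "\<rho>(Q := x) = \<rho>'(Q := x')"
  then have "x = x'" by (metis fun_upd_same)
  moreover have "\<rho> i = \<rho>' i" for i
    using * by (cases "i = Q") (auto simp: grid_def dest: fun_cong[of _ _ i])
  ultimately show "\<rho> = \<rho>' \<and> x = x'" by auto
qed

lemma finite_grid: "finite S \<Longrightarrow> finite (grid S c Q)"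
  and card_grid: "finite S \<Longrightarrow> card (grid S c Q) = card S ^ Q"
proof -
  assume S: "finite S"
  show "finite (grid S c Q)"
    by (induction Q) (auto simp: grid_0 grid_Suc S)
  show "card (grid S c Q) = card S ^ Q"
    by (induction Q) (auto simp: grid_0 grid_Suc card_image[OF grid_Suc_inj] card_cartesian_product)
qed

text \<open>
  The point \<open>c\<close> where \<open>f\<close> does not vanish is replaced by random values one
  coordinate at a time.
\<close>

lemma schwartz_zippel:
  assumes f: "poly_fun d f" "f c \<noteq> 0" and S: "finite S"
  shows "card S * card {\<rho> \<in> grid S c Q. f \<rho> = 0} \<le> Q * d * card S ^ Q"
proof (induction Q)
  case 0
  have no_zero: "{\<rho> \<in> grid S c 0. f \<rho> = 0} = {}" using f(2) by (auto simp: grid_0)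
  show ?case unfolding no_zero by simp
next
  case (Suc Q)
  let ?B = "\<lambda>Q. {\<rho> \<in> grid S c Q. f \<rho> = 0}" and ?R = "\<lambda>\<rho>. {x \<in> S. f (\<rho>(Q := x)) = 0}"
  \<comment> \<open>On the line through \<open>\<rho>\<close> the polynomial is nonzero, since it
    does not vanish at the old value of coordinate \<open>Q\<close>.\<close>
  have roots: "card (?R \<rho>) \<le> d" if "\<rho> \<in> grid S c Q - ?B Q" for \<rho>
  proof -
    obtain P where P: "degree P \<le> d" "\<And>x. f (\<rho>(Q := x)) = poly P x"
      using f(1) unfolding poly_fun_def by metis
    have "f (\<rho>(Q := \<rho> Q)) \<noteq> 0" using that by auto
    then have "P \<noteq> 0" using P by (metis poly_0)
    then have "card {x. poly P x = 0} \<le> degree P" "finite {x. poly P x = 0}"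
      by (auto intro: card_poly_roots_bound poly_roots_finite)
    then show ?thesis using P by (auto intro: order_trans[OF card_mono])
  qed
  \<comment> \<open>A zero in the larger grid extends a zero of the smaller one or uses one of at
    most \<open>d\<close> roots.\<close>
  have "?B (Suc Q) \<subseteq> (\<lambda>(\<rho>, x). \<rho>(Q := x)) ` (?B Q \<times> S \<union> Sigma (grid S c Q - ?B Q) ?R)"
    unfolding grid_Suc by force
  then have "card (?B (Suc Q)) \<le> card (?B Q \<times> S \<union> Sigma (grid S c Q - ?B Q) ?R)"
    using S finite_grid[OF S, of c Q] by (intro surj_card_le) auto
  also have "\<dots> \<le> card (?B Q \<times> S) + card (Sigma (grid S c Q - ?B Q) ?R)"
    by (rule card_Un_le)
  also have "card (Sigma (grid S c Q - ?B Q) ?R) = (\<Sum>\<rho>\<in>grid S c Q - ?B Q. card (?R \<rho>))"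
    using S finite_grid[OF S, of c Q] by (intro card_SigmaI) auto
  also have "\<dots> \<le> card (grid S c Q - ?B Q) * d"
    using sum_bounded_above[of "grid S c Q - ?B Q" "\<lambda>\<rho>. card (?R \<rho>)" d] roots by auto
  also have "card (grid S c Q - ?B Q) \<le> card S ^ Q"
    using card_mono[OF finite_grid[OF S], of "grid S c Q - ?B Q" c Q] by (simp add: card_grid[OF S])
  finally have "card (?B (Suc Q)) \<le> card (?B Q) * card S + card S ^ Q * d"
    by (simp add: card_cartesian_product)
  then have "card S * card (?B (Suc Q)) \<le> card S * (card (?B Q) * card S + card S ^ Q * d)"
    by (rule mult_left_mono) simp
  also have "\<dots> \<le> Q * d * card S ^ Q * card S + card S * (card S ^ Q * d)"
    using mult_right_mono[OF Suc.IH, of "card S"] by (simp add: algebra_simps)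
  finally show ?case by (simp add: algebra_simps)
qed

section \<open>Random polynomials over GF(2)\<close>

definition bit_vectors :: "nat \<Rightarrow> (nat \<Rightarrow> nat) set" where
  "bit_vectors M = grid {0, 1} (\<lambda>_. 0) M"

lemma finite_bit_vectors: "finite (bit_vectors M)"
  and card_bit_vectors: "card (bit_vectors M) = 2 ^ M"
  by (simp_all add: bit_vectors_def finite_grid card_grid numeral_2_eq_2)

text \<open>The \<open>q\<close>-th variable takes its \<open>m\<close> coefficients from the
  \<open>q\<close>-th block of coins. They stay in \<open>nat\<close>, because the machine takes
  parities only when it reads off the answer.\<close>

definition block :: "nat \<Rightarrow> (nat \<Rightarrow> nat) \<Rightarrow> nat \<Rightarrow> nat poly" where
  "block m r q = (\<Sum>j<m. monom (r (q * m + j)) j)"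

lemma coeff_block: "coeff (block m r q) j = (if j < m then r (q * m + j) else 0)"
  by (simp add: block_def coeff_sum)

definition mod2 :: "nat poly \<Rightarrow> bit poly" where
  "mod2 = map_poly of_nat"

lemma coeff_mod2: "coeff (mod2 P) j = of_nat (coeff P j)"
  by (simp add: mod2_def coeff_map_poly)

lemma mod2_hom: "mod2 0 = 0" "mod2 1 = 1" "mod2 (P + Q) = mod2 P + mod2 Q" "mod2 (P * Q) = mod2 P * mod2 Q"
proof -
  show "mod2 0 = 0" by (rule poly_eqI) (simp only: coeff_mod2 coeff_0 of_nat_0)
  show "mod2 1 = 1" by (rule poly_eqI) (simp only: coeff_mod2 coeff_1 of_nat_of_bool)
  show "mod2 (P + Q) = mod2 P + mod2 Q"
    by (rule poly_eqI) (simp only: coeff_mod2 coeff_add of_nat_add)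
  show "mod2 (P * Q) = mod2 P * mod2 Q"
    by (rule poly_eqI) (simp only: coeff_mod2 coeff_mult of_nat_sum of_nat_mult)
qed

lemma bit_poly_char2: "(1 :: bit poly) + 1 = 0"
  by (rule poly_eqI) (simp only: coeff_add coeff_1 coeff_0, simp add: of_bool_def)

lemma bit_vector_le_1: "r \<in> bit_vectors M \<Longrightarrow> r i \<le> 1"
  by (cases "i < M") (auto simp: bit_vectors_def grid_def)

text \<open>Distinct coin vectors give distinct tuples of polynomials of degree below
  \<open>m\<close>, so counting coin vectors is counting points of a grid over 2^m values, where the
  fraction of zeros is at most Q * d / 2^m.\<close>

lemma card_bit_vectors_zero:
  fixes f :: "(nat \<Rightarrow> bit poly) \<Rightarrow> bit poly"
  assumes f: "poly_fun d f" "f c \<noteq> 0" and m: "3 * Q * d \<le> 2 ^ m"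
    and cong: "\<And>\<rho> \<rho>'. (\<And>q. q < Q \<Longrightarrow> \<rho> q = \<rho>' q) \<Longrightarrow> f \<rho> = f \<rho>'"
  shows "3 * card {r \<in> bit_vectors (Q * m). f (\<lambda>q. mod2 (block m r q)) = 0} \<le> card (bit_vectors (Q * m))"
proof -
  define S where "S = (\<lambda>r. mod2 (block m r 0)) ` bit_vectors m"
  have bit_inj: "(of_nat a :: bit) = of_nat b \<Longrightarrow> a \<le> 1 \<Longrightarrow> b \<le> 1 \<Longrightarrow> a = b" for a b :: nat
    by (cases "a = 0"; cases "b = 0") (auto simp: le_Suc_eq)
  have "inj_on (\<lambda>r. mod2 (block m r 0)) (bit_vectors m)"
  proof (rule inj_onI, rule ext)
    fix r r' i assume r: "r \<in> bit_vectors m" "r' \<in> bit_vectors m"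
      and eq: "mod2 (block m r 0) = mod2 (block m r' 0)"
    show "r i = r' i"
    proof (cases "i < m")
      case True
      then have "(of_nat (r i) :: bit) = of_nat (r' i)"
        using arg_cong[OF eq, of "\<lambda>P. coeff P i"] by (simp add: coeff_mod2 coeff_block)
      then show ?thesis using r by (intro bit_inj) (auto intro: bit_vector_le_1[unfolded One_nat_def])
    qed (use r in \<open>auto simp: bit_vectors_def grid_def\<close>)
  qed
  then have cardS: "card S = 2 ^ m" and finS: "finite S"
    by (auto simp: S_def card_image card_bit_vectors finite_bit_vectors)
  let ?\<Phi> = "\<lambda>r q. if q < Q then mod2 (block m r q) else c q"
  have block_S: "mod2 (block m r q) \<in> S" if "r \<in> bit_vectors (Q * m)" for r q
  proof -
    have "(\<lambda>j. if j < m then r (q * m + j) else 0) \<in> bit_vectors m"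
      using bit_vector_le_1[OF that] by (auto simp: bit_vectors_def grid_def le_Suc_eq)
    moreover have "block m r q = block m (\<lambda>j. if j < m then r (q * m + j) else 0) 0"
      by (rule poly_eqI) (simp add: coeff_block)
    ultimately show ?thesis unfolding S_def by auto
  qed
  have inj: "inj_on ?\<Phi> (bit_vectors (Q * m))"
  proof (rule inj_onI, rule ext)
    fix r r' i assume r: "r \<in> bit_vectors (Q * m)" "r' \<in> bit_vectors (Q * m)" and eq: "?\<Phi> r = ?\<Phi> r'"
    show "r i = r' i"
    proof (cases "i < Q * m")
      case True
      then have "0 < m" by (cases m) auto
      then have i: "i div m < Q" "i mod m < m" "(i div m) * m + i mod m = i"
        using True by (auto simp: less_mult_imp_div_less)
      have "mod2 (block m r (i div m)) = mod2 (block m r' (i div m))"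
        using fun_cong[OF eq, of "i div m"] i by simp
      then have "(of_nat (r i) :: bit) = of_nat (r' i)"
        using i by (metis coeff_block coeff_mod2)
      then show ?thesis using r by (intro bit_inj) (auto intro: bit_vector_le_1[unfolded One_nat_def])
    qed (use r in \<open>auto simp: bit_vectors_def grid_def\<close>)
  qed
  let ?Z = "{r \<in> bit_vectors (Q * m). f (\<lambda>q. mod2 (block m r q)) = 0}"
  have "?\<Phi> ` ?Z \<subseteq> {\<rho> \<in> grid S c Q. f \<rho> = 0}"
  proof clarify
    fix r assume r: "r \<in> bit_vectors (Q * m)" "f (\<lambda>q. mod2 (block m r q)) = 0"
    have "f (?\<Phi> r) = f (\<lambda>q. mod2 (block m r q))" by (rule cong) auto
    then show "?\<Phi> r \<in> grid S c Q \<and> f (?\<Phi> r) = 0"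
      using r block_S by (auto simp: grid_def)
  qed
  then have "card ?Z \<le> card {\<rho> \<in> grid S c Q. f \<rho> = 0}"
    using inj finite_grid[OF finS, of c Q] by (intro card_inj_on_le[where f = ?\<Phi>]) (auto simp: inj_on_def)
  then have "2 ^ m * card ?Z \<le> card S * card {\<rho> \<in> grid S c Q. f \<rho> = 0}"
    by (simp add: cardS)
  also have "\<dots> \<le> Q * d * card S ^ Q"
    by (rule schwartz_zippel[OF f finS])
  finally have "2 ^ m * (3 * card ?Z) \<le> (3 * Q * d) * card S ^ Q" by simp
  also have "\<dots> \<le> 2 ^ m * card S ^ Q" using m by (intro mult_right_mono) auto
  also have "card S ^ Q = card (bit_vectors (Q * m))"
    by (simp add: cardS card_bit_vectors mult.commute flip: power_mult)
  finally show ?thesis by simp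
qed


section \<open>Evaluation at a power of two\<close>

lemma coeff_le_poly_1: "coeff P d \<le> poly P (1::nat)"
proof (induction P arbitrary: d)
  case (pCons a P)
  show ?case
  proof (cases d)
    case (Suc d')
    then show ?thesis using pCons.IH[of d'] by simp
  qed auto
qed auto

lemma coeff_power_le_poly: "coeff P d * B ^ d \<le> poly P (B::nat)"
proof (induction P arbitrary: d)
  case (pCons a P)
  show ?case
  proof (cases d)
    case (Suc d')
    have "B * (coeff P d' * B ^ d') \<le> B * poly P B" using pCons.IH by (rule mult_left_mono) simp
    also have "\<dots> \<le> a + B * poly P B" by simp
    finally show ?thesis using Suc by (simp only: coeff_pCons_Suc poly_pCons power_Suc ac_simps)
  qed auto
qed auto

text \<open>Coefficients below \<open>B\<close> produce no carries, so dividing by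
  \<open>B ^ d\<close> shifts the coefficient list; as \<open>B\<close> is even, the parity of the
  result is that of its lowest digit.\<close>

lemma odd_digit_iff:
  fixes P :: "nat poly"
  assumes "\<And>d. coeff P d < B" "even B"
  shows "odd (poly P B div B ^ d) \<longleftrightarrow> odd (coeff P d)"
  using assms(1)
proof (induction P arbitrary: d)
  case (pCons a P)
  have a: "a < B" and P: "\<And>d. coeff P d < B"
    using pCons.prems[of 0] pCons.prems[of "Suc _"] by auto
  show ?case
  proof (cases d)
    case 0
    then show ?thesis using assms(2) by simp
  next
    case (Suc d')
    have "poly (pCons a P) B div B ^ d = poly P B div B ^ d'"
      using a by (simp add: Suc div_mult2_eq)
    then show ?thesis using pCons.IH[OF P] Suc by simp
  qed
qed auto

lemma mod2_eq_0_iff: "mod2 P = 0 \<longleftrightarrow> (\<forall>d. even (coeff P d))"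
proof -
  have "(of_nat a :: bit) = 0 \<longleftrightarrow> even a" for a :: nat
    by (induction a) auto
  then show ?thesis by (auto simp: poly_eq_iff coeff_mod2)
qed

definition evaluated :: "nat \<Rightarrow> nat \<Rightarrow> (nat \<Rightarrow> nat) \<Rightarrow> nat \<Rightarrow> nat" where
  "evaluated m B r q = (\<Sum>j<m. r (q * m + j) * B ^ j)"

lemma evaluated_eq_poly: "evaluated m B r q = poly (block m r q) B"
  by (simp add: evaluated_def block_def poly_sum poly_monom)

lemma evaluated_less:
  assumes "\<And>i. r i \<le> 1" "B \<ge> 2"
  shows "evaluated m B r q < B ^ m"
proof -
  have "evaluated m B r q \<le> (\<Sum>j<m. B ^ j)"
    unfolding evaluated_def using assms(1) by (intro sum_mono) (metis mult_le_mono1 mult_1)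
  also have "\<dots> < B ^ m"
  proof (induction m)
    case (Suc m)
    then have "(\<Sum>j<Suc m. B ^ j) < B ^ m + B ^ m" by simp
    also have "\<dots> \<le> B ^ Suc m" using assms(2) by (metis mult_2 mult_le_mono1 power_Suc)
    finally show ?case .
  qed auto
  finally show ?thesis .
qed

section \<open>Correctness of the randomised test\<close>

text \<open>The length of the path is unknown, so all lengths below \<open>n\<close> are tried. One
  odd digit shows that the polynomial modulo 2 is nonzero.\<close>

definition accepting :: "(nat \<Rightarrow> nat \<Rightarrow> bool) \<Rightarrow> nat \<Rightarrow> nat \<Rightarrow> nat \<Rightarrow> nat \<Rightarrow> nat \<Rightarrow> nat \<Rightarrow> nat \<Rightarrow> (nat \<Rightarrow> nat) \<Rightarrow> bool" where
  "accepting E n K m B D u v r \<longleftrightarrow>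
     (\<exists>l<n. \<exists>d<D. odd (dp E n K u (evaluated m B r) l v (2 ^ K - 1) div B ^ d))"

text \<open>Neighbours lie on different sides, so twice the count differs from the length by
  corrections at the ends only. Both vanish for a path from \<open>A\<close> to its
  complement.\<close>

lemma alternating_length:
  assumes bip: "\<And>x y. E x y \<Longrightarrow> x \<in> A \<longleftrightarrow> y \<notin> A" and "successively E p" "p \<noteq> []"
  shows "2 * length (filter (\<lambda>x. x \<in> A) p) + of_bool (hd p \<notin> A) = length p + of_bool (last p \<in> A)"
  using assms(2,3)
proof (induction p rule: induct_list012)
  case (3 x y zs)
  then show ?case using bip[of x y] by (cases "x \<in> A") auto
qed auto

lemma dp_evaluated: "dp E n K u (evaluated m B r) l w I = poly (dp E n K u (block m r) l w I) B"
  using dp_hom[of "\<lambda>P. poly P B" E n K u "block m r" l w I]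
  by (simp add: evaluated_eq_poly[abs_def])

text \<open>Origin of the 9 in \<open>B\<close>: the number of choices in a step takes at most 2n
  bits, the square of m = 4n at most 6n, and one more n makes the bound strict. Up to n steps give
  the exponent 9n^2.\<close>

lemma power_2_bounds:
  fixes n :: nat
  assumes "K \<le> n" "n \<ge> 1"
  shows "n * (K + 1) \<le> 2 ^ (2 * n)" "n * (K + 1) * (4 * n)\<^sup>2 < 2 ^ (9 * n)"
proof -
  have n: "n < 2 ^ n" by (rule less_exp)
  then have K: "K + 1 \<le> 2 ^ n" using assms by linarith
  show 1: "n * (K + 1) \<le> 2 ^ (2 * n)"
    using mult_mono[OF less_imp_le[OF n] K] by (simp add: mult_2 power_add)
  have "(2::nat) ^ 2 \<le> 2 ^ (2 * n)" using assms by (intro power_increasing) auto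
  then have "4 * n \<le> 2 ^ (2 * n) * 2 ^ n" using n by (intro mult_mono) auto
  also have "\<dots> = 2 ^ (3 * n)" by (simp flip: power_add)
  finally have "(4 * n)\<^sup>2 \<le> (2 ^ (3 * n))\<^sup>2" by (rule power_mono) simp
  also have "\<dots> = 2 ^ (6 * n)" by (simp flip: power_mult)
  finally have "n * (K + 1) * (4 * n)\<^sup>2 \<le> 2 ^ (2 * n) * 2 ^ (6 * n)" using 1 by (intro mult_mono) auto
  also have "\<dots> = 2 ^ (8 * n)" by (simp flip: power_add)
  also have "\<dots> < 2 ^ (9 * n)" using assms by (intro power_strict_increasing) auto
  finally show "n * (K + 1) * (4 * n)\<^sup>2 < 2 ^ (9 * n)" .
qed

context
  fixes n K m B D :: nat and r :: "nat \<Rightarrow> nat"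
  assumes K: "K \<le> n" and n: "n \<ge> 2" and m: "m = 4 * n" and B: "B = 2 ^ (9 * n\<^sup>2)" and D: "D = 10 * n\<^sup>2"
    and r: "\<And>i. r i \<le> 1"
begin

lemma B_ge: "B \<ge> 2"
proof -
  have "(2::nat) ^ 1 \<le> 2 ^ (9 * n\<^sup>2)" using n by (intro power_increasing) (auto simp: Suc_le_eq)
  then show ?thesis using B by simp
qed

lemma evaluated_le: "evaluated m B r q \<le> B ^ m"
  using evaluated_less[of r B m q] r B_ge by (simp add: less_imp_le)

text \<open>Origin of \<open>D\<close>: a step multiplies the bound by
  \<open>n * (K + 1) \<le> B\<close> and by two values of at most \<open>B ^ m\<close>. Over n steps
  the exponent is (2m + 1)n = 8n^2 + n, below 10n^2.\<close>

lemma dp_evaluated_less: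
  assumes "l \<le> n"
  shows "dp E n K u (evaluated m B r) l w I < B ^ D"
proof -
  have "(2::nat) ^ (2 * n) \<le> B" unfolding B
    using n by (intro power_increasing) (auto simp: power2_eq_square)
  then have nK: "n * (K + 1) \<le> B" using power_2_bounds(1)[OF K] n by linarith
  have "dp E n K u (evaluated m B r) l w I \<le> (n * (K + 1) * (B ^ m)\<^sup>2) ^ l"
    using B_ge by (intro dp_le evaluated_le) auto
  also have "\<dots> \<le> (B * (B ^ m)\<^sup>2) ^ l" using nK by (intro power_mono mult_right_mono) auto
  also have "\<dots> \<le> (B * (B ^ m)\<^sup>2) ^ n" using assms B_ge by (intro power_increasing) (auto simp: Suc_le_eq)
  also have "\<dots> = B ^ ((2 * m + 1) * n)"
    by (simp add: power_mult power_add mult.commute flip: power_Suc power_mult)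
  also have "\<dots> < B ^ D"
  proof (rule power_strict_increasing)
    have "n < 2 * (n * n)" using n by (cases n) auto
    then show "(2 * m + 1) * n < D" by (simp add: m D power2_eq_square algebra_simps)
  qed (use B_ge in auto)
  finally show ?thesis .
qed

text \<open>At 1 a polynomial over the naturals takes the sum of its coefficients, which bounds each
  of them; there a block is worth at most \<open>m\<close>.\<close>

lemma coeff_dp_less:
  assumes "l \<le> n"
  shows "coeff (dp E n K u (block m r) l w I) d < B"
proof -
  have "coeff (dp E n K u (block m r) l w I) d \<le> dp E n K u (evaluated m 1 r) l w I"
    unfolding dp_evaluated by (rule coeff_le_poly_1)
  also have "\<dots> \<le> (n * (K + 1) * m\<^sup>2) ^ l"
  proof (rule dp_le)
    have "evaluated m 1 r q \<le> (\<Sum>j<m. 1)" for q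
      unfolding evaluated_def using r by (intro sum_mono) simp
    then show "evaluated m 1 r q \<le> m" for q by simp
  qed (use n m in auto)
  also have "\<dots> \<le> (n * (K + 1) * m\<^sup>2) ^ n" using assms n m by (intro power_increasing) (auto simp: Suc_le_eq)
  also have "\<dots> < (2 ^ (9 * n)) ^ n"
    using power_2_bounds(2)[OF K] n unfolding m by (intro power_strict_mono) auto
  also have "\<dots> = B" by (simp add: B power2_eq_square mult.assoc flip: power_mult)
  finally show ?thesis .
qed

lemma odd_digit_dp_iff:
  assumes "l \<le> n"
  shows "(\<exists>d<D. odd (dp E n K u (evaluated m B r) l w I div B ^ d)) \<longleftrightarrow>
    dp E n K u (\<lambda>q. mod2 (block m r q)) l w I \<noteq> 0"
proof -
  let ?P = "dp E n K u (block m r) l w I"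
  have "even B" using B n by simp
  then have odd: "odd (poly ?P B div B ^ d) \<longleftrightarrow> odd (coeff ?P d)" for d
    using coeff_dp_less[OF assms] by (intro odd_digit_iff)
  have "d < D" if "odd (coeff ?P d)" for d
  proof -
    have "1 * B ^ d \<le> coeff ?P d * B ^ d" using odd_pos[OF that] by (intro mult_right_mono) auto
    also have "\<dots> \<le> poly ?P B" by (rule coeff_power_le_poly)
    also have "\<dots> < B ^ D" using dp_evaluated_less[OF assms] by (simp add: dp_evaluated)
    finally show ?thesis using B_ge by (simp add: power_strict_increasing_iff)
  qed
  then show ?thesis
    using dp_hom[of mod2 E n K u "block m r" l w I] mod2_eq_0_iff[of ?P]
    unfolding dp_evaluated odd by (auto simp: mod2_hom)
qed

end

context
  fixes n K m B D u v :: nat and E :: "nat \<Rightarrow> nat \<Rightarrow> bool" and A :: "nat set"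
  assumes K: "K \<le> n" and n: "n \<ge> 2" and m: "m = 4 * n" and B: "B = 2 ^ (9 * n\<^sup>2)" and D: "D = 10 * n\<^sup>2"
    and sym: "\<And>x y. E x y \<Longrightarrow> E y x"
    and bip: "\<And>x y. E x y \<Longrightarrow> x \<in> A \<longleftrightarrow> y \<notin> A"
    and u: "u \<notin> A" "u < n" and v: "v \<in> A" "v < n"
begin

lemma accepting_imp_path:
  assumes "r \<in> bit_vectors M" "accepting E n K m B D u v r"
  shows "\<exists>p. path_between E {..<n} v p u \<and> K \<le> length (filter (\<lambda>x. x \<in> A) p)"
proof -
  obtain l where l: "l < n" "\<exists>d<D. odd (dp E n K u (evaluated m B r) l v (2 ^ K - 1) div B ^ d)"
    using assms(2) unfolding accepting_def by blast
  then have "dp E n K u (\<lambda>q. mod2 (block m r q)) l v (2 ^ K - 1) \<noteq> 0"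
    using odd_digit_dp_iff[OF K n m B D bit_vector_le_1[OF assms(1)], of l] by simp
  then show ?thesis
    using dp_nonzero_imp_path[where E = E and A = A and u = u, OF sym bip u bit_poly_char2 v] by blast
qed

lemma path_imp_accepting:
  assumes p: "path_between E {..<n} v p u" "K \<le> length (filter (\<lambda>x. x \<in> A) p)"
  shows "3 * card {r \<in> bit_vectors (3 * n * n * m). \<not> accepting E n K m B D u v r} \<le> card (bit_vectors (3 * n * n * m))"
proof -
  define L where "L = length p - 1"
  have p': "p \<noteq> []" "hd p = v" "last p = u" "distinct p" "set p \<subseteq> {..<n}" "successively E p"
    using p(1) by (auto simp: path_between_def)
  have len: "length p = Suc L" using p'(1) by (simp add: L_def)
  have "2 * length (filter (\<lambda>x. x \<in> A) p) = Suc L"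
    using alternating_length[of E A p] bip p' u v len by auto
  then have KL: "2 * K \<le> Suc L" "odd L" using p(2) by (auto, presburger)
  have "card (set p) \<le> n" using card_mono[OF _ p'(5)] by simp
  then have L: "L < n" using p'(4) len by (simp add: distinct_card)
  have ends: "p ! 0 = v" "p ! L = u" using p' len by (auto simp: hd_conv_nth last_conv_nth)
  have arcs: "E (p ! Suc j) (p ! j)" if "j < L" for j
    using p'(6) that len sym by (auto simp: successively_conv_nth)
  define f where "f = (\<lambda>\<rho> :: nat \<Rightarrow> bit poly. dp E n K u \<rho> L v (2 ^ K - 1))"
  have "dp E n K u (witness_point n K p) L v (2 ^ K - 1) = (1 :: bit poly)"
    using dp_witness_point[of L E p n K 0 L "2 ^ K - 1", OF arcs len KL(2) p'(4,5) KL(1) K] ends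
    by (simp add: set_decode_all[simplified])
  then have f1: "f (witness_point n K p) \<noteq> 0" by (simp add: f_def)
  have f2: "poly_fun (2 * L) f" unfolding f_def by (rule poly_fun_dp)
  \<comment> \<open>Origin of m = 4n: there are 3n^2 variables, each of degree at most 2L < 2n, and
    three times the product is at most 18n^3 \<le> 16^n = 2^m.\<close>
  have m': "3 * (3 * n * n) * (2 * L) \<le> 2 ^ m"
  proof -
    have "18 * n ^ 3 \<le> 16 ^ n" using n
    proof (induction n rule: dec_induct)
      case (step n)
      have "n + 1 \<le> 2 * n" using step by simp
      then have "(n + 1) ^ 3 \<le> (2 * n) ^ 3" by (rule power_mono) simp
      also have "\<dots> = 8 * n ^ 3" by (simp add: power_mult_distrib)
      finally have "18 * (n + 1) ^ 3 \<le> 8 * (18 * n ^ 3)" by simp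
      also have "\<dots> \<le> 8 * 16 ^ n" using step by simp
      finally show ?case by simp
    qed simp
    moreover have "3 * (3 * n * n) * (2 * L) \<le> 18 * n ^ 3"
      using L by (simp add: power3_eq_cube)
    ultimately show ?thesis by (simp add: m power_mult)
  qed
  have "3 * card {r \<in> bit_vectors (3 * n * n * m). f (\<lambda>q. mod2 (block m r q)) = 0} \<le> card (bit_vectors (3 * n * n * m))"
    by (rule card_bit_vectors_zero[OF f2 f1 m']) (use K v in \<open>auto simp: f_def intro: dp_cong\<close>)
  moreover have "{r \<in> bit_vectors (3 * n * n * m). \<not> accepting E n K m B D u v r} \<subseteq>
      {r \<in> bit_vectors (3 * n * n * m). f (\<lambda>q. mod2 (block m r q)) = 0}"
  proof clarify
    fix r assume r: "r \<in> bit_vectors (3 * n * n * m)" "\<not> accepting E n K m B D u v r"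
    show "f (\<lambda>q. mod2 (block m r q)) = 0"
    proof (rule ccontr)
      assume "f (\<lambda>q. mod2 (block m r q)) \<noteq> 0"
      then have "\<exists>d<D. odd (dp E n K u (evaluated m B r) L v (2 ^ K - 1) div B ^ d)"
        using odd_digit_dp_iff[OF K n m B D bit_vector_le_1[OF r(1)], of L] L by (simp add: f_def)
      then show False using r(2) L unfolding accepting_def by blast
    qed
  qed
  then have "card {r \<in> bit_vectors (3 * n * n * m). \<not> accepting E n K m B D u v r} \<le>
      card {r \<in> bit_vectors (3 * n * n * m). f (\<lambda>q. mod2 (block m r q)) = 0}"
    by (rule card_mono[rotated]) (simp add: finite_bit_vectors)
  ultimately show ?thesis by linarith
qed

end


section \<open>Long cycles and simple paths\<close>

lemma pcas_imp_path:
  assumes "pcas w c y" "set c \<subseteq> parcs G"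
  shows "successively (\<lambda>x y. (x, y) \<in> parcs G) (w # map snd c) \<and> last (w # map snd c) = y"
  using assms
proof (induction c arbitrary: w)
  case (Cons e c)
  then show ?case
    by (cases e) (auto simp: successively_Cons)
qed auto

lemma path_imp_pcas:
  assumes "successively (\<lambda>x y. (x, y) \<in> parcs G) (w # p)"
  shows "pcas w (zip (w # p) p) (last (w # p)) \<and> set (zip (w # p) p) \<subseteq> parcs G"
  using assms
proof (induction p arbitrary: w)
  case (Cons x p)
  then show ?case by auto
qed auto

lemma pawalk_verts_eq_Cons:
  "pcas w c y \<Longrightarrow> pawalk_verts w c = w # map snd c"
  by (induction c arbitrary: w) auto

lemma pcas_append:
  "pcas w (c @ c') y \<longleftrightarrow>
    (\<exists>x. pcas w c x \<and> pcas x c' y)"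
  by (induction c arbitrary: w) auto

lemma path_between_rev:
  assumes "path_between E H w p y" "\<And>x y. E x y \<Longrightarrow> E y x"
  shows "path_between E H y (rev p) w"
  using assms by (auto simp: path_between_def hd_rev last_rev successively_rev intro: successively_mono)

text \<open>Deleting the edge from the cycle leaves a path with as many vertices as the cycle has
  edges. The cycle is rotated to start behind the edge, and the path is reversed if the edge was
  walked from \<open>v\<close> to \<open>u\<close>.\<close>

lemma long_cycle_iff_path:
  assumes G: "pair_graph G" and uv: "(u, v) \<in> parcs G"
  shows "long_cycle_through G (u, v) k \<longleftrightarrow>
    (\<exists>p. path_between (\<lambda>x y. (x, y) \<in> parcs G) (pverts G) v p u \<and> k \<le> length p \<and> 3 \<le> length p)"
    (is "_ \<longleftrightarrow> (\<exists>p. path_between ?E _ _ p _ \<and> _)")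
proof
  interpret pair_graph G by (rule G)
  have sym: "?E x y \<Longrightarrow> ?E y x" for x y by (rule arcs_symmetric)
  have arcsV: "x \<in> pverts G \<and> y \<in> pverts G" if "(x, y) \<in> parcs G" for x y
    using that in_arcsD1 in_arcsD2 by auto
  {
    assume "long_cycle_through G (u, v) k"
    then obtain c where c: "cycle c" "3 \<le> length c" "k \<le> length c" "(u, v) \<in> set c \<or> (v, u) \<in> set c"
      unfolding long_cycle_through_def simple_cycle_def by auto
    then obtain a b where ab: "(a, b) \<in> set c" "(a, b) = (u, v) \<or> (a, b) = (v, u)" by blast
    obtain c1 c2 where c12: "c = c1 @ (a, b) # c2" using split_list[OF ab(1)] by blast
    obtain x where x: "awalk x c x" "distinct (tl (pawalk_verts x c))" using c(1) unfolding cycle_def by blast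
    have cas: "pcas x c x" and sub: "set c \<subseteq> parcs G" using x(1) by (auto simp: awalk_def)
    have dist: "distinct (map snd c)" using x(2) pawalk_verts_eq_Cons[OF cas] by simp
    have "pcas x c1 a" "pcas b c2 x" using cas unfolding c12 pcas_append by auto
    then have rot: "pcas b (c2 @ c1) a" unfolding pcas_append by blast
    let ?p = "b # map snd (c2 @ c1)"
    have "set ?p \<subseteq> pverts G" using sub arcsV unfolding c12 by fastforce
    then have path: "path_between ?E (pverts G) b ?p a"
      using pcas_imp_path[OF rot] dist sub unfolding c12 path_between_def by auto
    have len: "length ?p = length c" by (simp add: c12)
    show "\<exists>p. path_between ?E (pverts G) v p u \<and> k \<le> length p \<and> 3 \<le> length p"
      using ab(2)
    proof
      assume "(a, b) = (u, v)"
      then show ?thesis using path len c(2,3) by (intro exI[of _ ?p]) auto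
    next
      assume "(a, b) = (v, u)"
      then show ?thesis using path_between_rev[OF path sym] len c(2,3) by (intro exI[of _ "rev ?p"]) auto
    qed
  next
    assume "\<exists>p. path_between ?E (pverts G) v p u \<and> k \<le> length p \<and> 3 \<le> length p"
    then obtain p where p: "path_between ?E (pverts G) v p u" "k \<le> length p" "3 \<le> length p" by blast
    obtain q where q: "p = v # q" using p(1) by (cases p) (auto simp: path_between_def)
    let ?c = "zip p q @ [(u, v)]"
    have path: "pcas v (zip p q) u" "set (zip p q) \<subseteq> parcs G"
      using path_imp_pcas[of G v q] p(1) by (auto simp: path_between_def q)
    moreover have "pcas u [(u, v)] v" by simp
    ultimately have cas: "pcas v ?c v" unfolding pcas_append by blast
    have "map snd ?c = q @ [v]" by (simp add: q map_snd_zip_take)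
    then have "pawalk_verts v ?c = v # q @ [v]" using pawalk_verts_eq_Cons[OF cas] by simp
    then have "cycle ?c"
      using cas path uv arcsV p(1) by (auto simp: cycle_def awalk_def path_between_def q)
    moreover have "length ?c = length p" by (simp add: q)
    ultimately show "long_cycle_through G (u, v) k"
      using p unfolding long_cycle_through_def simple_cycle_def by (intro exI[of _ ?c]) auto
  }
qed

section \<open>Cost of terminating runs\<close>

definition fits :: "nat \<Rightarrow> memory \<Rightarrow> bool" where
  "fits \<beta> s \<longleftrightarrow> (\<forall>x i. s x i < 2 ^ \<beta>)"

text \<open>Widths measure values in units of \<open>\<beta>\<close> bits, weights measure costs in
  units of \<open>\<beta>\<close> squared; both depend on the program text only. No operation yields
  more bits than the bounds of its two operands allow together, whence the sum.\<close>

primrec width :: "expr \<Rightarrow> nat" where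
  "width (Lit c) = bit_length c"
| "width (Load x i) = 1"
| "width (Bin f a b) = width a + width b"

primrec expr_weight :: "expr \<Rightarrow> nat" where
  "expr_weight (Lit c) = bit_length c"
| "expr_weight (Load x i) = expr_weight i + width i + 1"
| "expr_weight (Bin f a b) = expr_weight a + expr_weight b + width a * width b + width a + width b"

primrec com_weight :: "com \<Rightarrow> nat" where
  "com_weight Skip = 1"
| "com_weight (Store x i e) = expr_weight i + expr_weight e + width i + width e"
| "com_weight (Toss x i) = expr_weight i + width i + 1"
| "com_weight (Seq c d) = com_weight c + com_weight d"
| "com_weight (If b c d) = expr_weight b + com_weight c + com_weight d"
| "com_weight (While b c) = expr_weight b + com_weight c"

lemma bit_length_ge_1: "1 \<le> bit_length a"
  by (simp add: bit_length_def)

lemma less_power_bit_length: "a < 2 ^ bit_length a"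
  using floor_log_exp2_gt[of a] by (simp add: bit_length_def)

lemma bit_length_le:
  assumes "a < 2 ^ m" "1 \<le> m"
  shows "bit_length a \<le> m"
proof (cases "a = 0")
  case False
  then have "2 ^ floor_log a \<le> a" by (intro floor_log_exp2_le) simp
  then have "(2::nat) ^ floor_log a < 2 ^ m" using assms by linarith
  then show ?thesis by (simp add: bit_length_def)
qed (use assms in \<open>simp add: bit_length_def\<close>)

lemma width_ge_1: "1 \<le> width e"
  by (induction e) (auto simp: bit_length_ge_1[simplified])

lemma eval_less:
  assumes "fits \<beta> s" "1 \<le> \<beta>"
  shows "eval_expr e s < 2 ^ (width e * \<beta>)"
proof (induction e)
  case (Lit c)
  have "(2::nat) ^ bit_length c \<le> 2 ^ (bit_length c * \<beta>)" using assms by (intro power_increasing) auto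
  then show ?case using less_power_bit_length[of c] by (simp only: eval_expr.simps width.simps)
next
  case (Load x i)
  then show ?case using assms by (simp add: fits_def)
next
  case (Bin f a b)
  define x y p q where "x = eval_expr a s" and "y = eval_expr b s" and "p = width a * \<beta>" and "q = width b * \<beta>"
  have pq: "1 \<le> p" "1 \<le> q" using width_ge_1 assms by (auto simp: p_def q_def Suc_le_eq)
  have x: "x < 2 ^ p" and y: "y < 2 ^ q" using Bin by (auto simp: x_def y_def p_def q_def)
  have mono: "(2::nat) ^ p \<le> 2 ^ (p + q)" "(2::nat) ^ q \<le> 2 ^ (p + q)" by (auto intro: power_increasing)
  have x': "x < 2 ^ (p + q)" and y': "y < 2 ^ (p + q)" using x y mono by linarith+
  have bits: "take_bit (p + q) x = x" "take_bit (p + q) y = y"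
    using x' y' by (auto simp: take_bit_nat_eq_self_iff)
  have mul: "x * y < 2 ^ (p + q)"
    unfolding power_add using x y by (intro mult_strict_mono) auto
  have two: "(2::nat) \<le> 2 ^ p" "(2::nat) \<le> 2 ^ q"
    using power_increasing[OF pq(1), of "2::nat"] power_increasing[OF pq(2), of "2::nat"] by auto
  have "(1::nat) < 2 ^ (p + q)" using two(1) mono(1) by linarith
  then have one: "of_bool P < (2::nat) ^ (p + q)" for P by (cases P) auto
  have "apply_binop f x y < 2 ^ (p + q)"
  proof (cases f)
    case Add
    obtain c d where cd: "(2::nat) ^ p = c + 2" "(2::nat) ^ q = d + 2"
      using two by (metis add.commute le_Suc_ex)
    have "(2::nat) ^ p + 2 ^ q \<le> 2 ^ p * 2 ^ q" unfolding cd by (simp add: algebra_simps)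
    then show ?thesis using Add x y by (simp add: power_add)
  next
    case Div
    then show ?thesis using le_less_trans[OF div_le_dividend x'] by simp
  next
    case Mod
    then show ?thesis using le_less_trans[OF mod_less_eq_dividend x'] by simp
  next
    case And
    have "take_bit (p + q) (Bit_Operations.and x y) = Bit_Operations.and x y" by (simp add: bits)
    then show ?thesis using And by (simp only: take_bit_nat_eq_self_iff apply_binop.simps)
  next
    case Or
    have "take_bit (p + q) (Bit_Operations.or x y) = Bit_Operations.or x y" by (simp add: bits)
    then show ?thesis using Or by (simp only: take_bit_nat_eq_self_iff apply_binop.simps)
  next
    case Xor
    have "take_bit (p + q) (Bit_Operations.xor x y) = Bit_Operations.xor x y" by (simp add: bits)
    then show ?thesis using Xor by (simp only: take_bit_nat_eq_self_iff apply_binop.simps)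
  next
    case Less
    then show ?thesis using one by simp
  next
    case Equal
    then show ?thesis using one by simp
  qed (use x' mul in simp_all)
  then show ?case by (simp add: x_def y_def p_def q_def distrib_right)
qed

lemma bit_length_eval_le:
  assumes "fits \<beta> s" "1 \<le> \<beta>"
  shows "bit_length (eval_expr e s) \<le> width e * \<beta>"
  using eval_less[OF assms] width_ge_1[of e] assms(2) by (intro bit_length_le) (auto simp: Suc_le_eq)

lemma le_mult_square:
  fixes \<beta> :: nat
  assumes "1 \<le> \<beta>"
  shows "a \<le> a * \<beta>\<^sup>2" "a * \<beta> \<le> a * \<beta>\<^sup>2"
  using assms by (simp_all add: power2_eq_square Suc_le_eq)

lemma expr_cost_le:
  assumes "fits \<beta> s" "1 \<le> \<beta>"
  shows "expr_cost e s \<le> expr_weight e * \<beta>\<^sup>2"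
proof (induction e)
  case (Lit c)
  then show ?case using le_mult_square(1)[OF assms(2)] by simp
next
  case (Load x i)
  have "bit_length (eval_expr i s) \<le> width i * \<beta>\<^sup>2"
    using bit_length_eval_le[OF assms, of i] le_mult_square(2)[OF assms(2), of "width i"] by linarith
  moreover have "bit_length (s x (eval_expr i s)) \<le> 1 * \<beta>\<^sup>2"
    using bit_length_eval_le[OF assms, of "Load x i"] le_mult_square(2)[OF assms(2), of 1] by simp
  ultimately show ?case using Load by (simp add: algebra_simps)
next
  case (Bin f a b)
  have "bit_length (eval_expr a s) * bit_length (eval_expr b s) \<le> (width a * \<beta>) * (width b * \<beta>)"
    by (intro mult_mono bit_length_eval_le assms) auto
  moreover have "bit_length (eval_expr a s) \<le> width a * \<beta>\<^sup>2" "bit_length (eval_expr b s) \<le> width b * \<beta>\<^sup>2"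
    using bit_length_eval_le[OF assms, of a] le_mult_square(2)[OF assms(2), of "width a"]
      bit_length_eval_le[OF assms, of b] le_mult_square(2)[OF assms(2), of "width b"] by linarith+
  ultimately have "binop_cost f (eval_expr a s) (eval_expr b s) \<le> width a * width b * \<beta>\<^sup>2 + width a * \<beta>\<^sup>2 + width b * \<beta>\<^sup>2"
    by (auto simp: binop_cost_def power2_eq_square algebra_simps)
  then show ?case using Bin by (simp add: algebra_simps)
qed

text \<open>
  Since only numbers of at most \<open>\<beta>\<close> bits are stored, the cost of a run is bounded by the number of
  its elementary steps.
\<close>

inductive exec :: "nat \<Rightarrow> com \<Rightarrow> memory \<Rightarrow> memory \<Rightarrow> nat \<Rightarrow> bool" for \<beta> where
  Skip: "exec \<beta> Skip s s 1"
| Store: "eval_expr e s < 2 ^ \<beta> \<Longrightarrow> exec \<beta> (Store x i e) s (update s x (eval_expr i s) (eval_expr e s)) 1"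
| Seq: "exec \<beta> c s s' N \<Longrightarrow> exec \<beta> d s' s'' N' \<Longrightarrow> exec \<beta> (Seq c d) s s'' (N + N')"
| WhileFalse: "eval_expr b s = 0 \<Longrightarrow> exec \<beta> (While b c) s s 1"
| WhileTrue: "eval_expr b s \<noteq> 0 \<Longrightarrow> exec \<beta> c s s' N \<Longrightarrow> exec \<beta> (While b c) s' s'' N' \<Longrightarrow>
    exec \<beta> (While b c) s s'' (1 + N + N')"

lemma charge_return: "charge c (return_spmf (s, t)) = return_spmf (s, c + t)"
  by (simp add: charge_def)

text \<open>\<open>com_weight c\<close> adds up the weights of all expressions in the program and
  hence bounds the cost of any single step.\<close>

lemma exec_run:
  assumes "exec \<beta> c s s' N" "fits \<beta> s" "1 \<le> \<beta>"
  shows "fits \<beta> s' \<and> (\<exists>t \<le> N * (com_weight c * \<beta>\<^sup>2). run c s = return_spmf (s', t))"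
  using assms
proof induction
  case (Skip s)
  then show ?case by (simp add: Suc_le_eq)
next
  case (Store e s x i)
  have "bit_length (eval_expr i s) \<le> width i * \<beta>\<^sup>2" "bit_length (eval_expr e s) \<le> width e * \<beta>\<^sup>2"
    using bit_length_eval_le[OF Store.prems, of i] le_mult_square(2)[OF Store.prems(2), of "width i"]
      bit_length_eval_le[OF Store.prems, of e] le_mult_square(2)[OF Store.prems(2), of "width e"] by linarith+
  then show ?case
    using expr_cost_le[OF Store.prems, of i] expr_cost_le[OF Store.prems, of e] Store
    by (auto simp: fits_def update_def algebra_simps)
next
  case (Seq c s s' N d s'' N')
  obtain t t' where t: "t \<le> N * (com_weight c * \<beta>\<^sup>2)" "run c s = return_spmf (s', t)" "fits \<beta> s''"
      "t' \<le> N' * (com_weight d * \<beta>\<^sup>2)" "run d s' = return_spmf (s'', t')"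
    using Seq by blast
  have "N * (com_weight c * \<beta>\<^sup>2) + N' * (com_weight d * \<beta>\<^sup>2) \<le>
      N * ((com_weight c + com_weight d) * \<beta>\<^sup>2) + N' * ((com_weight c + com_weight d) * \<beta>\<^sup>2)"
    by (intro add_mono mult_mono) auto
  then show ?case using t by (auto simp: charge_return algebra_simps)
next
  case (WhileFalse b s c)
  then show ?case
    using expr_cost_le[OF WhileFalse.prems, of b]
    by (auto simp: run_while.simps charge_return algebra_simps)
next
  case (WhileTrue b s c s' N s'' N')
  obtain t t' where t: "t \<le> N * (com_weight c * \<beta>\<^sup>2)" "run c s = return_spmf (s', t)" "fits \<beta> s''"
      "t' \<le> N' * (com_weight (While b c) * \<beta>\<^sup>2)" "run (While b c) s' = return_spmf (s'', t')"
    using WhileTrue by blast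
  have "run (While b c) s = return_spmf (s'', expr_cost b s + (t + t'))"
    using WhileTrue.hyps(1) t by (simp add: run_while.simps[of b "run c" s] charge_return)
  moreover have "expr_cost b s + (t + t') \<le> (1 + N + N') * (com_weight (While b c) * \<beta>\<^sup>2)"
  proof -
    have "N * (com_weight c * \<beta>\<^sup>2) \<le> N * (com_weight (While b c) * \<beta>\<^sup>2)"
      by (intro mult_mono) auto
    moreover have "expr_cost b s \<le> com_weight (While b c) * \<beta>\<^sup>2"
      using expr_cost_le[OF WhileTrue.prems, of b] by (simp add: algebra_simps)
    ultimately have "expr_cost b s + (t + t') \<le> com_weight (While b c) * \<beta>\<^sup>2 +
        (N * (com_weight (While b c) * \<beta>\<^sup>2) + N' * (com_weight (While b c) * \<beta>\<^sup>2))"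
      using t(1,4) by linarith
    then show ?thesis by (simp only: distrib_right mult_1 add.assoc)
  qed
  ultimately show ?case using t by blast
qed

definition for_loop :: "string \<Rightarrow> expr \<Rightarrow> com \<Rightarrow> com" where
  "for_loop i b c = While (Bin Less (Load i (Lit 0)) b) (Seq c (Store i (Lit 0) (Bin Add (Load i (Lit 0)) (Lit 1))))"

definition loop_state :: "memory \<Rightarrow> string \<Rightarrow> string \<Rightarrow> nat \<Rightarrow> (nat \<Rightarrow> nat) \<Rightarrow> memory" where
  "loop_state s i x q X = s(i := (s i)(0 := q), x := X)"

text \<open>\<open>X q\<close> is the array after \<open>q\<close> rounds. A round takes three steps
  (test, store, increment), and the final test one more. Nested loops are flattened to one counter
  in the algorithm, so this rule covers all its deterministic loops.\<close>

lemma exec_for_loop: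
  assumes "i \<noteq> x" and s: "s i 0 = 0" "s x = X 0"
    and b: "\<And>q. q \<le> N \<Longrightarrow> eval_expr b (loop_state s i x q (X q)) = N"
    and e: "\<And>q. q < N \<Longrightarrow> eval_expr e (loop_state s i x q (X q)) < 2 ^ \<beta>"
    and X: "\<And>q. q < N \<Longrightarrow> X (Suc q) = (X q)(eval_expr a (loop_state s i x q (X q)) := eval_expr e (loop_state s i x q (X q)))"
    and N: "N < 2 ^ \<beta>"
  shows "exec \<beta> (for_loop i b (Store x a e)) s (loop_state s i x N (X N)) (1 + 3 * N)"
proof -
  have "exec \<beta> (for_loop i b (Store x a e)) (loop_state s i x q (X q)) (loop_state s i x N (X N)) (1 + 3 * (N - q))"
    if "q \<le> N" for q
    using that
  proof (induction rule: inc_induct)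
    case base
    have "eval_expr (Bin Less (Load i (Lit 0)) b) (loop_state s i x N (X N)) = 0"
      using b[of N] \<open>i \<noteq> x\<close> by (simp add: loop_state_def)
    then show ?case
      unfolding for_loop_def by (simp only: diff_self_eq_0 mult_0_right add_0_right exec.WhileFalse)
  next
    case (step q)
    let ?S = "\<lambda>q. loop_state s i x q (X q)"
    let ?T = "update (?S q) x (eval_expr a (?S q)) (eval_expr e (?S q))"
    have 1: "exec \<beta> (Store x a e) (?S q) ?T 1"
      using step e by (intro exec.Store) auto
    have T: "?T i 0 = q" using \<open>i \<noteq> x\<close> by (simp add: update_def loop_state_def)
    have "exec \<beta> (Store i (Lit 0) (Bin Add (Load i (Lit 0)) (Lit 1))) ?T
        (update ?T i (eval_expr (Lit 0) ?T) (eval_expr (Bin Add (Load i (Lit 0)) (Lit 1)) ?T)) 1"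
      using step N T by (intro exec.Store) simp
    also have "update ?T i (eval_expr (Lit 0) ?T) (eval_expr (Bin Add (Load i (Lit 0)) (Lit 1)) ?T) = ?S (Suc q)"
      using \<open>i \<noteq> x\<close> X step by (auto simp: update_def loop_state_def fun_eq_iff)
    finally have 2: "exec \<beta> (Seq (Store x a e) (Store i (Lit 0) (Bin Add (Load i (Lit 0)) (Lit 1)))) (?S q) (?S (Suc q)) (1 + 1)"
      using 1 by (rule exec.Seq[rotated])
    have "exec \<beta> (for_loop i b (Store x a e)) (?S q) (?S N) (1 + (1 + 1) + (1 + 3 * (N - Suc q)))"
      unfolding for_loop_def
      by (rule exec.WhileTrue[OF _ 2 step.IH[unfolded for_loop_def]])
        (use b[of q] step \<open>i \<noteq> x\<close> in \<open>simp add: loop_state_def\<close>)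
    moreover have "1 + (1 + 1) + (1 + 3 * (N - Suc q)) = 1 + 3 * (N - q)" using step by simp
    ultimately show ?case by simp
  qed
  moreover have "loop_state s i x 0 (X 0) = s"
    using s by (auto simp: loop_state_def fun_eq_iff)
  ultimately show ?thesis by (metis diff_zero le0)
qed


section \<open>Tossing a block of coins\<close>

text \<open>The coins still to be tossed when the counter is at \<open>i\<close>. Earlier positions
  are 0, so such a vector can be added to the bits already tossed.\<close>

definition bit_segment :: "nat \<Rightarrow> nat \<Rightarrow> (nat \<Rightarrow> nat) set" where
  "bit_segment i M = {g. (\<forall>j. g j \<in> {0, 1}) \<and> (\<forall>j. j < i \<or> M \<le> j \<longrightarrow> g j = 0)}"

lemma bit_segment_self: "bit_segment M M = {\<lambda>_. 0}"
  by (auto simp: bit_segment_def fun_eq_iff) (metis not_le)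

lemma bit_segment_Suc:
  assumes "i < M"
  shows "bit_segment i M = (\<lambda>(b, g). g(i := of_bool b)) ` (UNIV \<times> bit_segment (Suc i) M)"
proof (intro equalityI subsetI)
  fix g assume g: "g \<in> bit_segment i M"
  then have "g(i := 0) \<in> bit_segment (Suc i) M" by (auto simp: bit_segment_def)
  moreover have "g = (g(i := 0))(i := of_bool (g i = 1))" using g by (auto simp: bit_segment_def fun_eq_iff)
  ultimately show "g \<in> (\<lambda>(b, g). g(i := of_bool b)) ` (UNIV \<times> bit_segment (Suc i) M)"
    by (intro image_eqI[of _ _ "(g i = 1, g(i := 0))"]) auto
next
  fix g assume "g \<in> (\<lambda>(b, g). g(i := of_bool b)) ` (UNIV \<times> bit_segment (Suc i) M)"
  then obtain b g' where "g = g'(i := of_bool b)" "g' \<in> bit_segment (Suc i) M" by auto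
  then show "g \<in> bit_segment i M" using assms by (auto simp: bit_segment_def)
qed

lemma bit_segment_inj: "inj_on (\<lambda>(b, g). g(i := of_bool b :: nat)) (UNIV \<times> bit_segment (Suc i) M)"
proof (rule inj_onI, clarify)
  fix b b' and g g' :: "nat \<Rightarrow> nat"
  assume g: "g \<in> bit_segment (Suc i) M" "g' \<in> bit_segment (Suc i) M"
    and eq: "g(i := of_bool b) = g'(i := of_bool b')"
  have "b = b'" using fun_cong[OF eq, of i] by (auto split: if_splits simp: of_bool_def)
  moreover have "g j = g' j" for j
    using fun_cong[OF eq, of j] g by (cases "j = i") (auto simp: bit_segment_def)
  ultimately show "b = b' \<and> g = g'" by auto
qed

lemma pair_spmf_of_set_eq: "pair_spmf (spmf_of_set A) (spmf_of_set B) = spmf_of_set (A \<times> B)"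
proof (rule spmf_eqI, clarify)
  fix a b
  show "spmf (pair_spmf (spmf_of_set A) (spmf_of_set B)) (a, b) = spmf (spmf_of_set (A \<times> B)) (a, b)"
    by (auto simp: spmf_of_set card_cartesian_product indicator_def)
qed

lemma bind_coin_bit_segment:
  assumes "i < M"
  shows "bind_spmf coin_spmf (\<lambda>b. map_spmf (\<lambda>g. h (g(i := of_bool b))) (spmf_of_set (bit_segment (Suc i) M)))
    = map_spmf h (spmf_of_set (bit_segment i M))"
proof -
  have "map_spmf h (spmf_of_set (bit_segment i M)) =
      map_spmf h (map_spmf (\<lambda>(b, g). g(i := of_bool b)) (spmf_of_set (UNIV \<times> bit_segment (Suc i) M)))"
    unfolding bit_segment_Suc[OF assms] map_spmf_of_set_inj_on[OF bit_segment_inj] ..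
  also have "\<dots> = map_spmf h (map_spmf (\<lambda>(b, g). g(i := of_bool b)) (pair_spmf coin_spmf (spmf_of_set (bit_segment (Suc i) M))))"
    by (simp only: pair_spmf_of_set_eq)
  also have "\<dots> = bind_spmf coin_spmf (\<lambda>b. map_spmf (\<lambda>g. h (g(i := of_bool b))) (spmf_of_set (bit_segment (Suc i) M)))"
    by (simp add: pair_spmf_alt_def map_spmf_conv_bind_spmf bind_spmf_assoc)
  finally show ?thesis ..
qed

definition toss_loop :: "string \<Rightarrow> string \<Rightarrow> expr \<Rightarrow> com" where
  "toss_loop i r b = for_loop i b (Toss r (Load i (Lit 0)))"

text \<open>By \<open>b_cost\<close> the time does not depend on the outcomes; the joint
  distribution of memory and time is therefore the image of a uniform distribution, with one common
  \<open>t\<close>.\<close>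

lemma run_toss_loop:
  assumes "i \<noteq> r" and s: "s i 0 = 0" "s r = (\<lambda>_. 0)" "fits \<beta> s" "1 \<le> \<beta>"
    and b: "\<And>q X. eval_expr b (loop_state s i r q X) = M"
    and b_cost: "\<And>q X. expr_cost b (loop_state s i r q X) = expr_cost b (loop_state s i r q (\<lambda>_. 0))" and M: "M < 2 ^ \<beta>"
  shows "\<exists>t \<le> (1 + 3 * M) * (com_weight (toss_loop i r b) * \<beta>\<^sup>2).
    run (toss_loop i r b) s = map_spmf (\<lambda>g. (loop_state s i r M g, t)) (spmf_of_set (bit_segment 0 M))"
proof -
  let ?S = "loop_state s i r" and ?W = "com_weight (toss_loop i r b) * \<beta>\<^sup>2"
  let ?e = "Bin Add (Load i (Lit 0)) (Lit 1)"
  let ?g = "Bin Less (Load i (Lit 0)) b"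
  have fits: "fits \<beta> (?S q X)" if "q \<le> M" "\<And>j. X j \<le> 1" for q X
  proof -
    have "X j < 2 ^ \<beta>" for j
      using that(2)[of j] power_increasing[OF \<open>1 \<le> \<beta>\<close>, of "2::nat"] by simp
    then show ?thesis
      using s(3) that(1) M by (auto simp: fits_def loop_state_def)
  qed
  define k t1 t2 where "k q = expr_cost ?g (?S q (\<lambda>_. 0))"
    and "t1 q = expr_cost (Load i (Lit 0)) (?S q (\<lambda>_. 0)) + bit_length q + 1"
    and "t2 q = expr_cost (Lit 0) (?S q (\<lambda>_. 0)) + expr_cost ?e (?S q (\<lambda>_. 0)) + bit_length 0 + bit_length (q + 1)" for q
  have i0: "?S q X i 0 = q" for q X using \<open>i \<noteq> r\<close> by (simp add: loop_state_def)
  have k: "expr_cost ?g (?S q X) = k q" for q X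
    using b_cost[of q X] b[of q X] b[of q "\<lambda>_. 0"] by (simp add: k_def i0)
  have body: "run (Seq (Toss r (Load i (Lit 0))) (Store i (Lit 0) ?e)) (?S q X) =
      map_spmf (\<lambda>b. (?S (Suc q) (X(q := of_bool b)), t1 q + t2 q)) coin_spmf" for q X
  proof -
    have up: "update (?S q X) r q v = ?S q (X(q := v))" "update (?S q X) i 0 (Suc q) = ?S (Suc q) X" for X v
      using \<open>i \<noteq> r\<close> by (auto simp: update_def loop_state_def fun_eq_iff)
    have up': "(update (?S q X) r q v) i 0 = q" for v by (simp only: up i0)
    show ?thesis
      by (simp add: i0 up up' map_spmf_conv_bind_spmf bind_spmf_assoc charge_return t1_def t2_def add_ac)
  qed
  have kW: "k q \<le> ?W" if "q \<le> M" for q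
  proof -
    have "k q \<le> expr_weight ?g * \<beta>\<^sup>2" unfolding k_def using that fits \<open>1 \<le> \<beta>\<close> by (intro expr_cost_le) (auto simp del: One_nat_def)
    also have "\<dots> \<le> ?W" by (intro mult_right_mono) (auto simp: toss_loop_def for_loop_def)
    finally show ?thesis .
  qed
  have tW: "t1 q + t2 q \<le> ?W" if "q < M" for q
  proof -
    have f: "fits \<beta> (?S q (\<lambda>_. 0))" using that fits by auto
    note c = expr_cost_le[OF f \<open>1 \<le> \<beta>\<close>] and l = bit_length_eval_le[OF f \<open>1 \<le> \<beta>\<close>]
    have "bit_length q \<le> width (Load i (Lit 0)) * \<beta>\<^sup>2" "bit_length 0 \<le> width (Lit 0) * \<beta>\<^sup>2"
        "bit_length (q + 1) \<le> width ?e * \<beta>\<^sup>2" "1 \<le> 1 * \<beta>\<^sup>2"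
      using l[of "Load i (Lit 0)"] l[of "Lit 0"] l[of ?e] le_mult_square[OF \<open>1 \<le> \<beta>\<close>]
      by (fastforce simp only: eval_expr.simps i0 apply_binop.simps intro: order_trans)+
    then have "t1 q + t2 q \<le> expr_weight (Load i (Lit 0)) * \<beta>\<^sup>2 + width (Load i (Lit 0)) * \<beta>\<^sup>2 + 1 * \<beta>\<^sup>2 +
       (expr_weight (Lit 0) * \<beta>\<^sup>2 + expr_weight ?e * \<beta>\<^sup>2 + width (Lit 0) * \<beta>\<^sup>2 + width ?e * \<beta>\<^sup>2)"
      unfolding t1_def t2_def using c[of "Load i (Lit 0)"] c[of "Lit 0"] c[of ?e] by linarith
    also have "\<dots> = com_weight (Seq (Toss r (Load i (Lit 0))) (Store i (Lit 0) ?e)) * \<beta>\<^sup>2"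
      unfolding com_weight.simps distrib_right by simp
    also have "\<dots> \<le> ?W" by (intro mult_right_mono) (auto simp: toss_loop_def for_loop_def)
    finally show ?thesis .
  qed
  have "\<exists>t \<le> (1 + 3 * (M - q)) * ?W. \<forall>X. (\<forall>j. X j \<le> 1) \<longrightarrow> (\<forall>j\<ge>q. X j = 0) \<longrightarrow>
      run (toss_loop i r b) (?S q X) = map_spmf (\<lambda>g. (?S M (\<lambda>j. X j + g j), t)) (spmf_of_set (bit_segment q M))"
    if "q \<le> M" for q
    using that
  proof (induction rule: inc_induct)
    case base
    have "run (toss_loop i r b) (?S M X) = return_spmf (?S M X, k M)" for X
      using b[of M X] k[of M X]
      by (simp add: toss_loop_def for_loop_def run_while.simps charge_return i0)
    then show ?case using kW[of M] by (intro exI[of _ "k M"]) (simp add: bit_segment_self spmf_of_set_singleton)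
  next
    case (step q)
    then obtain t where t: "t \<le> (1 + 3 * (M - Suc q)) * ?W"
      "\<And>X. (\<forall>j. X j \<le> 1) \<Longrightarrow> (\<forall>j\<ge>Suc q. X j = 0) \<Longrightarrow> run (toss_loop i r b) (?S (Suc q) X) =
        map_spmf (\<lambda>g. (?S M (\<lambda>j. X j + g j), t)) (spmf_of_set (bit_segment (Suc q) M))"
      by blast
    let ?t = "k q + (t1 q + t2 q + t)"
    have "run (toss_loop i r b) (?S q X) = map_spmf (\<lambda>g. (?S M (\<lambda>j. X j + g j), ?t)) (spmf_of_set (bit_segment q M))"
      if X: "\<forall>j. X j \<le> 1" "\<forall>j\<ge>q. X j = 0" for X
    proof -
      have guard: "eval_expr ?g (?S q X) \<noteq> 0" using b[of q X] step by (simp add: i0)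
      have "run (toss_loop i r b) (?S q X) = charge (k q) (bind_spmf coin_spmf (\<lambda>v.
          charge (t1 q + t2 q) (run (toss_loop i r b) (?S (Suc q) (X(q := of_bool v))))))"
        unfolding toss_loop_def for_loop_def run.simps(6)
        by (subst run_while.simps) (simp only: guard if_False body k bind_map_spmf o_def case_prod_conv)
      also have "\<dots> = charge (k q) (bind_spmf coin_spmf (\<lambda>v. charge (t1 q + t2 q)
          (map_spmf (\<lambda>g. (?S M (\<lambda>j. (X(q := of_bool v)) j + g j), t)) (spmf_of_set (bit_segment (Suc q) M)))))"
        using X by (subst t(2)) (auto simp: of_bool_def)
      also have "\<dots> = bind_spmf coin_spmf (\<lambda>v. map_spmf (\<lambda>g. (?S M (\<lambda>j. (X(q := of_bool v)) j + g j), ?t))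
          (spmf_of_set (bit_segment (Suc q) M)))"
        by (simp add: charge_def map_spmf_bind_spmf spmf.map_comp o_def)
      also have "\<dots> = bind_spmf coin_spmf (\<lambda>v. map_spmf (\<lambda>g. (?S M (\<lambda>j. X j + (g(q := of_bool v)) j), ?t))
          (spmf_of_set (bit_segment (Suc q) M)))"
      proof (intro bind_spmf_cong refl map_spmf_cong)
        fix v g assume "g \<in> set_spmf (spmf_of_set (bit_segment (Suc q) M))"
        then have "g q = 0" by (auto simp: set_spmf_of_set bit_segment_def split: if_splits)
        then have "(\<lambda>j. (X(q := of_bool v)) j + g j) = (\<lambda>j. X j + (g(q := of_bool v)) j)"
          using X by (auto simp: fun_eq_iff)
        then show "(?S M (\<lambda>j. (X(q := of_bool v)) j + g j), ?t) = (?S M (\<lambda>j. X j + (g(q := of_bool v)) j), ?t)"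
          by simp
      qed
      also have "\<dots> = map_spmf (\<lambda>g. (?S M (\<lambda>j. X j + g j), ?t)) (spmf_of_set (bit_segment q M))"
        by (rule bind_coin_bit_segment) (use step in simp)
      finally show ?thesis .
    qed
    moreover have "?t \<le> (1 + 3 * (M - q)) * ?W"
    proof -
      have "?t \<le> ?W + (?W + (1 + 3 * (M - Suc q)) * ?W)" using kW[of q] tW[of q] t(1) step by linarith
      also have "\<dots> = (3 + 3 * (M - Suc q)) * ?W" by (simp add: algebra_simps)
      also have "\<dots> \<le> (1 + 3 * (M - q)) * ?W" using step by (intro mult_right_mono) auto
      finally show ?thesis .
    qed
    ultimately show ?case by blast
  qed
  from this[of 0] obtain t where t: "t \<le> (1 + 3 * M) * ?W"
    "\<And>X. (\<forall>j. X j \<le> 1) \<Longrightarrow> (\<forall>j\<ge>0. X j = 0) \<Longrightarrow>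
      run (toss_loop i r b) (?S 0 X) = map_spmf (\<lambda>g. (?S M (\<lambda>j. X j + g j), t)) (spmf_of_set (bit_segment 0 M))"
    by auto
  have "?S 0 (\<lambda>_. 0) = s" using s by (auto simp: loop_state_def fun_eq_iff)
  then show ?thesis using t(1) t(2)[of "\<lambda>_. 0"] by auto
qed

section \<open>The algorithm\<close>

abbreviation var :: "string \<Rightarrow> expr" where
  "var x \<equiv> Load x (Lit 0)"

abbreviation add_expr (infixl "+\<^sub>e" 65) where "a +\<^sub>e b \<equiv> Bin Add a b"
abbreviation sub_expr (infixl "-\<^sub>e" 65) where "a -\<^sub>e b \<equiv> Bin Sub a b"
abbreviation mul_expr (infixl "*\<^sub>e" 70) where "a *\<^sub>e b \<equiv> Bin Mul a b"
abbreviation div_expr (infixl "div\<^sub>e" 70) where "a div\<^sub>e b \<equiv> Bin Div a b"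
abbreviation mod_expr (infixl "mod\<^sub>e" 70) where "a mod\<^sub>e b \<equiv> Bin Mod a b"

definition "block_length_expr = Lit 4 *\<^sub>e var ''n''"
definition "digit_bits_expr = Lit 9 *\<^sub>e (var ''n'' *\<^sub>e var ''n'')"
definition "digits_expr = Lit 10 *\<^sub>e (var ''n'' *\<^sub>e var ''n'')"
definition "coins_expr = Lit 3 *\<^sub>e var ''n'' *\<^sub>e var ''n'' *\<^sub>e block_length_expr"
definition "label_sets_expr = Load ''pw'' (var ''K'')"

definition "half_expr = (var ''k'' +\<^sub>e Lit 1) div\<^sub>e Lit 2"

text \<open>One table of powers of two serves twice: entry \<open>i\<close> is the mask of label
  \<open>i\<close>, and the entries at multiples of the digit length are the powers of
  \<open>B\<close>.\<close>

definition power_loop :: com where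
  "power_loop = for_loop ''i2'' (digit_bits_expr *\<^sub>e digits_expr)
     (Store ''pw'' (var ''i2'' +\<^sub>e Lit 1) (Lit 2 *\<^sub>e Load ''pw'' (var ''i2'')))"

definition value_loop :: com where
  "value_loop = for_loop ''i3'' coins_expr
     (Store ''val'' (var ''i3'' div\<^sub>e block_length_expr)
       (Load ''val'' (var ''i3'' div\<^sub>e block_length_expr) +\<^sub>e
        Load ''r'' (var ''i3'') *\<^sub>e Load ''pw'' (digit_bits_expr *\<^sub>e (var ''i3'' mod\<^sub>e block_length_expr))))"

text \<open>
  One counter runs over all tuples of a walk length \<open>l\<close>, a new vertex \<open>w\<close>, a label set \<open>I\<close>, an old
  vertex \<open>w'\<close> and a label \<open>i\<close>, the last component varying fastest.
\<close>

definition "dp_label = var ''i4'' mod\<^sub>e (var ''K'' +\<^sub>e Lit 1)"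
definition "dp_old = var ''i4'' div\<^sub>e (var ''K'' +\<^sub>e Lit 1) mod\<^sub>e var ''n''"
definition "dp_cell = var ''i4'' div\<^sub>e ((var ''K'' +\<^sub>e Lit 1) *\<^sub>e var ''n'')"
definition "dp_set = dp_cell mod\<^sub>e label_sets_expr"
definition "dp_new = dp_cell div\<^sub>e label_sets_expr mod\<^sub>e var ''n''"
definition "dp_length = dp_cell div\<^sub>e (label_sets_expr *\<^sub>e var ''n'')"
text \<open>Expressions have no conditional, so the parity of the length selects by multiplication
  with 0 or 1; the edge test and the choice of the label below work alike.\<close>

definition "dp_row = dp_new *\<^sub>e (Lit 1 -\<^sub>e dp_length mod\<^sub>e Lit 2) +\<^sub>e dp_old *\<^sub>e (dp_length mod\<^sub>e Lit 2)"
definition "dp_col = dp_old *\<^sub>e (Lit 1 -\<^sub>e dp_length mod\<^sub>e Lit 2) +\<^sub>e dp_new *\<^sub>e (dp_length mod\<^sub>e Lit 2)"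
definition "dp_source = (dp_length *\<^sub>e var ''n'' +\<^sub>e dp_old) *\<^sub>e label_sets_expr +\<^sub>e dp_set"
definition "dp_bit = Load ''pw'' (dp_label -\<^sub>e Lit 1)"
definition "dp_plain = Load ''val'' (dp_row *\<^sub>e var ''n'' +\<^sub>e dp_col) *\<^sub>e Load ''T'' dp_source"
text \<open>For label 0 truncated subtraction yields 0, and \<open>dp_increment\<close> cancels the
  resulting value by a factor 0. The mask is the lowest part of the address, so subtracting a set
  bit from the address subtracts it from the mask without a borrow.\<close>

definition "dp_labelled = (dp_set div\<^sub>e dp_bit) mod\<^sub>e Lit 2 *\<^sub>e
   (Load ''val'' (var ''n'' *\<^sub>e var ''n'' +\<^sub>e dp_row *\<^sub>e var ''n'' +\<^sub>e dp_col) *\<^sub>e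
    Load ''val'' (Lit 2 *\<^sub>e var ''n'' *\<^sub>e var ''n'' +\<^sub>e dp_row *\<^sub>e var ''n'' +\<^sub>e (dp_label -\<^sub>e Lit 1)) *\<^sub>e
    Load ''T'' (dp_source -\<^sub>e dp_bit))"
text \<open>The cell counter contains the old length; one layer of \<open>n * 2 ^ K\<close> entries
  further is the entry for the next length.\<close>

definition "dp_target = var ''n'' *\<^sub>e label_sets_expr +\<^sub>e dp_cell"
definition "dp_increment = Load ''adj'' (dp_old *\<^sub>e var ''n'' +\<^sub>e dp_new) *\<^sub>e
   (Bin Equal dp_label (Lit 0) *\<^sub>e dp_plain +\<^sub>e Bin Less (Lit 0) dp_label *\<^sub>e dp_labelled)"

definition dp_loop :: com where
  "dp_loop = for_loop ''i4''
     (var ''n'' *\<^sub>e var ''n'' *\<^sub>e label_sets_expr *\<^sub>e ((var ''K'' +\<^sub>e Lit 1) *\<^sub>e var ''n''))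
     (Store ''T'' dp_target (Load ''T'' dp_target +\<^sub>e dp_increment))"

definition output_loop :: com where
  "output_loop = for_loop ''i5'' (var ''n'' *\<^sub>e digits_expr)
     (Store ''out'' (Lit 0) (Bin Or (var ''out'')
       (Load ''T'' ((var ''i5'' div\<^sub>e digits_expr *\<^sub>e var ''n'' +\<^sub>e Load ''e'' (Lit 1)) *\<^sub>e label_sets_expr +\<^sub>e
          (label_sets_expr -\<^sub>e Lit 1))
        div\<^sub>e Load ''pw'' (digit_bits_expr *\<^sub>e (var ''i5'' mod\<^sub>e digits_expr)) mod\<^sub>e Lit 2)))"

text \<open>With truncated subtraction the first assignment computes the maximum of 2 and the
  rounded half of \<open>k\<close>. All walks end at the first endpoint of the edge, so its entry
  for length 0 and no labels is set to 1.\<close>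

definition deterministic_part :: com where
  "deterministic_part =
     Seq (Store ''K'' (Lit 0) (half_expr +\<^sub>e (Lit 2 -\<^sub>e half_expr)))
    (Seq (Store ''pw'' (Lit 0) (Lit 1))
    (Seq power_loop
    (Seq value_loop
    (Seq (Store ''T'' (var ''e'' *\<^sub>e label_sets_expr) (Lit 1))
    (Seq dp_loop output_loop)))))"

text \<open>A simple cycle has at most \<open>n\<close> edges, so \<open>k > n\<close> is rejected
  by leaving \<open>out\<close> at 0. In the other branch the number of labels is at most
  \<open>n\<close>, as the layout of the variables requires.\<close>

definition long_cycle_program :: com where
  "long_cycle_program = If (Bin Less (var ''n'') (var ''k'')) Skip
     (Seq (toss_loop ''i1'' ''r'' coins_expr) deterministic_part)"

lemmas const_expr_defs = block_length_expr_def digit_bits_expr_def digits_expr_def coins_expr_def label_sets_expr_def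

section \<open>Loop invariants of the deterministic part\<close>

definition powers :: "nat \<Rightarrow> nat \<Rightarrow> nat" where
  "powers q j = (if j \<le> q then 2 ^ j else 0)"

definition partial_values :: "nat \<Rightarrow> nat \<Rightarrow> (nat \<Rightarrow> nat) \<Rightarrow> nat \<Rightarrow> nat \<Rightarrow> nat" where
  "partial_values m B r q j = (\<Sum>t | t < q \<and> t div m = j. r t * B ^ (t mod m))"

lemma sum_up_to_Suc:
  fixes f :: "nat \<Rightarrow> nat"
  shows "(\<Sum>t | t < Suc q \<and> P t. f t) = (\<Sum>t | t < q \<and> P t. f t) + (if P q then f q else 0)"
proof -
  have "{t. t < Suc q \<and> P t} = (if P q then insert q {t. t < q \<and> P t} else {t. t < q \<and> P t})"
    by (auto simp: less_Suc_eq)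
  then show ?thesis by auto
qed

lemma div_eq_iff_block:
  fixes m :: nat
  assumes "0 < m"
  shows "t div m = j \<longleftrightarrow> t \<in> {j * m..<j * m + m}"
proof
  assume "t div m = j"
  then have "t = j * m + t mod m" by (metis div_mult_mod_eq)
  moreover have "t mod m < m" using assms by simp
  ultimately show "t \<in> {j * m..<j * m + m}" by (metis atLeastLessThan_iff le_add1 nat_add_left_cancel_less)
next
  assume "t \<in> {j * m..<j * m + m}"
  then show "t div m = j" by (intro div_nat_eqI) (auto simp: mult.commute)
qed

lemma sum_block:
  fixes f :: "nat \<Rightarrow> nat"
  assumes "j * m + m \<le> q" "0 < m"
  shows "(\<Sum>t | t < q \<and> t div m = j. f t) = (\<Sum>i<m. f (j * m + i))"
proof -
  have "{t. t < q \<and> t div m = j} = {0 + j * m..<m + j * m}"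
    using assms by (auto simp: div_eq_iff_block[OF assms(2)])
  then show ?thesis
    using sum.shift_bounds_nat_ivl[of f 0 "j * m" m]
    by (simp only: lessThan_atLeast0 add.commute)
qed

lemma partial_values_eq:
  assumes "j * m + m \<le> q" "0 < m"
  shows "partial_values m B r q j = evaluated m B r j"
  unfolding partial_values_def evaluated_def sum_block[OF assms] by simp

lemma partial_values_mono: "q \<le> q' \<Longrightarrow> partial_values m B r q j \<le> partial_values m B r q' j"
  unfolding partial_values_def by (intro sum_mono2) auto

context
  fixes n K m b B D Z :: nat and r :: "nat \<Rightarrow> nat" and E :: "nat \<Rightarrow> nat \<Rightarrow> bool" and u v \<beta> P :: nat
  assumes K: "K \<le> n" and n: "n \<ge> 2" and m: "m = 4 * n" and b: "b = 9 * n\<^sup>2" and B: "B = 2 ^ (9 * n\<^sup>2)"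
    and D: "D = 10 * n\<^sup>2" and Z: "Z = b * D" and P: "P = 2 ^ K"
    and r: "\<And>i. r i \<le> 1" and uv: "u < n" "v < n" and \<beta>: "\<beta> = Z + 1"
begin

lemma size_bounds: "10 * n ^ 3 \<le> Z" "12 * n ^ 3 \<le> Z" "5 * n \<le> Z" "m \<le> D" "0 < m" "0 < D" "2 ^ Z < (2::nat) ^ \<beta>"
proof -
  have 1: "Z = 90 * n * n ^ 3" by (simp add: Z b D power2_eq_square power3_eq_cube)
  then have "180 * n ^ 3 \<le> Z" using n by simp
  then show "10 * n ^ 3 \<le> Z" "12 * n ^ 3 \<le> Z" by linarith+
  have "n \<le> n ^ 3" using n by (intro self_le_power) auto
  then show "5 * n \<le> Z" using \<open>180 * n ^ 3 \<le> Z\<close> by linarith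
  show "m \<le> D" using n by (simp add: m D power2_eq_square)
  show "0 < m" "0 < D" using n by (simp_all add: m D)
  show "2 ^ Z < (2::nat) ^ \<beta>" by (simp add: \<beta>)
qed

lemma power_digit: "j \<le> D \<Longrightarrow> powers Z (b * j) = B ^ j"
  by (simp add: powers_def Z B b power_mult)

lemma exec_power_loop:
  assumes s: "s ''n'' 0 = n" "s ''i2'' 0 = 0" "s ''pw'' = powers 0"
  shows "exec \<beta> power_loop s (loop_state s ''i2'' ''pw'' Z (powers Z)) (1 + 3 * Z)"
  unfolding power_loop_def
proof (rule exec_for_loop)
  fix q assume q: "q < Z"
  have "(2::nat) ^ Suc q \<le> 2 ^ Z" using q by (intro power_increasing) auto
  then have "(2::nat) ^ Suc q < 2 ^ \<beta>" using size_bounds(7) by linarith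
  then show "eval_expr (Lit 2 *\<^sub>e Load ''pw'' (var ''i2'')) (loop_state s ''i2'' ''pw'' q (powers q)) < 2 ^ \<beta>"
    by (simp add: loop_state_def powers_def)
  show "powers (Suc q) = (powers q)
    (eval_expr (var ''i2'' +\<^sub>e Lit 1) (loop_state s ''i2'' ''pw'' q (powers q)) :=
     eval_expr (Lit 2 *\<^sub>e Load ''pw'' (var ''i2'')) (loop_state s ''i2'' ''pw'' q (powers q)))"
    by (auto simp: loop_state_def powers_def fun_eq_iff)
next
  have "Z < 2 ^ Z" by (rule less_exp)
  then show "Z < 2 ^ \<beta>" using size_bounds(7) by linarith
qed (use s in \<open>auto simp: loop_state_def const_expr_defs Z b D power2_eq_square\<close>)

lemma exec_value_loop:
  assumes s: "s ''n'' 0 = n" "s ''i3'' 0 = 0" "s ''val'' = (\<lambda>_. 0)" "s ''r'' = r" "s ''pw'' = powers Z"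
  shows "exec \<beta> value_loop s (loop_state s ''i3'' ''val'' (3 * n * n * m) (partial_values m B r (3 * n * n * m)))
    (1 + 3 * (3 * n * n * m))"
  unfolding value_loop_def
proof (rule exec_for_loop)
  fix q assume q: "q < 3 * n * n * m"
  let ?S = "loop_state s ''i3'' ''val'' q (partial_values m B r q)"
  let ?e = "Load ''val'' (var ''i3'' div\<^sub>e block_length_expr) +\<^sub>e
        Load ''r'' (var ''i3'') *\<^sub>e Load ''pw'' (digit_bits_expr *\<^sub>e (var ''i3'' mod\<^sub>e block_length_expr))"
  have ix: "eval_expr (var ''i3'' div\<^sub>e block_length_expr) ?S = q div m"
    using s by (simp add: loop_state_def const_expr_defs m)
  have "q mod m \<le> D" using size_bounds(4,5) by (meson le_trans less_imp_le mod_less_divisor)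
  then have "eval_expr ?e ?S = partial_values m B r q (q div m) + r q * B ^ (q mod m)"
    using s power_digit[of "q mod m"]
    by (simp add: loop_state_def const_expr_defs m b power2_eq_square)
  also have "\<dots> = partial_values m B r (Suc q) (q div m)"
    by (simp add: partial_values_def sum_up_to_Suc)
  finally have e: "eval_expr ?e ?S = partial_values m B r (Suc q) (q div m)" .
  have "partial_values m B r (Suc q) (q div m) \<le> partial_values m B r (Suc q + (q div m * m + m)) (q div m)"
    by (rule partial_values_mono) simp
  also have "\<dots> = evaluated m B r (q div m)"
    using size_bounds(5) by (intro partial_values_eq) auto
  also have "\<dots> \<le> B ^ m" by (rule evaluated_le[OF K n m B D r])
  also have "\<dots> \<le> B ^ D" using B_ge[OF K n m B D r] size_bounds(4) by (intro power_increasing) auto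
  also have "B ^ D = 2 ^ Z" by (simp add: Z B b power_mult)
  finally show "eval_expr ?e ?S < 2 ^ \<beta>" unfolding e using size_bounds(7) by linarith
  show "partial_values m B r (Suc q) = (partial_values m B r q)
      (eval_expr (var ''i3'' div\<^sub>e block_length_expr) ?S := eval_expr ?e ?S)"
    unfolding ix e by (auto simp: fun_eq_iff partial_values_def sum_up_to_Suc)
next
  have "3 * n * n * m = 12 * n ^ 3" by (simp add: m power3_eq_cube)
  then have "3 * n * n * m \<le> Z" using size_bounds(2) by (simp only:)
  also have "Z < 2 ^ Z" by (rule less_exp)
  finally show "3 * n * n * m < 2 ^ \<beta>" using size_bounds(7) by linarith
qed (use s in \<open>auto simp: loop_state_def const_expr_defs m partial_values_def fun_eq_iff\<close>)

definition walk_label :: "nat \<Rightarrow> nat" where "walk_label t = t mod (K + 1)"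
definition walk_old :: "nat \<Rightarrow> nat" where "walk_old t = t div (K + 1) mod n"
definition walk_cell :: "nat \<Rightarrow> nat" where "walk_cell t = t div ((K + 1) * n)"
definition walk_set :: "nat \<Rightarrow> nat" where "walk_set t = walk_cell t mod P"
definition walk_new :: "nat \<Rightarrow> nat" where "walk_new t = walk_cell t div P mod n"
definition walk_length :: "nat \<Rightarrow> nat" where "walk_length t = walk_cell t div (P * n)"

definition table_term :: "nat \<Rightarrow> nat" where
  "table_term t = (if E (walk_old t) (walk_new t)
     then step_weight n (evaluated m B r)
       (if even (walk_length t) then walk_new t else walk_old t)
       (if even (walk_length t) then walk_old t else walk_new t)
       (walk_label t) (walk_set t) (dp E n K u (evaluated m B r) (walk_length t) (walk_old t)) else 0)"

text \<open>The array after \<open>q\<close> rounds. The terms are stated with values of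
  \<open>dp\<close>; that the loop really reads these values is the content of
  \<open>table_source\<close>.\<close>

definition table :: "nat \<Rightarrow> nat \<Rightarrow> nat" where
  "table q c = (if c = u * P then 1 else 0) + (\<Sum>t | t < q \<and> n * P + walk_cell t = c. table_term t)"

lemma P_pos: "0 < P" by (simp add: P)

lemma sum_product_block:
  fixes f :: "nat \<Rightarrow> nat \<Rightarrow> nat"
  shows "(\<Sum>i<k * l. f (i div k) (i mod k)) = (\<Sum>i<l. \<Sum>j<k. f i j)"
proof (cases "k = 0")
  case False
  have "(\<Sum>i<k * l. f (i div k) (i mod k)) = (\<Sum>i<l. \<Sum>t = i * k..<i * k + k. f (t div k) (t mod k))"
    using sum.nat_group[of "\<lambda>i. f (i div k) (i mod k)" k l] by (simp add: mult.commute)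
  also have "\<dots> = (\<Sum>i<l. \<Sum>j<k. f i j)"
  proof (rule sum.cong[OF refl])
    fix i
    have "(\<Sum>t = i * k..<i * k + k. f (t div k) (t mod k)) = (\<Sum>t = 0 + i * k..<k + i * k. f (t div k) (t mod k))"
      by (simp add: add.commute)
    also have "\<dots> = (\<Sum>j = 0..<k. f ((j + i * k) div k) ((j + i * k) mod k))"
      by (rule sum.shift_bounds_nat_ivl)
    also have "\<dots> = (\<Sum>j<k. f i j)"
      using False by (intro sum.cong) auto
    finally show "(\<Sum>t = i * k..<i * k + k. f (t div k) (t mod k)) = (\<Sum>j<k. f i j)" .
  qed
  finally show ?thesis .
qed auto

lemma cell_less:
  assumes "l < L" "w < n" "I < P"
  shows "(l * n + w) * P + I < L * n * P"
  using row_major_less[OF row_major_less[OF assms(1,2)] assms(3)] .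

text \<open>With k = (K + 1) * n, the rounds j * k, ..., j * k + k - 1 all add to one entry, and
  decoding the counter reproduces the double sum of the recursion. The bound on \<open>q\<close>
  says that these rounds are over.\<close>

lemma table_eq_dp:
  assumes w: "w < n" and I: "I < P" and q: "l * n * P * ((K + 1) * n) \<le> q"
  shows "table q ((l * n + w) * P + I) = dp E n K u (evaluated m B r) l w I"
proof (cases l)
  case 0
  have "w * P + I < n * P" using row_major_less[OF w I] .
  then have "table q (w * P + I) = (if w * P + I = u * P + 0 then 1 else 0)"
    by (auto simp: table_def)
  also have "\<dots> = of_bool (w = u \<and> I = 0)"
    using row_major_inj[of I P 0 w u] I P_pos by (auto simp: of_bool_def)
  finally show ?thesis using 0 by simp
next
  case (Suc l')
  define j where "j = (l' * n + w) * P + I"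
  let ?k = "(K + 1) * n"
  have c: "(l * n + w) * P + I = n * P + j" by (simp add: Suc j_def algebra_simps)
  have "u * P < n * P" using uv P_pos by simp
  then have "n * P + j \<noteq> u * P" by linarith
  then have "table q (n * P + j) = (\<Sum>t | t < q \<and> t div ?k = j. table_term t)"
    by (auto simp: table_def walk_cell_def intro!: sum.cong)
  also have "\<dots> = (\<Sum>i<?k. table_term (j * ?k + i))"
  proof (rule sum_block)
    have "Suc j \<le> l * n * P" using cell_less[of l' l w I] Suc w I by (simp add: j_def)
    then have "Suc j * ?k \<le> l * n * P * ?k" by (rule mult_right_mono) simp
    then show "j * ?k + ?k \<le> q" using q by simp
  qed (use n in simp)
  also have "\<dots> = (\<Sum>i<(K + 1) * n. (\<lambda>w' i'. if E w' w
     then step_weight n (evaluated m B r) (if even l' then w else w') (if even l' then w' else w) i' I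
       (dp E n K u (evaluated m B r) l' w') else 0) (i div (K + 1)) (i mod (K + 1)))"
  proof (intro sum.cong refl)
    fix i assume "i \<in> {..<(K + 1) * n}"
    then have i: "i < (K + 1) * n" "i div (K + 1) < n" by (auto simp: less_mult_imp_div_less mult.commute)
    have 1: "walk_cell (j * ?k + i) = j" using i n by (simp add: walk_cell_def)
    have 2: "walk_label (j * ?k + i) = i mod (K + 1)"
      by (simp add: walk_label_def mult.assoc mult.left_commute[of j] del: mult_Suc mult_Suc_right)
    have "(j * ?k + i) div (K + 1) = j * n + i div (K + 1)"
      by (simp add: mult.assoc mult.left_commute[of j] del: mult_Suc mult_Suc_right)
    then have 3: "walk_old (j * ?k + i) = i div (K + 1)" using i by (simp add: walk_old_def)
    have 4: "walk_set (j * ?k + i) = I"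
      unfolding walk_set_def 1 using I by (simp add: j_def)
    have "j div P = l' * n + w" using I by (simp add: j_def)
    then have 5: "walk_new (j * ?k + i) = w" "walk_length (j * ?k + i) = l'"
      unfolding walk_new_def walk_length_def 1 div_mult2_eq using w by auto
    show "table_term (j * ?k + i) = (\<lambda>w' i'. if E w' w
     then step_weight n (evaluated m B r) (if even l' then w else w') (if even l' then w' else w) i' I
       (dp E n K u (evaluated m B r) l' w') else 0) (i div (K + 1)) (i mod (K + 1))"
      unfolding table_term_def 2 3 4 5 by simp
  qed
  also have "\<dots> = (\<Sum>w'<n. \<Sum>i'<K + 1. if E w' w
     then step_weight n (evaluated m B r) (if even l' then w else w') (if even l' then w' else w) i' I
       (dp E n K u (evaluated m B r) l' w') else 0)"
    by (rule sum_product_block)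
  also have "\<dots> = dp E n K u (evaluated m B r) l w I"
    unfolding Suc dp.simps Suc_eq_plus1[symmetric] lessThan_Suc_atMost ..
  finally show ?thesis unfolding c .
qed

lemma table_mono: "q \<le> q' \<Longrightarrow> table q c \<le> table q' c"
  unfolding table_def by (intro add_mono sum_mono2) auto

text \<open>An unfinished entry is at most the finished one, whose size is known. Length
  \<open>n\<close> occurs too, because rounds with old length \<open>n - 1\<close> write one layer
  ahead.\<close>

lemma table_less:
  assumes "c < (n + 1) * n * P"
  shows "table q c < 2 ^ Z"
proof -
  define l w I where "l = c div P div n" and "w = c div P mod n" and "I = c mod P"
  have c: "c = (l * n + w) * P + I"
    by (simp add: l_def w_def I_def)
  have "c div P < (n + 1) * n" using assms by (simp add: less_mult_imp_div_less)
  then have l: "l < n + 1" unfolding l_def by (rule less_mult_imp_div_less)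
  have "table q c \<le> table (q + l * n * P * ((K + 1) * n)) c" by (rule table_mono) simp
  also have "\<dots> = dp E n K u (evaluated m B r) l w I"
    unfolding c using n P_pos by (intro table_eq_dp) (auto simp: w_def I_def)
  also have "\<dots> < B ^ D" by (rule dp_evaluated_less[OF K n m B D r]) (use l in simp)
  also have "B ^ D = 2 ^ Z" by (simp add: Z B b power_mult)
  finally show ?thesis .
qed

text \<open>The length is the slowest component of the counter, so a layer is complete before it is
  read.\<close>

lemma table_source:
  assumes t: "t < n * n * P * ((K + 1) * n)" and I: "I < P"
  shows "table t ((walk_length t * n + walk_old t) * P + I) =
    dp E n K u (evaluated m B r) (walk_length t) (walk_old t) I"
proof (rule table_eq_dp)
  let ?k = "(K + 1) * n"
  have "walk_length t * (P * n) \<le> walk_cell t" "walk_cell t * ?k \<le> t"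
    unfolding walk_length_def walk_cell_def by (rule div_times_less_eq_dividend)+
  then have "walk_length t * (P * n) * ?k \<le> t"
    by (meson le_trans mult_le_mono1)
  then show "walk_length t * n * P * ?k \<le> t" by (simp add: ac_simps)
qed (use n I in \<open>auto simp: walk_old_def\<close>)

lemma exec_dp_loop:
  assumes s: "s ''n'' 0 = n" "s ''K'' 0 = K" "s ''i4'' 0 = 0" "s ''T'' = (\<lambda>_. 0)(u * P := 1)" "s ''pw'' = powers Z"
    and val: "\<And>j. j < 3 * n * n \<Longrightarrow> s ''val'' j = evaluated m B r j"
    and adj: "\<And>x y. x < n \<Longrightarrow> y < n \<Longrightarrow> s ''adj'' (x * n + y) = of_bool (E x y)"
  shows "exec \<beta> dp_loop s (loop_state s ''i4'' ''T'' (n * n * P * ((K + 1) * n)) (table (n * n * P * ((K + 1) * n))))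
    (1 + 3 * (n * n * P * ((K + 1) * n)))"
  unfolding dp_loop_def
proof (rule exec_for_loop)
  have KZ: "K \<le> Z" using K size_bounds(3) by simp
  fix t assume t: "t < n * n * P * ((K + 1) * n)"
  let ?S = "loop_state s ''i4'' ''T'' t (table t)"
  have sets: "eval_expr label_sets_expr ?S = P" and sn: "?S ''n'' 0 = n"
    using s KZ by (simp_all add: loop_state_def label_sets_expr_def powers_def P)
  have sK: "?S ''K'' 0 = K" "?S ''i4'' 0 = t" "?S ''T'' = table t" "?S ''val'' = s ''val''" "?S ''adj'' = s ''adj''"
      "?S ''pw'' = powers Z"
    using s by (simp_all add: loop_state_def)
  have lab: "eval_expr dp_label ?S = walk_label t"
    and old: "eval_expr dp_old ?S = walk_old t"
    and cell: "eval_expr dp_cell ?S = walk_cell t"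
    by (simp_all add: dp_label_def dp_old_def dp_cell_def sK sn walk_label_def walk_old_def walk_cell_def)
  have set: "eval_expr dp_set ?S = walk_set t"
    and new: "eval_expr dp_new ?S = walk_new t"
    and len: "eval_expr dp_length ?S = walk_length t"
    by (simp_all add: dp_set_def dp_new_def dp_length_def cell sets sn walk_set_def walk_new_def walk_length_def)
  define row col where "row = (if even (walk_length t) then walk_new t else walk_old t)"
    and "col = (if even (walk_length t) then walk_old t else walk_new t)"
  have row: "eval_expr dp_row ?S = row" and col: "eval_expr dp_col ?S = col"
    by (auto simp: dp_row_def dp_col_def new old len row_def col_def odd_iff_mod_2_eq_one)
  have lt: "walk_new t < n" "walk_old t < n" "row < n" "col < n" "walk_set t < P" "walk_label t \<le> K"
    using n P_pos by (auto simp: walk_new_def walk_old_def row_def col_def walk_set_def walk_label_def less_Suc_eq_le[symmetric])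
  have src: "eval_expr dp_source ?S = (walk_length t * n + walk_old t) * P + walk_set t"
    by (simp add: dp_source_def len old set sets sn)
  have tgt: "eval_expr dp_target ?S = n * P + walk_cell t"
    by (simp add: dp_target_def cell sets sn)
  let ?d = "dp E n K u (evaluated m B r) (walk_length t) (walk_old t)"
  have idx: "row * n + col < n * n" "row * n + (walk_label t - 1) < n * n"
    using lt K n by (auto intro!: row_major_less)
  have plain: "eval_expr dp_plain ?S = evaluated m B r (row * n + col) * ?d (walk_set t)"
    using idx table_source[OF t lt(5)] by (simp add: dp_plain_def row col src sK sn val)
  have bit: "eval_expr dp_bit ?S = 2 ^ (walk_label t - 1)"
    using lt(6) KZ by (simp add: dp_bit_def lab sK powers_def)
  have labelled: "eval_expr dp_labelled ?S = (if odd (walk_set t div 2 ^ (walk_label t - 1))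
      then evaluated m B r (n * n + row * n + col) * evaluated m B r (2 * n * n + row * n + (walk_label t - 1)) *
        ?d (walk_set t - 2 ^ (walk_label t - 1)) else 0)"
  proof (cases "odd (walk_set t div 2 ^ (walk_label t - 1))")
    case True
    then have "2 ^ (walk_label t - 1) \<le> walk_set t"
      by (metis div_less even_zero not_le)
    then have "(walk_length t * n + walk_old t) * P + walk_set t - 2 ^ (walk_label t - 1) =
        (walk_length t * n + walk_old t) * P + (walk_set t - 2 ^ (walk_label t - 1))" by simp
    moreover have "walk_set t - 2 ^ (walk_label t - 1) < P" using lt(5) by simp
    ultimately have T: "table t ((walk_length t * n + walk_old t) * P + walk_set t - 2 ^ (walk_label t - 1)) =
        ?d (walk_set t - 2 ^ (walk_label t - 1))"
      using table_source[OF t] by simp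
    have v: "s ''val'' (n * n + row * n + col) = evaluated m B r (n * n + row * n + col)"
      "s ''val'' (2 * n * n + row * n + (walk_label t - 1)) = evaluated m B r (2 * n * n + row * n + (walk_label t - 1))"
      using idx by (auto intro!: val)
    have one: "walk_set t div 2 ^ (walk_label t - 1) mod 2 = 1"
      using True by (simp only: odd_iff_mod_2_eq_one)
    show ?thesis unfolding if_P[OF True]
      by (simp only: dp_labelled_def eval_expr.simps apply_binop.simps row col src set bit lab sK sn v T one mult_1)
  next
    case False
    then have zero: "walk_set t div 2 ^ (walk_label t - 1) mod 2 = 0"
      by (simp only: even_iff_mod_2_eq_zero not_not)
    show ?thesis unfolding if_not_P[OF False]
      by (simp only: dp_labelled_def eval_expr.simps apply_binop.simps set bit zero mult_0)
  qed
  have "eval_expr dp_increment ?S = table_term t"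
  proof (cases "E (walk_old t) (walk_new t)")
    case True
    then show ?thesis
      by (simp add: dp_increment_def table_term_def lab plain labelled old new sK sn adj lt step_weight_def
          flip: row_def col_def)
  next
    case False
    then show ?thesis
      by (simp add: dp_increment_def table_term_def old new sK sn adj lt)
  qed
  then have e: "eval_expr (Load ''T'' dp_target +\<^sub>e dp_increment) ?S = table (Suc t) (n * P + walk_cell t)"
    by (simp add: tgt sK table_def sum_up_to_Suc)
  have "t < ((K + 1) * n) * (n * n * P)" using t by (simp add: mult.commute)
  then have "walk_cell t < n * n * P" unfolding walk_cell_def using less_mult_imp_div_less[of t "n * n * P" "(K + 1) * n"]
    by (simp add: mult.commute)
  then have "n * P + walk_cell t < (n + 1) * n * P" by (simp add: algebra_simps)
  then show "eval_expr (Load ''T'' dp_target +\<^sub>e dp_increment) ?S < 2 ^ \<beta>"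
    unfolding e using table_less[of "n * P + walk_cell t" "Suc t"] size_bounds(7) by linarith
  show "table (Suc t) = (table t)(eval_expr dp_target ?S := eval_expr (Load ''T'' dp_target +\<^sub>e dp_increment) ?S)"
    unfolding e tgt
  proof (rule ext)
    fix c
    show "table (Suc t) c = ((table t)(n * P + walk_cell t := table (Suc t) (n * P + walk_cell t))) c"
      by (cases "c = n * P + walk_cell t") (simp_all add: table_def sum_up_to_Suc)
  qed
next
  have pow: "n < 2 ^ n" by (rule less_exp)
  have "K + 1 \<le> 2 ^ n" using K pow by linarith
  moreover have "P \<le> 2 ^ n" unfolding P using K by (intro power_increasing) auto
  ultimately have "n * n * P * ((K + 1) * n) \<le> 2 ^ n * 2 ^ n * 2 ^ n * (2 ^ n * 2 ^ n)"
    using pow by (intro mult_mono) auto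
  also have "\<dots> = 2 ^ (5 * n)" by (simp flip: power_add)
  also have "\<dots> \<le> 2 ^ Z" using size_bounds(3) by (intro power_increasing) auto
  finally show "n * n * P * ((K + 1) * n) < 2 ^ \<beta>" using size_bounds(7) by linarith
next
  fix q
  show "eval_expr (var ''n'' *\<^sub>e var ''n'' *\<^sub>e label_sets_expr *\<^sub>e ((var ''K'' +\<^sub>e Lit 1) *\<^sub>e var ''n''))
      (loop_state s ''i4'' ''T'' q (table q)) = n * n * P * ((K + 1) * n)"
    using s K size_bounds(3) by (simp add: loop_state_def label_sets_expr_def powers_def P)
qed (use s in \<open>auto simp: table_def fun_eq_iff\<close>)

definition output_flag :: "nat \<Rightarrow> nat \<Rightarrow> nat" where
  "output_flag q = (\<lambda>_. 0)(0 := of_bool (\<exists>t<q. odd (dp E n K u (evaluated m B r) (t div D) v (2 ^ K - 1) div B ^ (t mod D))))"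

lemma output_flag_0: "output_flag 0 = (\<lambda>_. 0)"
  by (rule ext) (simp add: output_flag_def)

lemma output_accepting: "output_flag (n * D) 0 = of_bool (accepting E n K m B D u v r)"
proof -
  have "(\<exists>t<n * D. odd (dp E n K u (evaluated m B r) (t div D) v (2 ^ K - 1) div B ^ (t mod D))) \<longleftrightarrow>
      accepting E n K m B D u v r" (is "?L \<longleftrightarrow> ?R")
  proof
    assume ?L
    then obtain t where "t < n * D" "odd (dp E n K u (evaluated m B r) (t div D) v (2 ^ K - 1) div B ^ (t mod D))"
      by blast
    moreover have "t div D < n" using \<open>t < n * D\<close> by (rule less_mult_imp_div_less)
    moreover have "t mod D < D" using size_bounds(6) by simp
    ultimately show ?R unfolding accepting_def by blast
  next
    assume ?R
    then obtain l d where ld: "l < n" "d < D" "odd (dp E n K u (evaluated m B r) l v (2 ^ K - 1) div B ^ d)"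
      unfolding accepting_def by blast
    then have "l * D + d < n * D" "(l * D + d) div D = l" "(l * D + d) mod D = d"
      using row_major_less[of l n d D] by auto
    then show ?L using ld(3) by metis
  qed
  then show ?thesis by (simp add: output_flag_def)
qed

lemma or_of_bool: "Bit_Operations.or (of_bool p) (x mod 2) = (of_bool (p \<or> odd x) :: nat)"
  by (cases p; cases "odd x") (auto simp: odd_iff_mod_2_eq_one even_iff_mod_2_eq_zero)

lemma exec_output_loop:
  assumes s: "s ''n'' 0 = n" "s ''K'' 0 = K" "s ''i5'' 0 = 0" "s ''e'' 1 = v" "s ''pw'' = powers Z" "s ''out'' = (\<lambda>_. 0)"
    and T: "\<And>l. l < n \<Longrightarrow> s ''T'' ((l * n + v) * P + (P - 1)) = dp E n K u (evaluated m B r) l v (2 ^ K - 1)"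
  shows "exec \<beta> output_loop s (loop_state s ''i5'' ''out'' (n * D) (output_flag (n * D))) (1 + 3 * (n * D))"
  unfolding output_loop_def
proof (rule exec_for_loop)
  have KZ: "K \<le> Z" using K size_bounds(3) by simp
  fix t assume t: "t < n * D"
  let ?S = "loop_state s ''i5'' ''out'' t (output_flag t)"
  let ?e = "Bin Or (var ''out'')
       (Load ''T'' ((var ''i5'' div\<^sub>e digits_expr *\<^sub>e var ''n'' +\<^sub>e Load ''e'' (Lit 1)) *\<^sub>e label_sets_expr +\<^sub>e
          (label_sets_expr -\<^sub>e Lit 1))
        div\<^sub>e Load ''pw'' (digit_bits_expr *\<^sub>e (var ''i5'' mod\<^sub>e digits_expr)) mod\<^sub>e Lit 2)"
  have S: "?S ''n'' 0 = n" "?S ''i5'' 0 = t" "?S ''T'' = s ''T''" "?S ''e'' 1 = v" "?S ''pw'' = powers Z"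
      "?S ''out'' 0 = output_flag t 0" "?S ''K'' 0 = K"
    using s by (simp_all add: loop_state_def)
  have ex: "eval_expr label_sets_expr ?S = P" "eval_expr digits_expr ?S = D" "eval_expr digit_bits_expr ?S = b"
    using S KZ by (simp_all add: const_expr_defs D b powers_def P power2_eq_square)
  have lt: "t div D < n" using t by (rule less_mult_imp_div_less)
  have pw: "powers Z (b * (t mod D)) = B ^ (t mod D)"
    using size_bounds(6) by (intro power_digit) (simp add: less_imp_le)
  define Q where "Q t = odd (dp E n K u (evaluated m B r) (t div D) v (2 ^ K - 1) div B ^ (t mod D))" for t
  have flag: "output_flag q 0 = of_bool (\<exists>t<q. Q t)" for q
    by (simp add: output_flag_def Q_def)
  have "eval_expr ?e ?S = Bit_Operations.or (output_flag t 0)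
      (dp E n K u (evaluated m B r) (t div D) v (2 ^ K - 1) div B ^ (t mod D) mod 2)"
    by (simp only: eval_expr.simps apply_binop.simps S ex T[OF lt] pw)
  also have "\<dots> = of_bool ((\<exists>t'<t. Q t') \<or> Q t)"
    unfolding flag or_of_bool Q_def[symmetric] ..
  also have "\<dots> = output_flag (Suc t) 0"
    unfolding flag by (simp add: Ex_less_Suc disj_commute)
  finally have e: "eval_expr ?e ?S = output_flag (Suc t) 0" .
  have "output_flag (Suc t) 0 \<le> 1" by (simp add: output_flag_def)
  moreover have "(1::nat) < 2 ^ \<beta>" using size_bounds(7) by (metis le_less_trans one_le_numeral one_le_power)
  ultimately show "eval_expr ?e ?S < 2 ^ \<beta>" unfolding e by linarith
  show "output_flag (Suc t) = (output_flag t)(eval_expr (Lit 0) ?S := eval_expr ?e ?S)"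
    unfolding e by (simp add: output_flag_def)
next
  have "n * D = 10 * n ^ 3" by (simp add: D power2_eq_square power3_eq_cube)
  then have "n * D \<le> Z" using size_bounds(1) by (simp only:)
  also have "Z < 2 ^ Z" by (rule less_exp)
  finally show "n * D < 2 ^ \<beta>" using size_bounds(7) by linarith
qed (simp_all add: s loop_state_def const_expr_defs D power2_eq_square output_flag_0[unfolded D power2_eq_square])

end

text \<open>
  Two labels at least: the walk back and forth along the edge has only one vertex in \<open>A\<close>.
\<close>

definition label_count :: "nat \<Rightarrow> nat" where
  "label_count k = max 2 ((k + 1) div 2)"

context
  fixes n K m b B D Z :: nat and r :: "nat \<Rightarrow> nat" and E :: "nat \<Rightarrow> nat \<Rightarrow> bool" and u v \<beta> P :: nat
  assumes K: "K \<le> n" and n: "n \<ge> 2" and m: "m = 4 * n" and b: "b = 9 * n\<^sup>2" and B: "B = 2 ^ (9 * n\<^sup>2)"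
    and D: "D = 10 * n\<^sup>2" and Z: "Z = b * D" and P: "P = 2 ^ K"
    and r: "\<And>i. r i \<le> 1" and uv: "u < n" "v < n" and \<beta>: "\<beta> = Z + 1"
begin

lemma exec_deterministic_part:
  assumes s: "s ''n'' 0 = n" "s ''k'' 0 = k" "s ''e'' 0 = u" "s ''e'' 1 = v" "s ''r'' = r"
    and adj: "\<And>x y. x < n \<Longrightarrow> y < n \<Longrightarrow> s ''adj'' (x * n + y) = of_bool (E x y)"
    and zero: "\<And>x. x \<in> {''K'', ''pw'', ''val'', ''T'', ''out'', ''i2'', ''i3'', ''i4'', ''i5''} \<Longrightarrow> s x = (\<lambda>_. 0)"
    and k: "label_count k = K"
  shows "\<exists>s'. exec \<beta> deterministic_part s s'
      (7 + 3 * Z + 3 * (3 * n * n * m) + 3 * (n * n * P * ((K + 1) * n)) + 3 * (n * D)) \<and>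
    s' ''out'' 0 = of_bool (accepting E n K m B D u v r)"
proof -
  note ctx = K n m b B D Z P r uv \<beta>
  note bounds = size_bounds[OF ctx]
  let ?M = "3 * n * n * m" and ?N = "n * n * P * ((K + 1) * n)"
  have KZ: "K \<le> Z" using K bounds(3) by simp
  have lt: "x < 2 ^ \<beta>" if "x \<le> Z" for x
    using that less_exp[of Z] bounds(7) by linarith
  define s1 where "s1 = update s ''K'' 0 K"
  define s2 where "s2 = update s1 ''pw'' 0 1"
  define s3 where "s3 = loop_state s2 ''i2'' ''pw'' Z (powers Z)"
  define s4 where "s4 = loop_state s3 ''i3'' ''val'' ?M (partial_values m B r ?M)"
  define s5 where "s5 = update s4 ''T'' (u * P) 1"
  define s6 where "s6 = loop_state s5 ''i4'' ''T'' ?N (table n K m B r E u P ?N)"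
  define s7 where "s7 = loop_state s6 ''i5'' ''out'' (n * D) (output_flag n K m B D r E u v (n * D))"
  note defs = s1_def s2_def s3_def s4_def s5_def s6_def s7_def update_def loop_state_def
  have p0: "(\<lambda>_. 0)(0 := Suc 0) = powers 0" by (auto simp: powers_def fun_eq_iff)
  have "(k + 1) div 2 + (2 - (k + 1) div 2) = K"
    using k by (auto simp: label_count_def)
  then have half: "eval_expr (half_expr +\<^sub>e (Lit 2 -\<^sub>e half_expr)) s = K"
    using s by (simp add: half_expr_def)
  have "exec \<beta> (Store ''K'' (Lit 0) (half_expr +\<^sub>e (Lit 2 -\<^sub>e half_expr))) s s1 1"
    using exec.Store[of "half_expr +\<^sub>e (Lit 2 -\<^sub>e half_expr)" s \<beta> "''K''" "Lit 0"] lt[OF KZ]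
    unfolding half s1_def by simp
  moreover have "exec \<beta> (Store ''pw'' (Lit 0) (Lit 1)) s1 s2 1"
    using exec.Store[of "Lit 1" s1 \<beta> "''pw''" "Lit 0"] lt[of 1] bounds(3) n
    unfolding s2_def by simp
  moreover have "exec \<beta> power_loop s2 s3 (1 + 3 * Z)"
    unfolding s3_def by (rule exec_power_loop[OF ctx]) (simp_all add: defs s zero p0)
  moreover have "exec \<beta> value_loop s3 s4 (1 + 3 * ?M)"
    unfolding s4_def by (rule exec_value_loop[OF ctx]) (simp_all add: defs s zero)
  moreover have "exec \<beta> (Store ''T'' (var ''e'' *\<^sub>e label_sets_expr) (Lit 1)) s4 s5 1"
  proof -
    have "eval_expr (var ''e'' *\<^sub>e label_sets_expr) s4 = u * P"
      using KZ by (simp add: label_sets_expr_def defs s powers_def P)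
    then show ?thesis
      using exec.Store[of "Lit 1" s4 \<beta> "''T''" "var ''e'' *\<^sub>e label_sets_expr"] lt[of 1] bounds(3) n
      unfolding s5_def by simp
  qed
  moreover have "exec \<beta> dp_loop s5 s6 (1 + 3 * ?N)"
    unfolding s6_def
  proof (rule exec_dp_loop[OF ctx])
    fix j assume j: "j < 3 * n * n"
    have "Suc j * m \<le> ?M" using j by (intro mult_right_mono) auto
    then have "partial_values m B r ?M j = evaluated m B r j"
      using bounds(5) by (intro partial_values_eq) (auto simp: add.commute)
    then show "s5 ''val'' j = evaluated m B r j" by (simp add: defs)
  qed (simp_all add: defs s zero adj)
  moreover have "exec \<beta> output_loop s6 s7 (1 + 3 * (n * D))"
    unfolding s7_def
  proof (rule exec_output_loop[OF ctx])
    fix l assume l: "l < n"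
    have "l * n * P * ((K + 1) * n) \<le> n * n * P * ((K + 1) * n)"
      using l by (intro mult_right_mono) auto
    then have "table n K m B r E u P ?N ((l * n + v) * P + (P - 1)) = dp E n K u (evaluated m B r) l v (P - 1)"
      using uv(2) P by (intro table_eq_dp[OF ctx]) auto
    then show "s6 ''T'' ((l * n + v) * P + (P - 1)) = dp E n K u (evaluated m B r) l v (2 ^ K - 1)"
      by (simp add: defs P)
  qed (simp_all add: defs s[simplified] zero)
  ultimately have "exec \<beta> deterministic_part s s7
      (1 + (1 + ((1 + 3 * Z) + ((1 + 3 * ?M) + (1 + ((1 + 3 * ?N) + (1 + 3 * (n * D))))))))"
    unfolding deterministic_part_def by (intro exec.Seq)
  moreover have "(1 + (1 + ((1 + 3 * Z) + ((1 + 3 * ?M) + (1 + ((1 + 3 * ?N) + (1 + 3 * (n * D)))))))) =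
      7 + 3 * Z + 3 * ?M + 3 * ?N + 3 * (n * D)" by simp
  moreover have "s7 ''out'' 0 = of_bool (accepting E n K m B D u v r)"
    using output_accepting[OF ctx] by (simp add: s7_def loop_state_def)
  ultimately show ?thesis by metis
qed

end

section \<open>Distribution, answer and running time of the whole program\<close>

lemma bit_segment_eq_bit_vectors: "bit_segment 0 M = bit_vectors M"
  by (auto simp: bit_segment_def bit_vectors_def grid_def) (metis not_le)+

text \<open>As the length is the even number 2c, the bound by \<open>k\<close> may be halved and
  rounded up, and \<open>3 \<le> 2 * c\<close> amounts to \<open>2 \<le> c\<close>.\<close>

lemma label_count_iff:
  assumes "length p = 2 * c"
  shows "k \<le> length p \<and> 3 \<le> length p \<longleftrightarrow> label_count k \<le> c"
  using assms by (auto simp: label_count_def)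

definition total_weight :: nat where
  "total_weight = 1 + expr_weight (Bin Less (var ''n'') (var ''k'')) + com_weight (toss_loop ''i1'' ''r'' coins_expr) +
     com_weight deterministic_part"

text \<open>Three steps per round of the loops: 90n^4 rounds for the powers, 12n^3 each for tossing
  and for reading the coins, at most 2n^4 * 2^K for the table by (K + 1)n \<le> 2n^2, and 10n^3 for
  the digits.\<close>

definition step_bound :: "nat \<Rightarrow> nat \<Rightarrow> nat" where
  "step_bound n K = 10 + 3 * (90 * n ^ 4) + 6 * (12 * n ^ 3) + 3 * (2 * n ^ 4 * 2 ^ K) + 3 * (10 * n ^ 3)"

text \<open>Once the coins are fixed the run is deterministic, so its distribution is the image of
  uniform bit vectors under a function \<open>F\<close>, and probabilities become counts.\<close>

lemma run_long_cycle_program: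
  fixes G :: "nat pair_pre_digraph"
  assumes G: "pair_graph G" "pverts G = {..<n}" and e: "(u, v) \<in> parcs G" and n: "n \<ge> 2" and k: "k \<le> n"
  defines "\<beta> \<equiv> 90 * n ^ 4 + 1" and "K \<equiv> label_count k"
  obtains F where
    "run long_cycle_program (encode_instance G (u, v) k) = map_spmf F (spmf_of_set (bit_vectors (3 * n * n * (4 * n))))"
    "\<And>r. r \<in> bit_vectors (3 * n * n * (4 * n)) \<Longrightarrow>
      accepts (fst (F r)) \<longleftrightarrow> accepting (\<lambda>x y. (x, y) \<in> parcs G) n K (4 * n) (2 ^ (9 * n\<^sup>2)) (10 * n\<^sup>2) u v r"
    "\<And>r. r \<in> bit_vectors (3 * n * n * (4 * n)) \<Longrightarrow> snd (F r) \<le> step_bound n K * (total_weight * \<beta>\<^sup>2)"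
proof -
  interpret pair_graph G by (rule G(1))
  let ?E = "\<lambda>x y. (x, y) \<in> parcs G"
  let ?M = "3 * n * n * (4 * n)" and ?b = "9 * n\<^sup>2" and ?D = "10 * n\<^sup>2"
  let ?s = "encode_instance G (u, v) k" and ?W = "total_weight * \<beta>\<^sup>2"
  let ?acc = "accepting ?E n K (4 * n) (2 ^ ?b) ?D u v"
  have card: "card (pverts G) = n" using G(2) by simp
  have uv: "u < n" "v < n" using in_arcsD1[OF e] in_arcsD2[OF e] G(2) by auto
  have K: "K \<le> n" using n k by (auto simp: K_def label_count_def)
  have Z: "?b * ?D = 90 * n ^ 4" by (simp add: power2_eq_square power4_eq_xxxx)
  have \<beta>: "\<beta> = ?b * ?D + 1" unfolding Z \<beta>_def ..
  have \<beta>1: "1 \<le> \<beta>" by (simp add: \<beta>_def)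
  have n4: "n \<le> n ^ 4" using n by (intro self_le_power) auto
  have lt: "x < 2 ^ \<beta>" if "x \<le> \<beta>" for x
    using that less_exp[of \<beta>] by linarith
  have s: "?s ''n'' = (\<lambda>_. 0)(0 := n)" "?s ''k'' = (\<lambda>_. 0)(0 := k)" "?s ''e'' = (\<lambda>_. 0)(0 := u, 1 := v)"
    "?s ''adj'' = (\<lambda>i. of_bool (i < n * n \<and> (i div n, i mod n) \<in> parcs G))"
    "x \<notin> {''n'', ''k'', ''e'', ''adj''} \<Longrightarrow> ?s x = (\<lambda>_. 0)" for x
    by (auto simp: encode_instance_def Let_def card)
  have cells: "?s x i \<le> n" for x i
    using s(5)[of x] uv k n by (cases "x \<in> {''n'', ''k'', ''e'', ''adj''}") (auto simp: s(1-4) fun_upd_def)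
  have fits: "fits \<beta> ?s"
    unfolding fits_def
  proof (intro allI lt)
    show "?s x i \<le> \<beta>" for x i using cells[of x i] n4 unfolding \<beta>_def by linarith
  qed
  have coins: "eval_expr coins_expr (loop_state ?s ''i1'' ''r'' q X) = ?M" for q X
    by (simp add: coins_expr_def block_length_expr_def loop_state_def s)
  have n3: "12 * n ^ 3 \<le> 90 * n ^ 4"
  proof -
    have "n ^ 3 \<le> n ^ 4" using n by (intro power_increasing) auto
    then show ?thesis by linarith
  qed
  have M: "?M = 12 * n ^ 3" by (simp add: power3_eq_cube)
  have "?M < 2 ^ \<beta>" by (rule lt) (unfold M \<beta>_def, use n3 in linarith)
  then obtain t1 where t1: "t1 \<le> (1 + 3 * ?M) * (com_weight (toss_loop ''i1'' ''r'' coins_expr) * \<beta>\<^sup>2)"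
    "run (toss_loop ''i1'' ''r'' coins_expr) ?s =
      map_spmf (\<lambda>g. (loop_state ?s ''i1'' ''r'' ?M g, t1)) (spmf_of_set (bit_vectors ?M))"
    using run_toss_loop[of "''i1''" "''r''" ?s \<beta> coins_expr ?M] fits \<beta>1 coins
    by (auto simp: s bit_segment_eq_bit_vectors coins_expr_def block_length_expr_def loop_state_def)
  let ?steps = "7 + 3 * (?b * ?D) + 3 * ?M + 3 * (n * n * 2 ^ K * ((K + 1) * n)) + 3 * (n * ?D)"
  have "\<exists>s' t. run deterministic_part (loop_state ?s ''i1'' ''r'' ?M r) = return_spmf (s', t) \<and>
      t \<le> ?steps * (com_weight deterministic_part * \<beta>\<^sup>2) \<and> s' ''out'' 0 = of_bool (?acc r)"
    if r: "r \<in> bit_vectors ?M" for r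
  proof -
    let ?S = "loop_state ?s ''i1'' ''r'' ?M r"
    have r1: "r i \<le> 1" for i by (rule bit_vector_le_1[OF r])
    have "fits \<beta> ?S"
    proof -
      have "r i < 2 ^ \<beta>" for i using r1[of i] \<beta>1 by (intro lt) linarith
      then show ?thesis using fits \<open>?M < 2 ^ \<beta>\<close> by (auto simp: fits_def loop_state_def)
    qed
    moreover have "\<exists>s'. exec \<beta> deterministic_part ?S s' ?steps \<and> s' ''out'' 0 = of_bool (?acc r)"
    proof (rule exec_deterministic_part[OF K n refl refl refl refl refl refl r1 uv \<beta>])
      fix x y assume xy: "x < n" "y < n"
      then show "?S ''adj'' (x * n + y) = of_bool (?E x y)"
        using row_major_less[of x n y n] by (simp add: loop_state_def s)
    qed (auto simp: loop_state_def s K_def)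
    ultimately show ?thesis using exec_run[OF _ _ \<beta>1] by blast
  qed
  then obtain fin tm where fin: "\<And>r. r \<in> bit_vectors ?M \<Longrightarrow>
      run deterministic_part (loop_state ?s ''i1'' ''r'' ?M r) = return_spmf (fin r, tm r)"
    "\<And>r. r \<in> bit_vectors ?M \<Longrightarrow> tm r \<le> ?steps * (com_weight deterministic_part * \<beta>\<^sup>2)"
    "\<And>r. r \<in> bit_vectors ?M \<Longrightarrow> fin r ''out'' 0 = of_bool (?acc r)"
    by metis
  define c where "c = expr_cost (Bin Less (var ''n'') (var ''k'')) ?s"
  define F where "F = (\<lambda>r. (fin r, c + (t1 + tm r)))"
  show ?thesis
  proof (rule that)
    have "eval_expr (Bin Less (var ''n'') (var ''k'')) ?s = 0" using k by (simp add: s)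
    then have "run long_cycle_program ?s = charge c (bind_spmf (spmf_of_set (bit_vectors ?M))
        (\<lambda>r. charge t1 (run deterministic_part (loop_state ?s ''i1'' ''r'' ?M r))))"
      by (simp only: long_cycle_program_def run.simps t1(2) c_def bind_map_spmf o_def case_prod_conv not_True_eq_False
          simp_thms if_False)
    also have "\<dots> = charge c (bind_spmf (spmf_of_set (bit_vectors ?M)) (\<lambda>r. charge t1 (return_spmf (fin r, tm r))))"
    proof (intro arg_cong[of _ _ "charge c"] bind_spmf_cong refl)
      fix r assume "r \<in> set_spmf (spmf_of_set (bit_vectors ?M))"
      then have "r \<in> bit_vectors ?M" using set_spmf_of_set_finite[OF finite_bit_vectors] by blast
      then show "charge t1 (run deterministic_part (loop_state ?s ''i1'' ''r'' ?M r)) = charge t1 (return_spmf (fin r, tm r))"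
        by (simp only: fin(1))
    qed
    also have "\<dots> = map_spmf F (spmf_of_set (bit_vectors ?M))"
      by (simp add: charge_return charge_def F_def map_spmf_conv_bind_spmf bind_spmf_assoc)
    finally show "run long_cycle_program ?s = map_spmf F (spmf_of_set (bit_vectors ?M))" .
  next
    fix r assume r: "r \<in> bit_vectors ?M"
    show "accepts (fst (F r)) \<longleftrightarrow> ?acc r"
      using fin(3)[OF r] by (auto simp: accepts_def F_def)
    have "c \<le> expr_weight (Bin Less (var ''n'') (var ''k'')) * \<beta>\<^sup>2"
      unfolding c_def by (rule expr_cost_le[OF fits \<beta>1])
    also have "\<dots> \<le> ?W" by (intro mult_right_mono) (auto simp: total_weight_def)
    finally have c: "c \<le> ?W" .
    have "(1 + 3 * ?M) * (com_weight (toss_loop ''i1'' ''r'' coins_expr) * \<beta>\<^sup>2) \<le> (1 + 3 * ?M) * ?W"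
      by (intro mult_left_mono mult_right_mono) (auto simp: total_weight_def)
    moreover have "?steps * (com_weight deterministic_part * \<beta>\<^sup>2) \<le> ?steps * ?W"
      by (intro mult_left_mono mult_right_mono) (auto simp: total_weight_def)
    ultimately have "snd (F r) \<le> ?W + ((1 + 3 * ?M) * ?W + ?steps * ?W)"
      using c t1(1) fin(2)[OF r] unfolding F_def snd_conv by linarith
    also have "\<dots> = (1 + (1 + 3 * ?M + ?steps)) * ?W" by (simp only: distrib_right mult_1)
    also have "\<dots> \<le> step_bound n K * ?W"
    proof (rule mult_right_mono)
      have "(K + 1) * n \<le> (2 * n) * n" using K n by (intro mult_right_mono) auto
      then have "n * n * 2 ^ K * ((K + 1) * n) \<le> n * n * 2 ^ K * ((2 * n) * n)" by (rule mult_left_mono) simp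
      also have "\<dots> = 2 * n ^ 4 * 2 ^ K" by (simp add: power4_eq_xxxx)
      finally have N: "n * n * 2 ^ K * ((K + 1) * n) \<le> 2 * n ^ 4 * 2 ^ K" .
      have D: "n * ?D = 10 * n ^ 3" by (simp add: power2_eq_square power3_eq_cube)
      show "1 + (1 + 3 * ?M + ?steps) \<le> step_bound n K"
        unfolding step_bound_def M Z D using N by linarith
    qed simp
    finally show "snd (F r) \<le> step_bound n K * ?W" .
  qed
qed

text \<open>The error is one-sided: without a long cycle no coin vector is accepted, and with one at
  most a third are rejected.\<close>

lemma accepting_frequency:
  fixes G :: "nat pair_pre_digraph"
  assumes G: "pair_graph G" "pverts G = {..<n}" "bipartite G" and e: "(u, v) \<in> parcs G" and n: "n \<ge> 2" and k: "k \<le> n"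
  defines "\<Omega> \<equiv> bit_vectors (3 * n * n * (4 * n))"
    and "acc \<equiv> accepting (\<lambda>x y. (x, y) \<in> parcs G) n (label_count k) (4 * n) (2 ^ (9 * n\<^sup>2)) (10 * n\<^sup>2) u v"
  shows "2 * card \<Omega> \<le> 3 * card {r \<in> \<Omega>. acc r \<longleftrightarrow> long_cycle_through G (u, v) k}"
proof -
  interpret pair_graph G by (rule G(1))
  let ?E = "\<lambda>x y. (x, y) \<in> parcs G" and ?K = "label_count k"
  have uv: "u < n" "v < n" using in_arcsD1[OF e] in_arcsD2[OF e] G(2) by auto
  have K: "?K \<le> n" using n k by (auto simp: label_count_def)
  obtain A where v: "v \<in> A" and bip: "\<And>x y. ?E x y \<Longrightarrow> x \<in> A \<longleftrightarrow> y \<notin> A"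
  proof -
    obtain A B where AB: "pverts G = A \<union> B" "A \<inter> B = {}" "parcs G \<subseteq> A \<times> B \<union> B \<times> A"
      using G(3) unfolding bipartite_def by blast
    show thesis
    proof (cases "v \<in> A")
      case True
      then show ?thesis using AB that[of A] by blast
    next
      case False
      then have "v \<in> B" using uv AB(1) G(2) by auto
      then show ?thesis using AB that[of B] by blast
    qed
  qed
  have u: "u \<notin> A" using bip[OF e] v by blast
  have sym: "?E x y \<Longrightarrow> ?E y x" for x y by (rule arcs_symmetric)
  have "long_cycle_through G (u, v) k \<longleftrightarrow>
      (\<exists>p. path_between ?E {..<n} v p u \<and> ?K \<le> length (filter (\<lambda>x. x \<in> A) p))"
  proof -
    have "k \<le> length p \<and> 3 \<le> length p \<longleftrightarrow> ?K \<le> length (filter (\<lambda>x. x \<in> A) p)"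
      if "path_between ?E {..<n} v p u" for p
    proof (rule label_count_iff)
      show "length p = 2 * length (filter (\<lambda>x. x \<in> A) p)"
        using alternating_length[of ?E A p] bip that u v by (auto simp: path_between_def)
    qed
    then show ?thesis unfolding long_cycle_iff_path[OF G(1) e] G(2) by blast
  qed
  note answer = this
  show ?thesis
  proof (cases "long_cycle_through G (u, v) k")
    case True
    then obtain p where "path_between ?E {..<n} v p u" "?K \<le> length (filter (\<lambda>x. x \<in> A) p)"
      unfolding answer by blast
    then have "3 * card {r \<in> \<Omega>. \<not> acc r} \<le> card \<Omega>"
      unfolding \<Omega>_def acc_def
      by (intro path_imp_accepting[OF K n refl refl refl sym bip u uv(1) v uv(2)])
    moreover have "card \<Omega> = card {r \<in> \<Omega>. acc r} + card {r \<in> \<Omega>. \<not> acc r}"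
    proof -
      have "{r \<in> \<Omega>. acc r} \<union> {r \<in> \<Omega>. \<not> acc r} = \<Omega>" by blast
      then show ?thesis
        using card_Un_disjoint[of "{r \<in> \<Omega>. acc r}" "{r \<in> \<Omega>. \<not> acc r}"]
        by (auto simp: \<Omega>_def finite_bit_vectors)
    qed
    ultimately show ?thesis using True by simp
  next
    case False
    have "\<not> acc r" if "r \<in> \<Omega>" for r
      using accepting_imp_path[where E = ?E and A = A, OF K n refl refl refl sym bip u uv(1) v uv(2)] that False
      unfolding \<Omega>_def acc_def answer by blast
    then have "{r \<in> \<Omega>. acc r \<longleftrightarrow> long_cycle_through G (u, v) k} = \<Omega>" using False by blast
    then show ?thesis by simp
  qed
qed

text \<open>Serves the instances with \<open>k > n\<close>, where the crude cost bound is quadratic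
  in \<open>k\<close>. With j = k div 4, k is at most 4 * 2^j, and 2j is at most k/2.\<close>

lemma square_le_powr: "(real k)\<^sup>2 \<le> 16 * 2 powr (real k / 2)"
proof -
  define j where "j = k div 4"
  have "j < 2 ^ j" by (rule less_exp)
  moreover have "k \<le> 4 * j + 3" by (simp add: j_def)
  ultimately have "k \<le> 4 * 2 ^ j" by linarith
  then have "real k \<le> real (4 * 2 ^ j)" by (rule of_nat_mono)
  then have "(real k)\<^sup>2 \<le> (4 * 2 ^ j)\<^sup>2" by (intro power_mono) auto
  also have "\<dots> = 16 * 2 ^ (2 * j)" by (simp add: power_mult_distrib mult.commute flip: power_mult)
  also have "(2::real) ^ (2 * j) = 2 powr real (2 * j)" by (rule powr_realpow[symmetric]) simp
  also have "\<dots> \<le> 2 powr (real k / 2)" by (intro powr_mono) (auto simp: j_def)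
  finally show ?thesis by simp
qed

text \<open>Source of the exponent: rounding up and the minimum 2 add at most two labels to k/2, a
  factor of 4.\<close>

lemma power_label_count_le: "(2::real) ^ label_count k \<le> 4 * 2 powr (real k / 2)"
proof -
  have "real (label_count k) \<le> real k / 2 + 2" by (auto simp: label_count_def max_def)
  then have "2 powr real (label_count k) \<le> 2 powr (real k / 2 + 2)" by (intro powr_mono) auto
  then show ?thesis by (simp add: powr_realpow powr_add)
qed

lemma step_bound_le:
  assumes "n \<ge> 1"
  shows "real (step_bound n (label_count k)) \<le> 406 * real n ^ 4 * 2 powr (real k / 2)"
proof -
  let ?X = "2 powr (real k / 2)" and ?n = "real n"
  have X: "1 \<le> ?X" by (intro ge_one_powr_ge_zero) auto
  have n4: "1 \<le> ?n ^ 4" "?n ^ 3 \<le> ?n ^ 4" using assms by (auto intro: power_increasing)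
  have "real (step_bound n (label_count k)) =
      10 + 270 * ?n ^ 4 + 102 * ?n ^ 3 + 6 * ?n ^ 4 * 2 ^ label_count k"
    by (simp add: step_bound_def)
  also have "6 * ?n ^ 4 * 2 ^ label_count k \<le> 6 * ?n ^ 4 * (4 * ?X)"
    by (intro mult_left_mono power_label_count_le) auto
  also have "10 + 270 * ?n ^ 4 + 102 * ?n ^ 3 + 6 * ?n ^ 4 * (4 * ?X) \<le> 382 * (?n ^ 4 * 1) + 24 * (?n ^ 4 * ?X)"
    using n4 by (simp add: algebra_simps)
  also have "?n ^ 4 * 1 \<le> ?n ^ 4 * ?X" using X by (intro mult_left_mono) auto
  finally show ?thesis by (simp add: algebra_simps)
qed

theorem theorem1:
  shows "\<exists>(c :: com) (p :: real poly).
    \<forall>(G :: nat pair_pre_digraph) (n :: nat) (e :: nat \<times> nat) (k :: nat).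
      pair_graph G \<longrightarrow> pverts G = {..<n} \<longrightarrow> bipartite G \<longrightarrow> e \<in> parcs G \<longrightarrow> k > 0 \<longrightarrow>
      decides_within c (encode_instance G e k) (long_cycle_through G e k)
        (2 powr (real k / 2) * poly p (real n))"
proof -
  \<comment> \<open>406 is from \<open>step_bound_le\<close>, and 8281 is the square of 91, from
    90n^4 + 1 \<le> 91n^4 bits per number. The degree 12 is 4 for the steps and 8 for the cost of
    each.\<close>
  define C where "C = 406 * 8281 * real total_weight"
  have "decides_within long_cycle_program (encode_instance G (u, v) k) (long_cycle_through G (u, v) k)
      (2 powr (real k / 2) * poly (monom C 12) (real n))"
    if G: "pair_graph G" "pverts G = {..<n}" "bipartite G" and e: "(u, v) \<in> parcs G"
    for G :: "nat pair_pre_digraph" and n u v k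
  proof -
    interpret pair_graph G by (rule G(1))
    let ?s = "encode_instance G (u, v) k" and ?X = "2 powr (real k / 2)" and ?w = "real total_weight"
    have uv: "u < n" "v < n" "u \<noteq> v" using in_arcsD1[OF e] in_arcsD2[OF e] G(2) pair_no_loops[OF e] by auto
    then have n: "n \<ge> 2" by linarith
    have X: "1 \<le> ?X" by (intro ge_one_powr_ge_zero) auto
    have T: "?X * poly (monom C 12) (real n) = C * ?X * real n ^ 12" by (simp add: poly_monom)
    have w1: "1 \<le> ?w" by (simp add: total_weight_def)
    show ?thesis
    proof (cases "k \<le> n")
      case True
      let ?\<Omega> = "bit_vectors (3 * n * n * (4 * n))"
      let ?acc = "accepting (\<lambda>x y. (x, y) \<in> parcs G) n (label_count k) (4 * n) (2 ^ (9 * n\<^sup>2)) (10 * n\<^sup>2) u v"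
      obtain F where F: "run long_cycle_program ?s = map_spmf F (spmf_of_set ?\<Omega>)"
        "\<And>r. r \<in> ?\<Omega> \<Longrightarrow> accepts (fst (F r)) \<longleftrightarrow> ?acc r"
        "\<And>r. r \<in> ?\<Omega> \<Longrightarrow> snd (F r) \<le> step_bound n (label_count k) * (total_weight * (90 * n ^ 4 + 1)\<^sup>2)"
        using run_long_cycle_program[OF G(1,2) e n True] by blast
      have \<Omega>: "finite ?\<Omega>" "card ?\<Omega> > 0" "?\<Omega> \<noteq> {}"
        using finite_bit_vectors card_bit_vectors[of "3 * n * n * (4 * n)"] by (auto simp: card_gt_0_iff)
      have time: "real (snd (F r)) \<le> ?X * poly (monom C 12) (real n)" if "r \<in> ?\<Omega>" for r
      proof -
        have "1 \<le> n ^ 4" using n by (intro one_le_power) simp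
        then have "90 * n ^ 4 + 1 \<le> 91 * n ^ 4" by linarith
        then have "(90 * n ^ 4 + 1)\<^sup>2 \<le> (91 * n ^ 4)\<^sup>2" by (rule power_mono) simp
        also have "\<dots> = 8281 * n ^ 8" by (simp add: power_mult_distrib flip: power_mult)
        finally have "snd (F r) \<le> step_bound n (label_count k) * (total_weight * (8281 * n ^ 8))"
          using F(3)[OF that] by (meson le_trans mult_le_mono2)
        then have "real (snd (F r)) \<le> real (step_bound n (label_count k)) * (?w * (8281 * real n ^ 8))"
          by (metis (mono_tags, lifting) of_nat_mono of_nat_mult of_nat_numeral of_nat_power)
        also have "\<dots> \<le> (406 * real n ^ 4 * ?X) * (?w * (8281 * real n ^ 8))"
          using n by (intro mult_right_mono step_bound_le) auto
        also have "\<dots> = C * ?X * (real n ^ 4 * real n ^ 8)" by (simp add: C_def)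
        also have "real n ^ 4 * real n ^ 8 = real n ^ 12" by (simp flip: power_add)
        finally show ?thesis unfolding T .
      qed
      have "{r \<in> ?\<Omega>. ?acc r \<longleftrightarrow> long_cycle_through G (u, v) k} =
          ?\<Omega> \<inter> F -` {(s', t). accepts s' \<longleftrightarrow> long_cycle_through G (u, v) k}"
        using F(2) by (auto simp: case_prod_beta)
      then have "measure (measure_spmf (run long_cycle_program ?s)) {(s', t). accepts s' \<longleftrightarrow> long_cycle_through G (u, v) k} =
          card {r \<in> ?\<Omega>. ?acc r \<longleftrightarrow> long_cycle_through G (u, v) k} / card ?\<Omega>"
        by (simp add: F(1) measure_map_spmf measure_spmf_of_set)
      moreover have "2 * real (card ?\<Omega>) \<le> 3 * real (card {r \<in> ?\<Omega>. ?acc r \<longleftrightarrow> long_cycle_through G (u, v) k})"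
        using accepting_frequency[OF G e n True] by linarith
      then have "2 / 3 \<le> real (card {r \<in> ?\<Omega>. ?acc r \<longleftrightarrow> long_cycle_through G (u, v) k}) / card ?\<Omega>"
        using \<Omega>(2) by (subst pos_le_divide_eq) linarith+
      ultimately have "2 / 3 \<le> measure (measure_spmf (run long_cycle_program ?s))
          {(s', t). accepts s' \<longleftrightarrow> long_cycle_through G (u, v) k}"
        by (simp only:)
      then show ?thesis
        unfolding decides_within_def using time \<Omega> by (auto simp: F(1) case_prod_beta)
    next
      case False
      have s: "?s ''n'' 0 = n" "?s ''k'' 0 = k" "?s ''out'' 0 = 0"
        using G(2) by (auto simp: encode_instance_def Let_def)
      have "\<not> long_cycle_through G (u, v) k"
      proof
        assume "long_cycle_through G (u, v) k"
        then obtain p where "path_between (\<lambda>x y. (x, y) \<in> parcs G) {..<n} v p u" "k \<le> length p"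
          unfolding long_cycle_iff_path[OF G(1) e] G(2) by blast
        then have "k \<le> card (set p)" "card (set p) \<le> n"
          using card_mono[of "{..<n}" "set p"] by (auto simp: path_between_def distinct_card)
        then show False using False by simp
      qed
      let ?b = "Bin Less (var ''n'') (var ''k'')"
      have run: "run long_cycle_program ?s = return_spmf (?s, expr_cost ?b ?s + 1)"
        using False by (simp add: long_cycle_program_def s charge_return)
      \<comment> \<open>A word length of n + k is crude, but \<open>k > n\<close> bounds its square
        by 4k^2, which the exponential factor absorbs.\<close>
      have "fits (n + k) ?s"
      proof -
        have "?s x i \<le> n + k" for x i
          using uv n G(2) by (auto simp: encode_instance_def Let_def)
        then show ?thesis unfolding fits_def using less_exp[of "n + k"] by (meson le_less_trans)
      qed
      then have "expr_cost ?b ?s \<le> expr_weight ?b * (n + k)\<^sup>2" using n by (intro expr_cost_le) auto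
      also have "\<dots> \<le> expr_weight ?b * (2 * k)\<^sup>2" using False by (intro mult_left_mono power_mono) auto
      finally have "expr_cost ?b ?s + 1 \<le> expr_weight ?b * (2 * k)\<^sup>2 + 1 * (2 * k)\<^sup>2"
        using False n by (intro add_mono) (auto simp: Suc_le_eq)
      also have "\<dots> \<le> total_weight * (2 * k)\<^sup>2"
        unfolding distrib_right[symmetric] by (intro mult_right_mono) (auto simp: total_weight_def)
      finally have "real (expr_cost ?b ?s + 1) \<le> real (total_weight * (2 * k)\<^sup>2)" by (rule of_nat_mono)
      also have "\<dots> = 4 * ?w * (real k)\<^sup>2" by (simp add: power_mult_distrib)
      also have "\<dots> \<le> 4 * ?w * (16 * ?X)" by (intro mult_left_mono square_le_powr) auto
      also have "\<dots> = 64 * (?w * ?X) * 1" by simp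
      also have "\<dots> \<le> (406 * 8281) * (?w * ?X) * real n ^ 12"
        using n w1 X by (intro mult_mono one_le_power) auto
      also have "\<dots> = ?X * poly (monom C 12) (real n)" unfolding T by (simp add: C_def)
      finally have time: "real (expr_cost ?b ?s + 1) \<le> ?X * poly (monom C 12) (real n)" .
      have "\<not> accepts ?s" by (simp add: accepts_def s)
      then have "measure (measure_spmf (spmf_of_set {(?s, expr_cost ?b ?s + 1)}))
          {(s', t). accepts s' \<longleftrightarrow> long_cycle_through G (u, v) k} = 1"
        using \<open>\<not> long_cycle_through G (u, v) k\<close> unfolding measure_spmf_of_set by simp
      then show ?thesis
        unfolding decides_within_def run spmf_of_set_singleton using time by simp
    qed
  qed
  then show ?thesis by (metis surj_pair)
qed

end
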